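(* Let $\mathcal D\subset\mathbb R^d$ be a domain satisfying the standing assumptions in the context, with $\operatorname{diam}(\mathcal D)<\infty$. For measurable $A\subset\mathcal D$ let $\mathfrak m(A)$ be the mean time that the Knudsen stochastic billiard, started from a point $\tilde\xi_0$ uniformly distributed on $\partial\mathcal D$, spends in $A$ until the next hit $\tilde\xi_1$ of the boundary: $$\mathfrak m(A)=\mathbf E_{\hat\mu_0}\int_0^{\tau_1}\mathbf 1\{\tilde\xi_0+t\,\ell_{\tilde\xi_0,\tilde\xi_1}\in A\}\,dt .$$ Then $$\mathfrak m(A)=\kappa_d\,\frac{|A|}{|\partial\mathcal D|},\qquad \kappa_d:=\gamma_d|\mathbb S^{d-1}|=\frac{\pi^{1/2}\,\Gamma\big(\frac{d+1}{2}\big)\,d}{\Gamma\big(\frac d2+1\big)} .$$ In particular, the mean time $\bar{\mathfrak m}:=\mathfrak m(\mathcal D)$ between consecutive hits of the boundary equals $\kappa_d\frac{|\mathcal D|}{|\partial\mathcal D|}$.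
   Context: Notation: $d\ge 2$; $\|\cdot\|$ is the Euclidean norm, $\mathcal B(x,\varepsilon)$ the open ball, $\mathbb S^{d-1}$ the unit sphere with total surface measure $|\mathbb S^{d-1}|$, $e=(1,0,\dots,0)$, $\mathbb S_v=\{w\in\mathbb S^{d-1}:v\cdot w>0\}$, and $\ell_{x,y}=(y-x)/\|y-x\|$. $|A|$ denotes $d$-dimensional Lebesgue measure for $A\subset\mathcal D$ and $(d-1)$-dimensional Hausdorff measure for $A\subset\partial\mathcal D$. Standing assumptions on the domain: $\mathcal D\subset\mathbb R^d$ is open and connected, and (Lipschitz condition) for every $x\in\partial\mathcal D$ there exist $\varepsilon_x>0$, an affine isometry $\mathfrak I_x:\mathbb R^d\to\mathbb R^d$ with $\mathfrak I_x x=0$ and a Lipschitz function $f_x:\mathbb R^{d-1}\to\mathbb R$ with $f_x(0)=0$ such that $\mathfrak I_x(\mathcal D\cap\mathcal B(x,\varepsilon_x))=\{z\in\mathcal B(0,\varepsilon_x):z^{(d)}>f_x(z^{(1)},\dots,z^{(d-1)})\}$. Moreover there is a relatively open set $\mathcal R\subset\partial\mathcal D$, with $|\partial\mathcal D\setminus\mathcal R|=0$, such that $\partial\mathcal D$ has a local $C^1$ parametrization at each point of $\mathcal R$. For $x\in\mathcal R$, $\mathbf n(x)$ is the unit normal vector pointing into $\mathcal D$. Knudsen dynamics: $\gamma_d=\big(\int_{\mathbb S_e}u\cdot e\,du\big)^{-1}$ ($du$ surface measure). $\tilde\xi_0$ has the uniform distribution $\hat\mu_0(B)=|B|/|\partial\mathcal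 D|$ on $\partial\mathcal D$; given $\tilde\xi_0=x\in\mathcal R$, a direction $u\in\mathbb S_{\mathbf n(x)}$ is chosen with density $\gamma_d\,u\cdot\mathbf n(x)$ with respect to surface measure, $\tau_1=\inf\{t>0:x+tu\in\partial\mathcal D\}$ and $\tilde\xi_1=x+\tau_1u$. *)

theory Defs
  imports "HOL-Analysis.Analysis"
begin

section \<open>Hausdorff measure\<close>

text \<open>
  The standard normalisation is used: the factor in front of \<open>diameter ^ k\<close> makes the
  \<open>k\<close>-dimensional Hausdorff measure agree with \<open>k\<close>-dimensional Lebesgue measure (and with the
  usual surface measure on \<open>k\<close>-dimensional surfaces).  The case distinction on the empty set only
  matters for \<open>k = 0\<close>, where \<open>0 ^ 0 = 1\<close>.
\<close>

definition hausdorff_weight :: "nat \<Rightarrow> 'a::metric_space set \<Rightarrow> ennreal" where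
  "hausdorff_weight k C =
     (if C = {} then 0 else ennreal (unit_ball_vol (real k) * (diameter C / 2) ^ k))"

definition hausdorff_pre :: "nat \<Rightarrow> real \<Rightarrow> 'a::metric_space set \<Rightarrow> ennreal" where
  "hausdorff_pre k \<delta> A =
     (INF C \<in> {C :: nat \<Rightarrow> 'a set. A \<subseteq> (\<Union>i. C i) \<and> (\<forall>i. bounded (C i) \<and> diameter (C i) \<le> \<delta>)}.
        \<Sum>i. hausdorff_weight k (C i))"

definition hausdorff_outer :: "nat \<Rightarrow> 'a::metric_space set \<Rightarrow> ennreal" where
  "hausdorff_outer k A = (SUP \<delta>\<in>{0<..}. hausdorff_pre k \<delta> A)"

text \<open>
  The constant \<open>measure_of\<close> yields the null measure if its third argument is not countably additive
  on the given sigma algebra; the lemma \<open>emeasure_hausdorff_measure\<close> below shows that this does not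
  happen here.
\<close>

definition hausdorff_measure :: "nat \<Rightarrow> 'a::metric_space measure" where
  "hausdorff_measure k = measure_of UNIV (sets borel) (hausdorff_outer k)"

lemma space_hausdorff_measure [simp]: "space (hausdorff_measure k) = UNIV"
  by (simp add: hausdorff_measure_def space_measure_of_conv)

lemma sets_hausdorff_measure [simp, measurable_cong]: "sets (hausdorff_measure k) = sets borel"
  unfolding hausdorff_measure_def
  by (metis sets.sigma_sets_eq sets.space_closed sets_measure_of space_borel)

lemma hausdorff_weight_empty [simp]: "hausdorff_weight k {} = 0"
  by (simp add: hausdorff_weight_def)

lemma hausdorff_pre_lower:
  assumes "A \<subseteq> (\<Union>i. C i)" "\<And>i. bounded (C i)" "\<And>i. diameter (C i) \<le> \<delta>"
  shows "hausdorff_pre k \<delta> A \<le> (\<Sum>i. hausdorff_weight k (C i))"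
  unfolding hausdorff_pre_def by (rule INF_lower) (use assms in auto)

lemma hausdorff_pre_antimono:
  assumes "\<delta> \<le> \<delta>'"
  shows "hausdorff_pre k \<delta>' A \<le> hausdorff_pre k \<delta> A"
  unfolding hausdorff_pre_def by (rule INF_superset_mono) (use assms in \<open>auto intro: order_trans\<close>)

lemma hausdorff_pre_mono:
  assumes "A \<subseteq> B"
  shows "hausdorff_pre k \<delta> A \<le> hausdorff_pre k \<delta> B"
  unfolding hausdorff_pre_def by (rule INF_superset_mono) (use assms in auto)

lemma hausdorff_outer_mono:
  assumes "A \<subseteq> B"
  shows "hausdorff_outer k A \<le> hausdorff_outer k B"
  unfolding hausdorff_outer_def by (intro SUP_mono) (use hausdorff_pre_mono[OF assms] in auto)

lemma hausdorff_pre_le_outer: "\<delta> > 0 \<Longrightarrow> hausdorff_pre k \<delta> A \<le> hausdorff_outer k A"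
  unfolding hausdorff_outer_def by (intro SUP_upper) auto

lemma hausdorff_outer_empty [simp]: "hausdorff_outer k {} = 0"
proof -
  have "hausdorff_pre k \<delta> ({} :: 'a set) = 0" if "\<delta> > 0" for \<delta>
  proof -
    have "hausdorff_pre k \<delta> ({} :: 'a set) \<le> (\<Sum>i. hausdorff_weight k ((\<lambda>_::nat. {} :: 'a set) i))"
      by (rule hausdorff_pre_lower) (use that in auto)
    then show ?thesis by simp
  qed
  then show ?thesis
    unfolding hausdorff_outer_def by (intro antisym SUP_least) auto
qed

lemma hausdorff_pre_subadditive:
  fixes A :: "nat \<Rightarrow> 'a::metric_space set"
  shows "hausdorff_pre k \<delta> (\<Union>i. A i) \<le> (\<Sum>i. hausdorff_pre k \<delta> (A i))"
proof (rule ennreal_le_epsilon)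
  fix e :: real
  assume e: "0 < e" and fin: "(\<Sum>i. hausdorff_pre k \<delta> (A i)) < top"
  have fin': "hausdorff_pre k \<delta> (A i) \<noteq> top" for i
    using ennreal_suminf_lessD[OF fin, of i] by simp
  have "\<exists>C. A i \<subseteq> (\<Union>j. C j) \<and> (\<forall>j. bounded (C j) \<and> diameter (C j) \<le> \<delta>) \<and>
      (\<Sum>j. hausdorff_weight k (C j)) \<le> hausdorff_pre k \<delta> (A i) + ennreal (e * (1/2) ^ Suc i)"
    (is "\<exists>C. ?P i C") for i
  proof -
    have "hausdorff_pre k \<delta> (A i) < hausdorff_pre k \<delta> (A i) + ennreal (e * (1/2) ^ Suc i)"
      using fin'[of i] e
      by (metis ennreal_add_left_cancel_less add_0_right ennreal_less_zero_iff half_gt_zero_iff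
          infinity_ennreal_def less_numeral_extra(1) mult_pos_pos zero_less_power)
    then have "\<exists>C\<in>{C. A i \<subseteq> (\<Union>j. C j) \<and> (\<forall>j. bounded (C j) \<and> diameter (C j) \<le> \<delta>)}.
        (\<Sum>j. hausdorff_weight k (C j)) < hausdorff_pre k \<delta> (A i) + ennreal (e * (1/2) ^ Suc i)"
      by (subst (asm) hausdorff_pre_def) (simp only: INF_less_iff)
    then show ?thesis
      by (auto intro: less_imp_le)
  qed
  then obtain C where C: "\<And>i. ?P i (C i)"
    by metis
  define B where "B n = (case prod_decode n of (i, j) \<Rightarrow> C i j)" for n
  have "(\<Union>i. A i) \<subseteq> (\<Union>n. B n)"
  proof
    fix x assume "x \<in> (\<Union>i. A i)"
    then obtain i j where "x \<in> C i j"
      using C by blast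
    then have "x \<in> B (prod_encode (i, j))"
      by (simp add: B_def)
    then show "x \<in> (\<Union>n. B n)" by blast
  qed
  then have "hausdorff_pre k \<delta> (\<Union>i. A i) \<le> (\<Sum>n. hausdorff_weight k (B n))"
    by (rule hausdorff_pre_lower) (use C in \<open>auto simp: B_def split: prod.split\<close>)
  also have "\<dots> = (\<Sum>n. (\<lambda>(i, j). hausdorff_weight k (C i j)) (prod_decode n))"
    by (simp add: B_def split_def)
  also have "\<dots> = (\<Sum>i. \<Sum>j. hausdorff_weight k (C i j))"
    by (rule suminf_ennreal_2dimen) simp
  also have "\<dots> \<le> (\<Sum>i. hausdorff_pre k \<delta> (A i) + ennreal (e * (1/2) ^ Suc i))"
    using C by (intro suminf_le) auto
  also have "\<dots> = (\<Sum>i. hausdorff_pre k \<delta> (A i)) + (\<Sum>i. ennreal (e * (1/2) ^ Suc i))"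
    by (rule suminf_add[symmetric]) auto
  also have "(\<Sum>i. ennreal (e * (1/2) ^ Suc i)) = ennreal e"
    using sums_mult[OF power_half_series, of e] e
    by (intro suminf_ennreal_eq) auto
  finally show "hausdorff_pre k \<delta> (\<Union>i. A i) \<le> (\<Sum>i. hausdorff_pre k \<delta> (A i)) + ennreal e" .
qed

lemma hausdorff_outer_subadditive:
  fixes A :: "nat \<Rightarrow> 'a::metric_space set"
  shows "hausdorff_outer k (\<Union>i. A i) \<le> (\<Sum>i. hausdorff_outer k (A i))"
proof -
  have "hausdorff_pre k \<delta> (\<Union>i. A i) \<le> (\<Sum>i. hausdorff_outer k (A i))" if "\<delta> > 0" for \<delta>
    using that
    by (intro order_trans[OF hausdorff_pre_subadditive] suminf_le)
       (auto intro: hausdorff_pre_le_outer)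
  then show ?thesis
    by (subst hausdorff_outer_def) (auto intro: SUP_least)
qed

lemma outer_measure_space_hausdorff: "outer_measure_space UNIV (hausdorff_outer k)"
  unfolding outer_measure_space_def positive_def increasing_def countably_subadditive_def
  by (auto intro: hausdorff_outer_mono hausdorff_outer_subadditive)

lemma hausdorff_outer_Un:
  "hausdorff_outer k (A \<union> B) \<le> hausdorff_outer k A + hausdorff_outer k B"
proof -
  let ?C = "\<lambda>i::nat. if i = 0 then A else if i = 1 then B else {}"
  have "A \<union> B = (\<Union>i. ?C i)"
  proof (intro equalityI subsetI)
    fix x assume "x \<in> A \<union> B"
    then have "x \<in> ?C 0 \<or> x \<in> ?C 1" by auto
    then show "x \<in> (\<Union>i. ?C i)" by blast
  qed (auto split: if_splits)
  then have "hausdorff_outer k (A \<union> B) \<le> (\<Sum>i. hausdorff_outer k (?C i))"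
    using hausdorff_outer_subadditive[of k ?C] by simp
  also have "\<dots> = (\<Sum>i\<in>{0,1}. hausdorff_outer k (?C i))"
    by (rule suminf_finite) auto
  also have "\<dots> = hausdorff_outer k A + hausdorff_outer k B"
    by simp
  finally show ?thesis .
qed

lemma hausdorff_outer_metric:
  fixes A B :: "'a::metric_space set"
  assumes r: "r > 0" and AB: "\<And>x y. x \<in> A \<Longrightarrow> y \<in> B \<Longrightarrow> r \<le> dist x y"
  shows "hausdorff_outer k A + hausdorff_outer k B \<le> hausdorff_outer k (A \<union> B)"
proof -
  have small: "hausdorff_pre k \<delta> A + hausdorff_pre k \<delta> B \<le> hausdorff_pre k \<delta> (A \<union> B)"
    if \<delta>: "0 < \<delta>" "\<delta> < r" for \<delta>
    unfolding hausdorff_pre_def[of k \<delta> "A \<union> B"]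
  proof (rule INF_greatest, clarify)
    fix C :: "nat \<Rightarrow> 'a set"
    assume cov: "A \<union> B \<subseteq> (\<Union>i. C i)" and C: "\<forall>i. bounded (C i) \<and> diameter (C i) \<le> \<delta>"
    define CA where "CA i = (if C i \<inter> A = {} then {} else C i)" for i
    define CB where "CB i = (if C i \<inter> B = {} then {} else C i)" for i
    have "C i \<inter> A = {} \<or> C i \<inter> B = {}" for i
    proof (rule ccontr)
      assume "\<not> ?thesis"
      then obtain x y where xy: "x \<in> C i" "x \<in> A" "y \<in> C i" "y \<in> B" by blast
      then have "dist x y \<le> diameter (C i)"
        using C diameter_bounded_bound by blast
      then show False
        using C[rule_format, of i] AB[OF xy(2,4)] \<delta> by linarith
    qed
    then have le: "hausdorff_weight k (CA i) + hausdorff_weight k (CB i) \<le> hausdorff_weight k (C i)"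
      for i by (cases "C i \<inter> A = {}") (auto simp: CA_def CB_def)
    have "hausdorff_pre k \<delta> A \<le> (\<Sum>i. hausdorff_weight k (CA i))"
    proof (rule hausdorff_pre_lower)
      show "A \<subseteq> (\<Union>i. CA i)"
      proof
        fix x assume x: "x \<in> A"
        then obtain i where "x \<in> C i" using cov by blast
        then have "x \<in> CA i" using x by (auto simp: CA_def)
        then show "x \<in> (\<Union>i. CA i)" by blast
      qed
    qed (use C \<delta> in \<open>auto simp: CA_def\<close>)
    moreover have "hausdorff_pre k \<delta> B \<le> (\<Sum>i. hausdorff_weight k (CB i))"
    proof (rule hausdorff_pre_lower)
      show "B \<subseteq> (\<Union>i. CB i)"
      proof
        fix x assume x: "x \<in> B"
        then obtain i where "x \<in> C i" using cov by blast
        then have "x \<in> CB i" using x by (auto simp: CB_def)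
        then show "x \<in> (\<Union>i. CB i)" by blast
      qed
    qed (use C \<delta> in \<open>auto simp: CB_def\<close>)
    ultimately have "hausdorff_pre k \<delta> A + hausdorff_pre k \<delta> B
        \<le> (\<Sum>i. hausdorff_weight k (CA i)) + (\<Sum>i. hausdorff_weight k (CB i))"
      by (rule add_mono)
    also have "\<dots> = (\<Sum>i. hausdorff_weight k (CA i) + hausdorff_weight k (CB i))"
      by (rule suminf_add) auto
    also have "\<dots> \<le> (\<Sum>i. hausdorff_weight k (C i))"
      by (intro suminf_le le) auto
    finally show "hausdorff_pre k \<delta> A + hausdorff_pre k \<delta> B \<le> (\<Sum>i. hausdorff_weight k (C i))" .
  qed
  have main: "hausdorff_pre k \<delta>1 A + hausdorff_pre k \<delta>2 B \<le> hausdorff_outer k (A \<union> B)"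
    if "\<delta>1 > 0" "\<delta>2 > 0" for \<delta>1 \<delta>2
  proof -
    define \<delta> where "\<delta> = min (min \<delta>1 \<delta>2) (r / 2)"
    have \<delta>: "0 < \<delta>" "\<delta> < r" "\<delta> \<le> \<delta>1" "\<delta> \<le> \<delta>2"
      using that r by (auto simp: \<delta>_def)
    have "hausdorff_pre k \<delta>1 A + hausdorff_pre k \<delta>2 B \<le> hausdorff_pre k \<delta> A + hausdorff_pre k \<delta> B"
      using \<delta> by (intro add_mono hausdorff_pre_antimono)
    also have "\<dots> \<le> hausdorff_pre k \<delta> (A \<union> B)"
      using \<delta> by (intro small)
    also have "\<dots> \<le> hausdorff_outer k (A \<union> B)"
      using \<delta> by (intro hausdorff_pre_le_outer)
    finally show ?thesis .
  qed
  have ne: "{0::real<..} \<noteq> {}"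
    by (auto intro: exI[of _ 1])
  have one: "hausdorff_outer k A + hausdorff_pre k \<delta> B \<le> hausdorff_outer k (A \<union> B)"
    if "\<delta> > 0" for \<delta>
    unfolding hausdorff_outer_def[of k A]
    by (subst ennreal_SUP_add_left[symmetric, OF ne]) (use main that in \<open>auto intro!: SUP_least\<close>)
  show ?thesis
    unfolding hausdorff_outer_def[of k B]
    by (subst ennreal_SUP_add_right[OF ne]) (use one in \<open>auto intro!: SUP_least\<close>)
qed

lemma hausdorff_outer_shells:
  fixes R :: "nat \<Rightarrow> 'a::metric_space set" and g :: "'a \<Rightarrow> real" and s t :: "nat \<Rightarrow> real"
  assumes g: "\<And>x y. g x - g y \<le> dist x y"
    and lo: "\<And>i x. x \<in> R i \<Longrightarrow> s i \<le> g x" and hi: "\<And>i x. x \<in> R i \<Longrightarrow> g x \<le> t i"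
    and s: "decseq s" and st: "\<And>i. t (Suc i) < s i" and X: "\<And>i. R i \<subseteq> X"
  shows "(\<Sum>i. hausdorff_outer k (R i)) \<le> hausdorff_outer k X"
proof -
  have "(\<Sum>i<m. hausdorff_outer k (R i)) \<le> hausdorff_outer k (\<Union>i<m. R i)" for m
  proof (induction m)
    case (Suc m)
    have "(\<Sum>i<Suc m. hausdorff_outer k (R i))
        \<le> hausdorff_outer k (\<Union>i<m. R i) + hausdorff_outer k (R m)"
      using Suc by (simp add: add_right_mono)
    also have "\<dots> \<le> hausdorff_outer k ((\<Union>i<m. R i) \<union> R m)"
    proof (cases m)
      case (Suc n)
      have "s n - t m \<le> dist x y" if xy: "x \<in> (\<Union>i<m. R i)" "y \<in> R m" for x y
      proof -
        obtain i where i: "i < m" "x \<in> R i" using xy(1) by blast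
        have "s n \<le> s i" using s i Suc by (simp add: decseq_def)
        then show ?thesis using lo[OF i(2)] hi[OF xy(2)] g[of x y] by linarith
      qed
      then show ?thesis
        by (intro hausdorff_outer_metric[of "s n - t m"]) (use st[of n] Suc in auto)
    qed simp
    also have "(\<Union>i<m. R i) \<union> R m = (\<Union>i<Suc m. R i)"
      by (auto simp: less_Suc_eq)
    finally show ?case .
  qed simp
  then have "(\<Sum>i<m. hausdorff_outer k (R i)) \<le> hausdorff_outer k X" for m
    using hausdorff_outer_mono[of "\<Union>i<m. R i" X k] X by (meson UN_least order_trans)
  then show ?thesis
    by (simp add: suminf_eq_SUP SUP_least)
qed

lemma closed_hausdorff_caratheodory:
  fixes F X :: "'a::metric_space set"
  assumes F: "closed F"
  shows "hausdorff_outer k (X \<inter> F) + hausdorff_outer k (X - F) \<le> hausdorff_outer k X"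
proof (cases "F = {} \<or> hausdorff_outer k X = top")
  case True
  then show ?thesis by auto
next
  case False
  then have ne: "F \<noteq> {}" and fin: "hausdorff_outer k X < top"
    by (auto simp: less_top)
  define g where "g x = infdist x F" for x
  have g: "g x - g y \<le> dist x y" for x y
    using infdist_triangle[of x F y] by (simp add: g_def)
  have g0: "g x = 0 \<longleftrightarrow> x \<in> F" and gnn: "g x \<ge> 0" for x
    using in_closed_iff_infdist_zero[OF F ne, of x] by (auto simp: g_def infdist_nonneg)
  define Y where "Y n = {x\<in>X. 1 / real (Suc n) \<le> g x}" for n
  define R where "R n = {x\<in>X. 1 / real (n + 2) \<le> g x \<and> g x < 1 / real (n + 1)}" for n
  have "(\<Sum>i. hausdorff_outer k (R (2 * i))) \<le> hausdorff_outer k X"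
    by (rule hausdorff_outer_shells[where g = g and
          s = "\<lambda>i. 1 / real (2 * i + 2)" and t = "\<lambda>i. 1 / real (2 * i + 1)"])
       (use g in \<open>auto simp: R_def decseq_def frac_le frac_less2\<close>)
  moreover have "(\<Sum>i. hausdorff_outer k (R (2 * i + 1))) \<le> hausdorff_outer k X"
    by (rule hausdorff_outer_shells[where g = g and
          s = "\<lambda>i. 1 / (3 + 2 * real i)" and t = "\<lambda>i. 1 / real (2 * i + 2)"])
       (use g in \<open>auto simp: R_def decseq_def frac_le frac_less2\<close>)
  moreover have split: "(\<Sum>i<2 * m. hausdorff_outer k (R i)) =
      (\<Sum>i<m. hausdorff_outer k (R (2 * i))) + (\<Sum>i<m. hausdorff_outer k (R (2 * i + 1)))" for m
    by (induction m) (auto simp: algebra_simps)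
  ultimately have "(\<Sum>i<m. hausdorff_outer k (R i)) \<le> hausdorff_outer k X + hausdorff_outer k X" for m
  proof -
    assume 1: "(\<Sum>i. hausdorff_outer k (R (2 * i))) \<le> hausdorff_outer k X"
      and 2: "(\<Sum>i. hausdorff_outer k (R (2 * i + 1))) \<le> hausdorff_outer k X"
    have "(\<Sum>i<m. hausdorff_outer k (R i)) \<le> (\<Sum>i<2 * m. hausdorff_outer k (R i))"
      by (intro sum_mono2) auto
    also have "\<dots> \<le> (\<Sum>i. hausdorff_outer k (R (2 * i))) + (\<Sum>i. hausdorff_outer k (R (2 * i + 1)))"
      unfolding split by (intro add_mono sum_le_suminf) auto
    also have "\<dots> \<le> hausdorff_outer k X + hausdorff_outer k X"
      by (intro add_mono 1 2)
    finally show ?thesis .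
  qed
  then have "(\<Sum>i. hausdorff_outer k (R i)) \<le> hausdorff_outer k X + hausdorff_outer k X"
    by (simp add: suminf_eq_SUP SUP_least)
  then have finR: "(\<Sum>i. hausdorff_outer k (R i)) < top"
    using fin by (simp add: order_le_less_trans)
  define h where "h i = enn2real (hausdorff_outer k (R i))" for i
  have hR: "hausdorff_outer k (R i) = ennreal (h i)" for i
    using finR ennreal_suminf_lessD[of "\<lambda>i. hausdorff_outer k (R i)" top i] by (auto simp: h_def)
  have hnn: "h i \<ge> 0" for i
    by (simp add: h_def)
  have sh: "summable h"
    using finR hnn by (intro summable_suminf_not_top) (auto simp: hR)
  show ?thesis
  proof (rule ennreal_le_epsilon)
    fix e :: real assume e: "0 < e"
    obtain N where N: "norm (\<Sum>i. h (i + N)) < e"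
      using suminf_exist_split[OF e sh] by blast
    have tail: "(\<Sum>i. hausdorff_outer k (R (i + N))) \<le> ennreal e"
    proof -
      have "(\<Sum>i. hausdorff_outer k (R (i + N))) = ennreal (\<Sum>i. h (i + N))"
        unfolding hR using sh hnn by (intro suminf_ennreal2) (auto simp: summable_iff_shift)
      then show ?thesis using N by (simp add: ennreal_leI)
    qed
    have "X - F \<subseteq> Y N \<union> (\<Union>i. R (i + N))"
    proof
      fix x assume x: "x \<in> X - F"
      then have gx: "g x > 0" using g0[of x] gnn[of x] by auto
      show "x \<in> Y N \<union> (\<Union>i. R (i + N))"
      proof (cases "1 / real (Suc N) \<le> g x")
        case True
        then show ?thesis using x by (auto simp: Y_def)
      next
        case notY: False
        obtain n where "1 / real (Suc n) < g x"
          by (rule nat_approx_posE[OF gx])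
        then have "\<exists>n. 1 / real (Suc n) \<le> g x"
          by (blast intro: less_imp_le)
        then obtain m where m: "1 / real (Suc m) \<le> g x"
          and min: "\<And>n. n < m \<Longrightarrow> \<not> 1 / real (Suc n) \<le> g x"
          using exists_least_iff[of "\<lambda>n. 1 / real (Suc n) \<le> g x"] by blast
        have mN: "N < m"
        proof (rule ccontr)
          assume "\<not> N < m"
          then have "1 / real (Suc N) \<le> 1 / real (Suc m)"
            by (intro divide_left_mono) auto
          then show False using m notY by linarith
        qed
        then have "\<not> 1 / real (Suc (m - 1)) \<le> g x"
          by (intro min) simp
        then have "x \<in> R (m - 1)"
          using m mN x by (auto simp: R_def not_le)
        moreover have "m - 1 = (m - 1 - N) + N" using mN by simp
        ultimately show ?thesis by (metis UNIV_I UN_I UnI2)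
      qed
    qed
    then have "hausdorff_outer k (X - F) \<le> hausdorff_outer k (Y N) + hausdorff_outer k (\<Union>i. R (i + N))"
      by (meson hausdorff_outer_Un hausdorff_outer_mono order_trans)
    also have "\<dots> \<le> hausdorff_outer k (Y N) + ennreal e"
      by (intro add_left_mono order_trans[OF hausdorff_outer_subadditive tail])
    finally have "hausdorff_outer k (X \<inter> F) + hausdorff_outer k (X - F)
        \<le> hausdorff_outer k (X \<inter> F) + hausdorff_outer k (Y N) + ennreal e"
      by (simp add: add_left_mono add.assoc)
    also have "hausdorff_outer k (X \<inter> F) + hausdorff_outer k (Y N) \<le> hausdorff_outer k ((X \<inter> F) \<union> Y N)"
    proof (rule hausdorff_outer_metric[of "1 / real (Suc N)"])
      fix x y assume "x \<in> X \<inter> F" "y \<in> Y N"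
      then show "1 / real (Suc N) \<le> dist x y"
        using g[of y x] g0[of x] by (auto simp: Y_def dist_commute)
    qed simp
    also have "\<dots> \<le> hausdorff_outer k X"
      by (intro hausdorff_outer_mono) (auto simp: Y_def)
    finally show "hausdorff_outer k (X \<inter> F) + hausdorff_outer k (X - F) \<le> hausdorff_outer k X + ennreal e"
      by (simp add: add_right_mono)
  qed
qed

lemma measure_space_hausdorff:
  "measure_space UNIV (sets (borel :: 'a::metric_space measure)) (hausdorff_outer k)"
proof -
  interpret P: sigma_algebra "UNIV :: 'a set" UNIV
    using sigma_algebra_Pow[of "UNIV :: 'a set"] by simp
  let ?L = "lambda_system UNIV UNIV (hausdorff_outer k :: 'a set \<Rightarrow> ennreal)"
  have ms: "measure_space UNIV ?L (hausdorff_outer k)"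
    by (rule P.caratheodory_lemma[OF outer_measure_space_hausdorff])
  then have sa: "sigma_algebra UNIV ?L"
    by (simp add: measure_space_def)
  have "closed F \<Longrightarrow> F \<in> ?L" for F :: "'a set"
    unfolding P.lambda_system_eq
    using closed_hausdorff_caratheodory[of F k]
      hausdorff_outer_Un[of k "X \<inter> F" "X - F" for X, unfolded Int_Diff_Un]
    by (auto intro!: antisym)
  then have "sigma_sets UNIV {S. closed S} \<subseteq> ?L"
    by (intro sigma_algebra.sigma_sets_subset[OF sa]) auto
  then have "sets (borel :: 'a measure) \<subseteq> ?L"
    by (simp add: borel_eq_closed)
  then show ?thesis
    by (rule measure_down[OF ms sets.sigma_algebra_axioms[of borel, simplified]])
qed

lemma emeasure_hausdorff_measure:
  assumes "A \<in> sets borel"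
  shows "emeasure (hausdorff_measure k) A = hausdorff_outer k A"
proof -
  have "measure_space UNIV (sigma_sets UNIV (sets (borel :: 'a measure))) (hausdorff_outer k)"
    using measure_space_hausdorff sets.sigma_sets_eq[of "borel :: 'a measure"] by simp
  then show ?thesis
    using assms unfolding hausdorff_measure_def
    by (subst emeasure_measure_of_conv) (auto simp: sets.sigma_sets_eq[of borel, simplified])
qed


section \<open>Coordinates\<close>

text \<open>
  Euclidean space \<open>\<real>\<^sup>d\<close> is \<open>real^'n\<close> with \<open>d = CARD('n)\<close>.  The linear order on the finite index
  type gives a meaning to the first and to the last coordinate, and \<open>\<real>\<^bsup>d-1\<^esup>\<close> is identified with the
  coordinate hyperplane of all vectors whose last coordinate vanishes.
\<close>

definition last_index :: "'n::{finite,wellorder}" where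
  "last_index = Max UNIV"

definition first_unit :: "real^'n::{finite,wellorder}" where
  "first_unit = axis (Min UNIV) 1"

definition base_space :: "(real^'n::{finite,wellorder}) set" where
  "base_space = {z. z $ last_index = 0}"

definition base_part :: "real^'n::{finite,wellorder} \<Rightarrow> real^'n::_" where
  "base_part z = (\<chi> i. if i = last_index then 0 else z $ i)"

definition surface_measure :: "(real^'n) measure" where
  "surface_measure = hausdorff_measure (CARD('n) - 1)"


section \<open>Boundary regularity\<close>

definition affine_isometry :: "(real^'n \<Rightarrow> real^'n) \<Rightarrow> bool" where
  "affine_isometry I \<longleftrightarrow> (\<exists>T c. orthogonal_transformation T \<and> I = (\<lambda>y. T y + c))"

definition lipschitz_boundary :: "(real^'n::{finite,wellorder}) set \<Rightarrow> bool" where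
  "lipschitz_boundary D \<longleftrightarrow>
     (\<forall>x \<in> frontier D. \<exists>\<epsilon> > 0. \<exists>I f L.
        affine_isometry I \<and> I x = 0 \<and>
        L-lipschitz_on base_space f \<and> f 0 = (0::real) \<and>
        I ` (D \<inter> ball x \<epsilon>) = {z \<in> ball 0 \<epsilon>. z $ last_index > f (base_part z)})"

text \<open>
  A regular \<open>C\<^sup>1\<close> parametrization \<open>\<phi>\<close>, with derivative \<open>\<phi>'\<close>, of a relatively open piece \<open>\<phi> ` U\<close> of
  the hypersurface \<open>S\<close>; the parameter domain \<open>U\<close> is an open subset of \<open>\<real>\<^bsup>d-1\<^esup>\<close>.
\<close>

definition C1_parametrization ::
  "(real^'n::{finite,wellorder}) set \<Rightarrow> (real^'n::_) set \<Rightarrow> (real^'n::_ \<Rightarrow> real^'n::_)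
     \<Rightarrow> (real^'n::_ \<Rightarrow> real^'n::_ \<Rightarrow> real^'n::_) \<Rightarrow> bool" where
  "C1_parametrization S U \<phi> \<phi>' \<longleftrightarrow>
     openin (top_of_set base_space) U \<and>
     openin (top_of_set S) (\<phi> ` U) \<and>
     (\<exists>\<psi>. homeomorphism U (\<phi> ` U) \<phi> \<psi>) \<and>
     (\<forall>z \<in> U. (\<phi> has_derivative \<phi>' z) (at z within U) \<and> inj_on (\<phi>' z) base_space) \<and>
     (\<forall>h \<in> base_space. continuous_on U (\<lambda>z. \<phi>' z h))"

definition locally_C1_at :: "(real^'n::{finite,wellorder}) set \<Rightarrow> real^'n::_ \<Rightarrow> bool" where
  "locally_C1_at S x \<longleftrightarrow> (\<exists>U \<phi> \<phi>'. C1_parametrization S U \<phi> \<phi>' \<and> x \<in> \<phi> ` U)"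

definition inward_unit_normal ::
  "(real^'n::{finite,wellorder}) set \<Rightarrow> real^'n::_ \<Rightarrow> real^'n::_ \<Rightarrow> bool" where
  "inward_unit_normal D x v \<longleftrightarrow>
     norm v = 1 \<and>
     (\<exists>U \<phi> \<phi>'. C1_parametrization (frontier D) U \<phi> \<phi>' \<and>
        (\<exists>z \<in> U. \<phi> z = x \<and> (\<forall>h \<in> base_space. v \<bullet> \<phi>' z h = 0))) \<and>
     (\<forall>\<^sub>F t in at_right 0. x + t *\<^sub>R v \<in> D)"


section \<open>The Knudsen stochastic billiard\<close>

definition half_sphere :: "real^'n \<Rightarrow> (real^'n) set" where
  "half_sphere v = {w \<in> sphere 0 1. v \<bullet> w > 0}"

definition knudsen_gamma :: "'n::{finite,wellorder} itself \<Rightarrow> real" where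
  "knudsen_gamma _ =
     inverse (LINT u:half_sphere (first_unit :: real^'n::_)|surface_measure. u \<bullet> first_unit)"

definition knudsen_kappa :: "'n::{finite,wellorder} itself \<Rightarrow> real" where
  "knudsen_kappa _ = knudsen_gamma TYPE('n) * measure surface_measure (sphere (0 :: real^'n::_) 1)"

definition direction_law :: "real^'n::{finite,wellorder} \<Rightarrow> (real^'n::_) measure" where
  "direction_law v =
     density surface_measure
       (\<lambda>u. indicator (half_sphere v) u * ennreal (knudsen_gamma TYPE('n) * (u \<bullet> v)))"

definition hit_time :: "(real^'n) set \<Rightarrow> real^'n \<Rightarrow> real^'n \<Rightarrow> real" where
  "hit_time D x u = Inf {t. t > 0 \<and> x + t *\<^sub>R u \<in> frontier D}"

definition next_hit :: "(real^'n) set \<Rightarrow> real^'n \<Rightarrow> real^'n \<Rightarrow> real^'n" where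
  "next_hit D x u = x + hit_time D x u *\<^sub>R u"

definition unit_dir :: "real^'n \<Rightarrow> real^'n \<Rightarrow> real^'n" where
  "unit_dir x y = (1 / norm (y - x)) *\<^sub>R (y - x)"

text \<open>
  Expectation of a functional of the starting point \<open>x\<close> and of the first direction \<open>u\<close>: the law of
  \<open>x\<close> is uniform on the boundary and, given \<open>x\<close>, the law of \<open>u\<close> is \<open>direction_law (\<nn> x)\<close>, where
  \<open>\<nn>\<close> is the field of inward unit normals.
\<close>

definition knudsen_expectation ::
  "(real^'n::{finite,wellorder}) set \<Rightarrow> (real^'n::_ \<Rightarrow> real^'n::_)
     \<Rightarrow> (real^'n::_ \<Rightarrow> real^'n::_ \<Rightarrow> ennreal) \<Rightarrow> ennreal" where
  "knudsen_expectation D \<nn> F =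
     (\<integral>\<^sup>+ x. (\<integral>\<^sup>+ u. F x u \<partial>direction_law (\<nn> x)) \<partial>uniform_measure surface_measure (frontier D))"

definition mean_time ::
  "(real^'n::{finite,wellorder}) set \<Rightarrow> (real^'n::_ \<Rightarrow> real^'n::_) \<Rightarrow> (real^'n::_) set \<Rightarrow> ennreal" where
  "mean_time D \<nn> A =
     knudsen_expectation D \<nn>
       (\<lambda>x u. \<integral>\<^sup>+ t\<in>{0..hit_time D x u}. indicator A (x + t *\<^sub>R unit_dir x (next_hit D x u)) \<partial>lborel)"

end

(*
  Fix a direction u.  Every point of the domain lies behind exactly one flight in direction u: going
  backwards along -u one meets a last boundary point x, and y = x + t u.  In these coordinates (x, t)
  Lebesgue measure is (u . n(x))^+ dH(x) dt, up to the null sets of flights that start at an irregular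
  or a tangential boundary point.  Hence the integral of (u . n(x))^+ times the time spent in A is |A|
  for each u, and integrating over the unit sphere gives the formula.

  The Jacobian (u . n) is obtained from the change of variables formula in a chart, and the Hausdorff
  measure enters through the area formula for C^1 charts: a chart is locally almost an isometry composed
  with a linear map, and on a hyperplane the normalised Hausdorff measure is Lebesgue measure.  The
  latter is the isodiametric inequality (by Steiner symmetrisation) in one direction and a Vitali
  covering argument in the other.
*)

theory Submission
  imports Defs
begin

section \<open>Lebesgue measure on coordinate hyperplanes\<close>

text \<open>Three obstacles shape the proof. The type \<open>real^'n\<close> has no companion of
  dimension d-1, so hyperplane measure lives on the full space (\<open>hyper\<close>) as the volume
  of a cylinder of height 1; linear maps that respect such cylinders then give (d-1)-dimensional
  Jacobians as d-dimensional determinants. Hausdorff measure on \<open>real^'n\<close> is not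
  sigma-finite, so Fubini is never applied to \<open>surface_measure\<close> itself: the regular
  boundary is cut into countably many Borel pieces, each inside one chart, and integrals are
  exchanged after pulling back to \<open>hyper\<close>. The normal field is given only pointwise:
  neither its measurability nor its independence of the chart is assumed. \<open>flat_at\<close>
  carries orthogonality from one chart to every other, and the inward sign is recovered by a
  countable test. For that sign, and to exclude flights that start against the normal, the domain
  must lie on one side of its boundary near a regular point. A slit shows that smooth charts alone
  do not give this; here the Lipschitz condition enters.\<close>

definition drop_coord :: "'n \<Rightarrow> real^'n \<Rightarrow> real^'n::finite" where
  "drop_coord j z = z - (z $ j) *\<^sub>R axis j 1"

lemma drop_coord_nth: "drop_coord j z $ i = (if i = j then 0 else z $ i)"
  by (simp add: drop_coord_def axis_def)

lemma linear_drop_coord [simp]: "linear (drop_coord j)"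
  by (auto intro!: linearI simp: drop_coord_def algebra_simps)

lemma bounded_linear_drop_coord: "bounded_linear (drop_coord j)"
  by (simp add: linear_linear)

lemma continuous_on_drop_coord [continuous_intros]:
  "continuous_on S f \<Longrightarrow> continuous_on S (\<lambda>x. drop_coord j (f x))"
  using bounded_linear.continuous_on[OF bounded_linear_drop_coord] .

lemma borel_measurable_drop_coord [measurable]: "drop_coord j \<in> borel_measurable borel"
  by (intro borel_measurable_continuous_onI continuous_intros)

lemma borel_measurable_nth [measurable]: "(\<lambda>x::real^'n. x $ i) \<in> borel_measurable borel"
  by (intro borel_measurable_continuous_onI continuous_intros)

lemma drop_coord_id: "z $ j = 0 \<Longrightarrow> drop_coord j z = z"
  by (simp add: drop_coord_def)

lemma drop_coord_add_axis: "drop_coord j (z + t *\<^sub>R axis j 1) = drop_coord j z"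
  by (simp add: vec_eq_iff drop_coord_nth axis_def)

lemma drop_coord_decomp: "drop_coord j z + (z $ j) *\<^sub>R axis j 1 = z"
  by (simp add: drop_coord_def)

lemma norm_drop_coord_sq: "(norm z)\<^sup>2 = (norm (drop_coord j z))\<^sup>2 + (z $ j)\<^sup>2"
proof -
  have "(\<Sum>i\<in>UNIV. (z $ i)\<^sup>2) = (\<Sum>i\<in>UNIV. (drop_coord j z $ i)\<^sup>2 + (if i = j then (z $ j)\<^sup>2 else 0))"
    by (intro sum.cong) (auto simp: drop_coord_nth)
  then have "(\<Sum>i\<in>UNIV. (z $ i)\<^sup>2) = (\<Sum>i\<in>UNIV. (drop_coord j z $ i)\<^sup>2) + (z $ j)\<^sup>2"
    by (simp add: sum.distrib)
  then show ?thesis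
    by (simp only: power2_norm_eq_inner inner_vec_def inner_real_def) (simp only: power2_eq_square)
qed

lemma norm_drop_coord_le: "norm (drop_coord j z) \<le> norm z"
proof (rule power2_le_imp_le)
  show "(norm (drop_coord j z))\<^sup>2 \<le> (norm z)\<^sup>2"
    using norm_drop_coord_sq[of z j] zero_le_power2[of "z $ j"] by linarith
qed simp

definition slab :: "'n \<Rightarrow> (real^'n::finite) set" where
  "slab j = {z. 0 < z $ j \<and> z $ j < 1}"

lemma slab_borel [measurable]: "slab j \<in> sets borel"
  unfolding slab_def by measurable

text \<open>The \<open>(d-1)\<close>-dimensional Lebesgue measure of the hyperplane \<open>z $ j = 0\<close>, carried by \<open>\<real>\<^sup>d\<close>: the
  measure of \<open>E\<close> is the volume of the cylinder of height 1 over \<open>E\<close>.\<close>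

definition hyper :: "'n \<Rightarrow> (real^'n::finite) measure" where
  "hyper j = distr (density lborel (indicator (slab j))) borel (drop_coord j)"

lemma sets_hyper [simp, measurable_cong]: "sets (hyper j) = sets borel"
  by (simp add: hyper_def)

lemma space_hyper [simp]: "space (hyper j) = UNIV"
  by (simp add: hyper_def)

lemma nn_integral_hyper:
  assumes [measurable]: "f \<in> borel_measurable borel"
  shows "(\<integral>\<^sup>+z. f z \<partial>hyper j) = (\<integral>\<^sup>+w. indicator (slab j) w * f (drop_coord j w) \<partial>lborel)"
  unfolding hyper_def by (subst nn_integral_distr) (auto simp: nn_integral_density)

lemma emeasure_hyper:
  assumes [measurable]: "E \<in> sets borel"
  shows "emeasure (hyper j) E = emeasure lborel {w \<in> slab j. drop_coord j w \<in> E}"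
proof -
  have "emeasure (hyper j) E = (\<integral>\<^sup>+z. indicator E z \<partial>hyper j)"
    by simp
  also have "\<dots> = (\<integral>\<^sup>+w. indicator {w \<in> slab j. drop_coord j w \<in> E} w \<partial>lborel)"
    by (subst nn_integral_hyper, simp, rule nn_integral_cong) (simp add: indicator_def)
  finally show ?thesis by simp
qed

lemma prod_Basis_vec: "(\<Prod>b\<in>(Basis :: (real^'n) set). f b) = (\<Prod>i\<in>UNIV. f (axis i 1))"
proof -
  have "Basis = (\<lambda>i::'n. axis i (1::real)) ` UNIV"
    by (auto simp: Basis_vec_def)
  then have "prod f Basis = prod f ((\<lambda>i::'n. axis i 1) ` UNIV)"
    by simp
  also have "\<dots> = (\<Prod>i\<in>UNIV. f (axis i 1))"
    by (subst prod.reindex) (auto simp: inj_on_def axis_eq_axis)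
  finally show ?thesis .
qed

lemma emeasure_lborel_box_cart:
  fixes l u :: "real^'n"
  assumes "\<And>i. l $ i \<le> u $ i"
  shows "emeasure lborel (box l u) = ennreal (\<Prod>i\<in>UNIV. u $ i - l $ i)"
proof -
  have "\<And>b. b \<in> Basis \<Longrightarrow> l \<bullet> b \<le> u \<bullet> b"
    using assms by (auto simp: Basis_vec_def inner_axis)
  then show ?thesis
    by (subst emeasure_lborel_box) (auto simp: prod_Basis_vec inner_axis)
qed

lemma sigma_finite_hyper: "sigma_finite_measure (hyper (j::'a::finite))"
proof
  let ?A = "\<lambda>n::nat. {z::real^'a. norm z < n}"
  have "emeasure (hyper j) (?A n) \<noteq> \<infinity>" for n
  proof -
    have "{w \<in> slab j. drop_coord j w \<in> ?A n} \<subseteq> ball 0 (real n + 1)"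
    proof clarsimp
      fix w assume w: "w \<in> slab j" "norm (drop_coord j w) < n"
      have "norm w \<le> norm (drop_coord j w) + norm ((w $ j) *\<^sub>R axis j (1::real))"
        using norm_triangle_ineq[of "drop_coord j w" "(w $ j) *\<^sub>R axis j (1::real)"]
        by (simp add: drop_coord_decomp)
      then show "norm w < real n + 1"
        using w by (simp add: slab_def)
    qed
    then have "emeasure (hyper j) (?A n) \<le> emeasure lborel (ball (0::real^'a) (real n + 1))"
      by (subst emeasure_hyper) (simp, rule emeasure_mono, auto)
    also have "\<dots> < \<infinity>"
      using emeasure_bounded_finite[OF bounded_ball] by simp
    finally show ?thesis by simp
  qed
  then have "\<forall>a\<in>range ?A. emeasure (hyper j) a \<noteq> \<infinity>"
    by blast
  moreover have "(\<Union>n. ?A n) = UNIV"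
  proof (intro equalityI subsetI)
    fix z :: "real^'a"
    obtain n where "norm z < real n"
      using reals_Archimedean2 by blast
    then show "z \<in> (\<Union>n. ?A n)"
      by (intro UN_I[of n]) auto
  qed simp
  moreover have "range ?A \<subseteq> sets (hyper j)"
    by (intro image_subsetI) simp
  moreover have "countable (range ?A)"
    by simp
  ultimately show "\<exists>A. countable A \<and> A \<subseteq> sets (hyper j) \<and> \<Union>A = space (hyper j) \<and> (\<forall>a\<in>A. emeasure (hyper j) a \<noteq> \<infinity>)"
    unfolding space_hyper by (intro exI[of _ "range ?A"]) blast
qed

interpretation hyper: sigma_finite_measure "hyper j"
  by (rule sigma_finite_hyper)

text \<open>Fubini along the \<open>j\<close>-th axis, checked on boxes: the slab replaces the
  \<open>j\<close>-th side of the box by the unit interval, and the integral over \<open>t\<close>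
  gives back the missing factor \<open>u $ j - l $ j\<close>.\<close>

lemma lborel_eq_hyper:
  "distr (hyper j \<Otimes>\<^sub>M lborel) borel (\<lambda>(z, t). z + t *\<^sub>R axis j 1) = (lborel :: (real^'n) measure)"
proof (rule lborel_eqI[symmetric])
  fix l u :: "real^'n"
  assume lu: "\<And>b. b \<in> Basis \<Longrightarrow> l \<bullet> b \<le> u \<bullet> b"
  have le: "l $ i \<le> u $ i" for i
    using lu[of "axis i 1"] by (simp add: inner_axis)
  let ?l = "\<chi> i. if i = j then 0 else l $ i" and ?u = "\<chi> i. if i = j then 1 else u $ i"
  have "emeasure (distr (hyper j \<Otimes>\<^sub>M lborel) borel (\<lambda>(z, t). z + t *\<^sub>R axis j 1)) (box l u)
     = (\<integral>\<^sup>+p. indicator (box l u) ((\<lambda>(z, t). z + t *\<^sub>R axis j 1) p) \<partial>(hyper j \<Otimes>\<^sub>M lborel))"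
    by (subst nn_integral_indicator[symmetric]) (simp, subst nn_integral_distr, auto)
  also have "\<dots> = (\<integral>\<^sup>+z. \<integral>\<^sup>+t. indicator (box l u) (z + t *\<^sub>R axis j 1) \<partial>lborel \<partial>hyper j)"
    by (subst lborel.nn_integral_fst[symmetric]) auto
  also have "\<dots> = (\<integral>\<^sup>+w. indicator (slab j) w *
      (\<integral>\<^sup>+t. indicator (box l u) (drop_coord j w + t *\<^sub>R axis j 1) \<partial>lborel) \<partial>lborel)"
    by (subst nn_integral_hyper) auto
  also have "\<dots> = (\<integral>\<^sup>+w. indicator (box ?l ?u) w * ennreal (u $ j - l $ j) \<partial>lborel)"
  proof (rule nn_integral_cong)
    fix w :: "real^'n"
    have eq: "indicator (slab j) w * indicator (box l u) (drop_coord j w + t *\<^sub>R axis j 1)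
        = (indicator (box ?l ?u) w * indicator {l $ j<..<u $ j} t :: ennreal)" for t
    proof -
      have nth: "(drop_coord j w + t *\<^sub>R axis j 1) $ i = (if i = j then t else w $ i)" for i
        by (simp add: drop_coord_nth axis_def)
      have "w \<in> slab j \<and> drop_coord j w + t *\<^sub>R axis j 1 \<in> box l u \<longleftrightarrow>
          w \<in> box ?l ?u \<and> t \<in> {l $ j<..<u $ j}"
      proof -
        have split: "(\<forall>i. P i) \<longleftrightarrow> P j \<and> (\<forall>i. i \<noteq> j \<longrightarrow> P i)" for P
          by metis
        show ?thesis
          unfolding mem_box_cart slab_def nth mem_Collect_eq
          by (subst (1 2) split) (simp; blast)
      qed
      then show ?thesis
        by (auto split: split_indicator)
    qed
    have "indicator (slab j) w * (\<integral>\<^sup>+t. indicator (box l u) (drop_coord j w + t *\<^sub>R axis j 1) \<partial>lborel)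
      = (\<integral>\<^sup>+t. indicator (slab j) w * indicator (box l u) (drop_coord j w + t *\<^sub>R axis j 1) \<partial>lborel)"
      by (subst nn_integral_cmult) auto
    also have "\<dots> = (\<integral>\<^sup>+t. indicator (box ?l ?u) w * indicator {l $ j<..<u $ j} t \<partial>lborel)"
      by (simp only: eq)
    also have "\<dots> = indicator (box ?l ?u) w * ennreal (u $ j - l $ j)"
      using le[of j] by (subst nn_integral_cmult) auto
    finally show "indicator (slab j) w * (\<integral>\<^sup>+t. indicator (box l u) (drop_coord j w + t *\<^sub>R axis j 1) \<partial>lborel)
      = indicator (box ?l ?u) w * ennreal (u $ j - l $ j)" .
  qed
  also have "\<dots> = emeasure lborel (box ?l ?u) * ennreal (u $ j - l $ j)"
    by (subst nn_integral_multc) auto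
  also have "\<dots> = ennreal ((\<Prod>i\<in>UNIV. ?u $ i - ?l $ i) * (u $ j - l $ j))"
    using le by (subst emeasure_lborel_box_cart) (auto simp: ennreal_mult intro!: prod_nonneg ennreal_mult[symmetric])
  also have "(\<Prod>i\<in>UNIV. ?u $ i - ?l $ i) = (\<Prod>i\<in>UNIV - {j}. u $ i - l $ i)"
    by (subst prod.remove[of _ j]) (auto intro!: prod.cong)
  also have "\<dots> * (u $ j - l $ j) = (\<Prod>i\<in>UNIV. u $ i - l $ i)"
    by (subst prod.remove[of UNIV j]) auto
  finally show "emeasure (distr (hyper j \<Otimes>\<^sub>M lborel) borel (\<lambda>(z, t). z + t *\<^sub>R axis j 1)) (box l u)
      = ennreal (\<Prod>b\<in>Basis. (u - l) \<bullet> b)"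
    by (simp add: prod_Basis_vec inner_axis)
qed simp

lemma nn_integral_lborel_hyper:
  fixes f :: "real^'n \<Rightarrow> ennreal"
  assumes [measurable]: "f \<in> borel_measurable borel"
  shows "(\<integral>\<^sup>+w. f w \<partial>lborel) = (\<integral>\<^sup>+z. \<integral>\<^sup>+t. f (z + t *\<^sub>R axis j 1) \<partial>lborel \<partial>hyper j)"
proof -
  have "(\<integral>\<^sup>+w. f w \<partial>lborel)
     = (\<integral>\<^sup>+w. f w \<partial>distr (hyper j \<Otimes>\<^sub>M lborel) borel (\<lambda>(z, t). z + t *\<^sub>R axis j 1))"
    by (simp add: lborel_eq_hyper)
  also have "\<dots> = (\<integral>\<^sup>+p. f ((\<lambda>(z, t). z + t *\<^sub>R axis j 1) p) \<partial>(hyper j \<Otimes>\<^sub>M lborel))"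
    by (subst nn_integral_distr) auto
  also have "\<dots> = (\<integral>\<^sup>+z. \<integral>\<^sup>+t. f (z + t *\<^sub>R axis j 1) \<partial>lborel \<partial>hyper j)"
    by (subst lborel.nn_integral_fst[symmetric]) auto
  finally show ?thesis .
qed

lemma AE_hyper: "AE z in hyper j. z $ j = 0"
proof -
  have "emeasure (hyper j) {z. z $ j \<noteq> 0} = 0"
    by (subst emeasure_hyper) (auto simp: drop_coord_nth)
  then show ?thesis
    by (intro AE_I[where N="{z. z $ j \<noteq> 0}"]) auto
qed


section \<open>Steiner symmetrisation and the isodiametric inequality\<close>

text \<open>\<open>lborel\<close> is unfolded into the product measure over \<open>Basis\<close>,
  and the factor of the \<open>j\<close>-th axis, where the slab has length 1, is split off. What
  remains is the volume of a ball in a product of lines over one axis less;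
  \<open>emeasure_cball_aux\<close> computes it for any finite index set.\<close>

lemma emeasure_hyper_cball_0:
  assumes r: "r > 0"
  shows "emeasure (hyper (j::'n::finite)) (cball 0 r) =
    ennreal (unit_ball_vol (real (CARD('n) - 1)) * r ^ (CARD('n) - 1))"
proof -
  let ?B = "Basis :: (real^'n) set"
  let ?b = "axis j 1 :: real^'n"
  let ?A = "?B - {?b}"
  let ?S = "{w \<in> slab j. drop_coord j w \<in> cball 0 r}"
  interpret P: product_sigma_finite "\<lambda>_::real^'n. lborel :: real measure"
    by standard
  have bB: "?b \<in> ?B" by (auto simp: Basis_vec_def)
  then have ins: "?B = insert ?b ?A" by blast
  have cA: "card ?A = CARD('n) - 1"
    using bB by simp
  have nthj: "(\<Sum>b\<in>?B. f b *\<^sub>R b) $ i = f (axis i 1)" for f i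
  proof -
    have "(\<Sum>b\<in>?B. f b *\<^sub>R b) \<bullet> axis i 1 = f (axis i 1)"
      by (subst inner_sum_left_Basis) (auto simp: Basis_vec_def)
    then show ?thesis by (simp add: inner_axis)
  qed
  have nrm: "norm (drop_coord j (\<Sum>b\<in>?B. f b *\<^sub>R b)) = sqrt (\<Sum>b\<in>?A. (f b)\<^sup>2)" for f
  proof -
    let ?w = "\<Sum>b\<in>?B. f b *\<^sub>R b"
    have "(\<Sum>b\<in>?B. (f b)\<^sup>2) = (\<Sum>b\<in>?A. (f b)\<^sup>2) + (f ?b)\<^sup>2"
      using bB by (subst sum.remove[of _ ?b]) auto
    moreover have "(norm ?w)\<^sup>2 = (\<Sum>b\<in>?B. (f b)\<^sup>2)"
    proof -
      have "(norm ?w)\<^sup>2 = (\<Sum>b\<in>?B. (?w \<bullet> b) * (?w \<bullet> b))"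
        unfolding power2_norm_eq_inner by (rule euclidean_inner)
      also have "\<dots> = (\<Sum>b\<in>?B. (f b)\<^sup>2)"
        by (intro sum.cong) (simp_all add: power2_eq_square inner_sum_left_Basis)
      finally show ?thesis .
    qed
    ultimately have "(norm (drop_coord j ?w))\<^sup>2 = (\<Sum>b\<in>?A. (f b)\<^sup>2)"
      using norm_drop_coord_sq[of ?w j] unfolding nthj by linarith
    then show ?thesis
      by (intro real_sqrt_unique[symmetric]) auto
  qed
  have [measurable]: "cball 0 r \<in> sets (borel :: (real^'n) measure)" by simp
  have [measurable]: "?S \<in> sets borel" by measurable
  have "emeasure (hyper j) (cball 0 r) = emeasure lborel ?S"
    by (subst emeasure_hyper) auto
  also have "\<dots> = emeasure (distr (Pi\<^sub>M ?B (\<lambda>_. lborel)) borel (\<lambda>f. \<Sum>b\<in>?B. f b *\<^sub>R b)) ?S"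
    by (subst lborel_eq) (rule refl)
  also have "\<dots> = (\<integral>\<^sup>+f. indicator ?S (\<Sum>b\<in>?B. f b *\<^sub>R b) \<partial>Pi\<^sub>M ?B (\<lambda>_. lborel))"
    by (subst nn_integral_indicator[symmetric], simp, subst nn_integral_distr) auto
  also have "\<dots> = (\<integral>\<^sup>+f. indicator {0<..<1} (f ?b) * indicator {..r} (sqrt (\<Sum>b\<in>?A. (f b)\<^sup>2)) \<partial>Pi\<^sub>M ?B (\<lambda>_. lborel))"
  proof (rule nn_integral_cong)
    fix f
    have "(\<Sum>b\<in>?B. f b *\<^sub>R b) \<in> ?S \<longleftrightarrow> f ?b \<in> {0<..<1} \<and> sqrt (\<Sum>b\<in>?A. (f b)\<^sup>2) \<in> {..r}"
      unfolding slab_def mem_Collect_eq nthj mem_cball_0 nrm by auto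
    then show "indicator ?S (\<Sum>b\<in>?B. f b *\<^sub>R b)
        = (indicator {0<..<1} (f ?b) * indicator {..r} (sqrt (\<Sum>b\<in>?A. (f b)\<^sup>2)) :: ennreal)"
      unfolding indicator_def by simp
  qed
  also have "\<dots> = (\<integral>\<^sup>+f. \<integral>\<^sup>+y. indicator {0<..<1::real} y * indicator {..r} (sqrt (\<Sum>b\<in>?A. (f b)\<^sup>2)) \<partial>lborel \<partial>Pi\<^sub>M ?A (\<lambda>_. lborel))"
  proof -
    have "(\<lambda>f. indicator {0<..<1} (f ?b) * indicator {..r} (sqrt (\<Sum>b\<in>?A. (f b)\<^sup>2)) :: ennreal)
       \<in> borel_measurable (Pi\<^sub>M (insert ?b ?A) (\<lambda>_. lborel))"
      by measurable
    then have "(\<integral>\<^sup>+f. indicator {0<..<1} (f ?b) * indicator {..r} (sqrt (\<Sum>b\<in>?A. (f b)\<^sup>2)) \<partial>Pi\<^sub>M (insert ?b ?A) (\<lambda>_. lborel))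
       = (\<integral>\<^sup>+f. \<integral>\<^sup>+y. indicator {0<..<1} ((f(?b := y)) ?b) * indicator {..r} (sqrt (\<Sum>b\<in>?A. ((f(?b := y)) b)\<^sup>2)) \<partial>lborel \<partial>Pi\<^sub>M ?A (\<lambda>_. lborel))"
      by (intro P.product_nn_integral_insert) auto
    also have "\<dots> = (\<integral>\<^sup>+f. \<integral>\<^sup>+y. indicator {0<..<1::real} y * indicator {..r} (sqrt (\<Sum>b\<in>?A. (f b)\<^sup>2)) \<partial>lborel \<partial>Pi\<^sub>M ?A (\<lambda>_. lborel))"
    proof -
      have "(\<Sum>b\<in>?A. ((f(?b := y)) b)\<^sup>2) = (\<Sum>b\<in>?A. (f b)\<^sup>2)" for f :: "real^'n \<Rightarrow> real" and y
        by (intro sum.cong) auto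
      then show ?thesis by (simp only: fun_upd_same)
    qed
    finally show ?thesis
      by (simp only: ins[symmetric])
  qed
  also have "\<dots> = (\<integral>\<^sup>+f. indicator {..r} (sqrt (\<Sum>b\<in>?A. (f b)\<^sup>2)) \<partial>Pi\<^sub>M ?A (\<lambda>_. lborel))"
    by (intro nn_integral_cong) (simp add: nn_integral_multc)
  also have "\<dots> = (\<integral>\<^sup>+f. indicator ({f. sqrt (\<Sum>b\<in>?A. (f b)\<^sup>2) \<le> r} \<inter> space (Pi\<^sub>M ?A (\<lambda>_. lborel))) f \<partial>Pi\<^sub>M ?A (\<lambda>_. lborel))"
    by (intro nn_integral_cong) (simp add: indicator_def)
  also have "\<dots> = emeasure (Pi\<^sub>M ?A (\<lambda>_. lborel)) ({f. sqrt (\<Sum>b\<in>?A. (f b)\<^sup>2) \<le> r} \<inter> space (Pi\<^sub>M ?A (\<lambda>_. lborel)))"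
    by (rule nn_integral_indicator) measurable
  also have "\<dots> = ennreal (unit_ball_vol (real (card ?A)) * r ^ card ?A)"
    using r by (intro emeasure_cball_aux) auto
  finally show ?thesis by (simp only: cA)
qed

lemma emeasure_hyper_cball:
  assumes r: "r > 0" and c: "c $ j = 0"
  shows "emeasure (hyper (j::'n::finite)) (cball c r) =
    ennreal (unit_ball_vol (real (CARD('n) - 1)) * r ^ (CARD('n) - 1))"
proof -
  have "emeasure (hyper j) (cball c r) = emeasure lborel {w \<in> slab j. drop_coord j w \<in> cball c r}"
    by (subst emeasure_hyper) auto
  also have "\<dots> = emeasure (distr lborel borel ((+) c)) {w \<in> slab j. drop_coord j w \<in> cball c r}"
    by (subst lborel_distr_plus) (rule refl)
  also have "\<dots> = emeasure lborel ((+) c -` {w \<in> slab j. drop_coord j w \<in> cball c r} \<inter> space lborel)"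
    by (rule emeasure_distr) (auto intro: measurable_sets)
  also have "(+) c -` {w \<in> slab j. drop_coord j w \<in> cball c r} \<inter> space lborel = {w \<in> slab j. drop_coord j w \<in> cball 0 r}"
    using c by (auto simp: slab_def dist_norm linear_add[OF linear_drop_coord] drop_coord_id)
  also have "emeasure lborel \<dots> = emeasure (hyper j) (cball 0 r)"
    by (subst emeasure_hyper) auto
  finally show ?thesis
    by (simp add: emeasure_hyper_cball_0[OF r])
qed

section \<open>Steiner symmetrisation in one coordinate\<close>

definition fibre_length :: "'n \<Rightarrow> (real^'n::finite) set \<Rightarrow> real^'n \<Rightarrow> ennreal" where
  "fibre_length j E z = emeasure lborel {t. drop_coord j z + t *\<^sub>R axis j 1 \<in> E}"

text \<open>Every line parallel to the \<open>j\<close>-th axis meets this set in an open interval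
  centred on the hyperplane, of the same length as its intersection with \<open>E\<close>; infinite
  length gives the whole line.\<close>

definition steiner :: "'n \<Rightarrow> (real^'n::finite) set \<Rightarrow> (real^'n) set" where
  "steiner j E = {z. ennreal (2 * \<bar>z $ j\<bar>) < fibre_length j E z}"

lemma fibre_length_measurable [measurable]:
  assumes [measurable]: "E \<in> sets borel"
  shows "fibre_length j E \<in> borel_measurable borel"
proof -
  have "fibre_length j E = (\<lambda>z. \<integral>\<^sup>+t. indicator E (drop_coord j z + t *\<^sub>R axis j 1) \<partial>lborel)"
  proof
    fix z
    have "fibre_length j E z = (\<integral>\<^sup>+t. indicator {t. drop_coord j z + t *\<^sub>R axis j 1 \<in> E} t \<partial>lborel)"
      unfolding fibre_length_def by (rule nn_integral_indicator[symmetric]) measurable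
    then show "fibre_length j E z = (\<integral>\<^sup>+t. indicator E (drop_coord j z + t *\<^sub>R axis j 1) \<partial>lborel)"
      by (simp add: indicator_def)
  qed
  then show ?thesis by simp
qed

lemma steiner_borel [measurable]:
  assumes [measurable]: "E \<in> sets borel"
  shows "steiner j E \<in> sets borel"
  unfolding steiner_def by measurable

lemma emeasure_abs_less: "emeasure lborel {t::real. ennreal (2 * \<bar>t\<bar>) < l} = l"
proof (cases l)
  case (real a)
  then have "{t::real. ennreal (2 * \<bar>t\<bar>) < l} = {- a / 2 <..< a / 2}"
    by (auto simp: ennreal_less_iff)
  then show ?thesis using real by (simp add: emeasure_lborel_Ioo)
qed simp

lemma emeasure_steiner:
  assumes [measurable]: "E \<in> sets borel"
  shows "emeasure lborel (steiner j E) = emeasure lborel E"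
proof -
  have key: "(\<integral>\<^sup>+t. indicator (steiner j E) (z + t *\<^sub>R axis j 1) \<partial>lborel)
     = (\<integral>\<^sup>+t. indicator E (z + t *\<^sub>R axis j 1) \<partial>lborel)" if z: "z $ j = 0" for z
  proof -
    have [simp]: "(z + t *\<^sub>R axis j 1) $ j = t" for t
      using z by simp
    have fl: "fibre_length j E (z + t *\<^sub>R axis j 1) = fibre_length j E z" for t
      by (simp add: fibre_length_def drop_coord_add_axis)
    have "(\<integral>\<^sup>+t. indicator (steiner j E) (z + t *\<^sub>R axis j 1) \<partial>lborel)
      = (\<integral>\<^sup>+t. indicator {t. ennreal (2 * \<bar>t\<bar>) < fibre_length j E z} t \<partial>lborel)"
      unfolding steiner_def by (intro nn_integral_cong) (simp add: indicator_def fl z)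
    also have "\<dots> = fibre_length j E z"
      by (subst nn_integral_indicator) (simp_all add: emeasure_abs_less)
    also have "\<dots> = (\<integral>\<^sup>+t. indicator {t. drop_coord j z + t *\<^sub>R axis j 1 \<in> E} t \<partial>lborel)"
      unfolding fibre_length_def by (rule nn_integral_indicator[symmetric]) measurable
    finally show ?thesis
      by (simp add: indicator_def drop_coord_id[OF z])
  qed
  have "emeasure lborel (steiner j E) = (\<integral>\<^sup>+w. indicator (steiner j E) w \<partial>lborel)"
    by simp
  also have "\<dots> = (\<integral>\<^sup>+z. \<integral>\<^sup>+t. indicator (steiner j E) (z + t *\<^sub>R axis j 1) \<partial>lborel \<partial>hyper j)"
    by (rule nn_integral_lborel_hyper) measurable
  also have "\<dots> = (\<integral>\<^sup>+z. \<integral>\<^sup>+t. indicator E (z + t *\<^sub>R axis j 1) \<partial>lborel \<partial>hyper j)"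
    using AE_hyper[of j] by (intro nn_integral_cong_AE) (auto elim!: eventually_mono simp: key)
  also have "\<dots> = (\<integral>\<^sup>+w. indicator E w \<partial>lborel)"
    by (rule nn_integral_lborel_hyper[symmetric]) measurable
  finally show ?thesis by simp
qed

text \<open>A nonempty set whose differences are all at most \<open>\<delta>\<close> lies in an
  interval of length \<open>\<delta>\<close> starting at its infimum.\<close>

lemma exists_far_pair:
  fixes T :: "real set"
  assumes T: "ennreal \<delta> < emeasure lborel T" and \<delta>: "\<delta> \<ge> 0"
  shows "\<exists>a\<in>T. \<exists>b\<in>T. b - a > \<delta>"
proof (rule ccontr)
  assume "\<not> ?thesis"
  then have le: "b - a \<le> \<delta>" if "a \<in> T" "b \<in> T" for a b
    using that by force
  have "T \<noteq> {}" using T by auto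
  then obtain a0 where a0: "a0 \<in> T" by blast
  have bdd: "bdd_below T"
    using le[OF _ a0] by (intro bdd_belowI[of _ "a0 - \<delta>"]) force
  have "T \<subseteq> {Inf T..Inf T + \<delta>}"
  proof
    fix t assume t: "t \<in> T"
    have "t - \<delta> \<le> Inf T"
      using \<open>T \<noteq> {}\<close> le[OF _ t] by (intro cInf_greatest) (auto simp: algebra_simps)
    moreover have "Inf T \<le> t"
      using bdd t by (simp add: cInf_lower)
    ultimately show "t \<in> {Inf T..Inf T + \<delta>}" by auto
  qed
  then have "emeasure lborel T \<le> emeasure lborel {Inf T..Inf T + \<delta>}"
    by (intro emeasure_mono) auto
  also have "\<dots> = ennreal \<delta>"
    using \<delta> by simp
  finally show False using T by simp
qed

lemma steiner_fibre_pair: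
  assumes "z \<in> steiner j E"
  obtains a b where "drop_coord j z + a *\<^sub>R axis j 1 \<in> E" "drop_coord j z + b *\<^sub>R axis j 1 \<in> E"
    "b - a > 2 * \<bar>z $ j\<bar>"
  using exists_far_pair[of "2 * \<bar>z $ j\<bar>" "{t. drop_coord j z + t *\<^sub>R axis j 1 \<in> E}"] assms
  by (auto simp: steiner_def fibre_length_def)

text \<open>The reason why symmetrisation does not increase diameters. The two sections of
  \<open>E\<close> have spreads \<open>b - a\<close> and \<open>d - c\<close>, so the cross
  differences \<open>b - c\<close> and \<open>d - a\<close> add up to more than
  \<open>2 * (\<bar>z $ j\<bar> + \<bar>w $ j\<bar>)\<close>; one of them exceeds half of that,
  hence \<open>\<bar>z $ j - w $ j\<bar>\<close>.\<close>

lemma steiner_pair: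
  assumes z: "z \<in> steiner j E" and w: "w \<in> steiner j E"
  obtains p q where "p \<in> E" "q \<in> E" "\<And>i. i \<noteq> j \<Longrightarrow> p $ i = z $ i" "\<And>i. i \<noteq> j \<Longrightarrow> q $ i = w $ i"
    "\<bar>z $ j - w $ j\<bar> \<le> \<bar>p $ j - q $ j\<bar>"
proof -
  obtain a b where ab: "drop_coord j z + a *\<^sub>R axis j 1 \<in> E" "drop_coord j z + b *\<^sub>R axis j 1 \<in> E"
    "b - a > 2 * \<bar>z $ j\<bar>" using steiner_fibre_pair[OF z] .
  obtain c d where cd: "drop_coord j w + c *\<^sub>R axis j 1 \<in> E" "drop_coord j w + d *\<^sub>R axis j 1 \<in> E"
    "d - c > 2 * \<bar>w $ j\<bar>" using steiner_fibre_pair[OF w] .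
  have nth: "(drop_coord j v + t *\<^sub>R axis j 1) $ i = (if i = j then t else v $ i)" for v t i
    by (simp add: drop_coord_nth axis_def)
  consider "\<bar>z $ j - w $ j\<bar> \<le> \<bar>b - c\<bar>" | "\<bar>z $ j - w $ j\<bar> \<le> \<bar>a - d\<bar>"
    using ab(3) cd(3) by linarith
  then show ?thesis
  proof cases
    case 1
    show ?thesis
      by (rule that[OF ab(2) cd(1)]) (use 1 in \<open>simp_all only: nth if_True if_False refl\<close>)
  next
    case 2
    show ?thesis
      by (rule that[OF ab(1) cd(2)]) (use 2 in \<open>simp_all only: nth if_True if_False refl\<close>)
  qed
qed

section \<open>Symmetrisation in all coordinates but one, and the isodiametric inequality\<close>

definition flip_coords :: "'n set \<Rightarrow> real^'n \<Rightarrow> real^'n::finite" where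
  "flip_coords J z = (\<chi> i. if i \<in> J then - z $ i else z $ i)"

lemma flip_coords_nth: "flip_coords J z $ i = (if i \<in> J then - z $ i else z $ i)"
  by (simp add: flip_coords_def)

text \<open>Symmetrising in \<open>j\<close> creates the symmetry in \<open>j\<close> and keeps one
  in another coordinate \<open>i\<close>, because reflection in \<open>i\<close> permutes the lines
  parallel to the \<open>j\<close>-th axis and preserves the length of their sections.\<close>

lemma steiner_flip:
  assumes "i = j \<or> (\<forall>z\<in>E. flip_coords {i} z \<in> E)" and z: "z \<in> steiner j E"
  shows "flip_coords {i} z \<in> steiner j E"
proof (cases "i = j")
  case True
  then have "drop_coord j (flip_coords {i} z) = drop_coord j z"
    by (simp add: vec_eq_iff drop_coord_nth flip_coords_nth)
  then show ?thesis
    using z True by (simp add: steiner_def fibre_length_def flip_coords_nth)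
next
  case False
  then have E: "\<And>z. z \<in> E \<Longrightarrow> flip_coords {i} z \<in> E"
    using assms by blast
  have eq: "drop_coord j (flip_coords {i} z) + t *\<^sub>R axis j 1 = flip_coords {i} (drop_coord j z + t *\<^sub>R axis j 1)" for t
    using False by (simp add: vec_eq_iff drop_coord_nth flip_coords_nth axis_def)
  have "flip_coords {i} v \<in> E \<longleftrightarrow> v \<in> E" for v
  proof -
    have "flip_coords {i} (flip_coords {i} v) = v"
      by (simp add: vec_eq_iff flip_coords_nth)
    then show ?thesis using E[of v] E[of "flip_coords {i} v"] by metis
  qed
  then have "fibre_length j E (flip_coords {i} z) = fibre_length j E z"
    by (simp add: fibre_length_def eq)
  then show ?thesis
    using z False by (simp add: steiner_def flip_coords_nth)
qed

text \<open>Differences are controlled coordinate by coordinate, which survives both repeated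
  symmetrisation and a later projection along \<open>j0\<close>. The untouched coordinate
  \<open>j0\<close> takes no new values, so a set inside the slab stays there.\<close>

lemma iterated_steiner:
  fixes E :: "(real^'n::finite) set"
  assumes "finite J" and j0: "j0 \<notin> J" and E: "E \<in> sets borel"
  shows "\<exists>F \<in> sets borel. emeasure lborel F = emeasure lborel E \<and>
     (\<forall>i\<in>J. \<forall>z\<in>F. flip_coords {i} z \<in> F) \<and>
     (\<forall>z\<in>F. \<forall>w\<in>F. \<exists>p\<in>E. \<exists>q\<in>E. \<forall>i. \<bar>z $ i - w $ i\<bar> \<le> \<bar>p $ i - q $ i\<bar>) \<and>
     (\<forall>z\<in>F. \<exists>p\<in>E. p $ j0 = z $ j0)"
  using assms(1) j0
proof (induction J)
  case empty
  then show ?case by (intro bexI[OF _ E]) auto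
next
  case (insert j J)
  then obtain F where F: "F \<in> sets borel" "emeasure lborel F = emeasure lborel E"
    and sym: "\<And>i z. i \<in> J \<Longrightarrow> z \<in> F \<Longrightarrow> flip_coords {i} z \<in> F"
    and pair: "\<And>z w. z \<in> F \<Longrightarrow> w \<in> F \<Longrightarrow> \<exists>p\<in>E. \<exists>q\<in>E. \<forall>i. \<bar>z $ i - w $ i\<bar> \<le> \<bar>p $ i - q $ i\<bar>"
    and base: "\<And>z. z \<in> F \<Longrightarrow> \<exists>p\<in>E. p $ j0 = z $ j0"
    by (auto; metis)
  show ?case
  proof (intro bexI[of _ "steiner j F"] conjI ballI)
    show "emeasure lborel (steiner j F) = emeasure lborel E"
      using F by (simp add: emeasure_steiner)
    show "flip_coords {i} z \<in> steiner j F" if "i \<in> insert j J" "z \<in> steiner j F" for i z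
      using that sym by (intro steiner_flip) auto
    show "\<exists>p\<in>E. \<exists>q\<in>E. \<forall>i. \<bar>z $ i - w $ i\<bar> \<le> \<bar>p $ i - q $ i\<bar>"
      if zw: "z \<in> steiner j F" "w \<in> steiner j F" for z w
    proof -
      obtain p q where pq: "p \<in> F" "q \<in> F" "\<And>i. i \<noteq> j \<Longrightarrow> p $ i = z $ i"
         "\<And>i. i \<noteq> j \<Longrightarrow> q $ i = w $ i" "\<bar>z $ j - w $ j\<bar> \<le> \<bar>p $ j - q $ j\<bar>"
        using steiner_pair[OF zw] by blast
      have le: "\<bar>z $ i - w $ i\<bar> \<le> \<bar>p $ i - q $ i\<bar>" for i
        using pq by (cases "i = j") auto
      show ?thesis
        using pair[OF pq(1,2)] order_trans[OF le] by meson
    qed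
    show "\<exists>p\<in>E. p $ j0 = z $ j0" if z: "z \<in> steiner j F" for z
    proof -
      obtain p q where "p \<in> F" "\<And>i. i \<noteq> j \<Longrightarrow> p $ i = z $ i"
        using steiner_pair[OF z z] by metis
      then show ?thesis using base insert.prems by (metis insertCI)
    qed
    show "steiner j F \<in> sets borel" using F by measurable
  qed
qed

lemma flip_coords_closed:
  fixes J :: "'n::finite set"
  assumes "\<And>i z. i \<in> J \<Longrightarrow> z \<in> F \<Longrightarrow> flip_coords {i} z \<in> F" "z \<in> F"
  shows "flip_coords J z \<in> F"
proof -
  have "finite J" by simp
  then show ?thesis using assms
  proof (induction J)
    case empty
    then show ?case by (simp add: flip_coords_def)
  next
    case (insert j J)
    have "flip_coords (insert j J) z = flip_coords {j} (flip_coords J z)"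
      using insert.hyps by (auto simp: vec_eq_iff flip_coords_nth)
    then show ?case using insert by simp
  qed
qed

text \<open>After symmetrisation in all coordinates but \<open>j\<close> the set is invariant under reflection in the
  \<open>j\<close>-th axis, so that its points have distance at most half the diameter from that axis.\<close>

lemma isodiametric_hyper:
  fixes K :: "(real^'n::finite) set"
  assumes K: "K \<in> sets borel" and \<delta>: "\<delta> \<ge> 0"
    and diam: "\<And>p q. p \<in> K \<Longrightarrow> q \<in> K \<Longrightarrow> norm (p - q) \<le> \<delta>"
  shows "emeasure (hyper j) K \<le> ennreal (unit_ball_vol (real (CARD('n) - 1)) * (\<delta> / 2) ^ (CARD('n) - 1))"
proof -
  let ?E = "{w \<in> slab j. drop_coord j w \<in> K}"
  have E: "?E \<in> sets borel" using K by measurable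
  obtain F where F: "F \<in> sets borel" "emeasure lborel F = emeasure lborel ?E"
    and sym: "\<And>i z. i \<in> - {j} \<Longrightarrow> z \<in> F \<Longrightarrow> flip_coords {i} z \<in> F"
    and pair: "\<And>z w. z \<in> F \<Longrightarrow> w \<in> F \<Longrightarrow> \<exists>p\<in>?E. \<exists>q\<in>?E. \<forall>i. \<bar>z $ i - w $ i\<bar> \<le> \<bar>p $ i - q $ i\<bar>"
    and base: "\<And>z. z \<in> F \<Longrightarrow> \<exists>p\<in>?E. p $ j = z $ j"
    using iterated_steiner[OF _ _ E, of "- {j}" j] by auto
  \<comment> \<open>A larger \<open>\<delta>'\<close> keeps the radius of the disc positive when
    \<open>\<delta> = 0\<close>; the limit towards \<open>\<delta>\<close> is taken at the
    end.\<close>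
  have le: "emeasure (hyper j) K \<le> ennreal (unit_ball_vol (real (CARD('n) - 1)) * (\<delta>' / 2) ^ (CARD('n) - 1))"
    if \<delta>': "\<delta>' > \<delta>" for \<delta>'
  proof -
    have "F \<subseteq> {w \<in> slab j. drop_coord j w \<in> cball 0 (\<delta>' / 2)}"
    proof
      fix z assume z: "z \<in> F"
      let ?w = "flip_coords (- {j}) z"
      have w: "?w \<in> F" using flip_coords_closed[of "- {j}" F z] sym z by blast
      obtain p q where pq: "p \<in> ?E" "q \<in> ?E" "\<And>i. \<bar>z $ i - ?w $ i\<bar> \<le> \<bar>p $ i - q $ i\<bar>"
        using pair[OF z w] by blast
      \<comment> \<open>A point minus its reflection in all coordinates but \<open>j\<close> is
        twice its projection, so the projection has at most half the diameter.\<close>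
      have "norm (2 *\<^sub>R drop_coord j z) \<le> norm (drop_coord j p - drop_coord j q)"
      proof (rule norm_le_componentwise_cart)
        fix i
        show "norm ((2 *\<^sub>R drop_coord j z) $ i) \<le> norm ((drop_coord j p - drop_coord j q) $ i)"
          using pq(3)[of i] by (auto simp: drop_coord_nth flip_coords_nth)
      qed
      also have "\<dots> \<le> \<delta>" using pq diam by blast
      finally have "norm (drop_coord j z) \<le> \<delta>' / 2" using \<delta>' by simp
      moreover have "z \<in> slab j" using base[OF z] by (auto simp: slab_def)
      ultimately show "z \<in> {w \<in> slab j. drop_coord j w \<in> cball 0 (\<delta>' / 2)}" by simp
    qed
    then have "emeasure lborel F \<le> emeasure lborel {w \<in> slab j. drop_coord j w \<in> cball 0 (\<delta>' / 2)}"
      by (intro emeasure_mono) auto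
    also have "\<dots> = emeasure (hyper j) (cball 0 (\<delta>' / 2))"
      by (subst emeasure_hyper) auto
    also have "emeasure lborel F = emeasure (hyper j) K"
      using F K by (simp add: emeasure_hyper)
    finally show ?thesis
      using \<delta> \<delta>' by (simp add: emeasure_hyper_cball_0)
  qed
  have "((\<lambda>x. ennreal (unit_ball_vol (real (CARD('n) - 1)) * (x / 2) ^ (CARD('n) - 1)))
      \<longlongrightarrow> ennreal (unit_ball_vol (real (CARD('n) - 1)) * (\<delta> / 2) ^ (CARD('n) - 1))) (at_right \<delta>)"
    by (intro tendsto_intros) auto
  then show ?thesis
  proof (rule tendsto_lowerbound)
    show "\<forall>\<^sub>F x in at_right \<delta>. emeasure (hyper j) K
        \<le> ennreal (unit_ball_vol (real (CARD('n) - 1)) * (x / 2) ^ (CARD('n) - 1))"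
      using eventually_at_right_less by (rule eventually_mono) (rule le)
  qed simp
qed


section \<open>Hausdorff measure on hyperplanes\<close>

lemma le_ennreal_mult_iff:
  assumes c: "c > 0"
  shows "x \<le> ennreal c * y \<longleftrightarrow> ennreal (1 / c) * x \<le> y"
proof -
  have 1: "ennreal (1 / c) * ennreal c = 1"
    using c by (simp flip: ennreal_mult)
  have 2: "ennreal c * ennreal (1 / c) = 1"
    using 1 by (simp add: mult.commute)
  show ?thesis
  proof
    assume "x \<le> ennreal c * y"
    then have "ennreal (1 / c) * x \<le> ennreal (1 / c) * (ennreal c * y)"
      by (intro mult_left_mono) auto
    then show "ennreal (1 / c) * x \<le> y"
      by (simp only: mult.assoc[symmetric] 1 mult_1)
  next
    assume "ennreal (1 / c) * x \<le> y"
    then have "ennreal c * (ennreal (1 / c) * x) \<le> ennreal c * y"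
      by (intro mult_left_mono) auto
    then show "x \<le> ennreal c * y"
      by (simp only: mult.assoc[symmetric] 2 mult_1)
  qed
qed

text \<open>A cover of \<open>A\<close> at scale \<open>\<delta> / L\<close> is mapped to a cover of
  the image at scale \<open>\<delta>\<close>. The covering sets are first cut with \<open>A\<close>,
  since \<open>f\<close> is controlled only there.\<close>

lemma hausdorff_outer_lipschitz_image:
  fixes f :: "'a::real_normed_vector \<Rightarrow> 'b::real_normed_vector"
  assumes L: "L > 0" and f: "\<And>x y. x \<in> A \<Longrightarrow> y \<in> A \<Longrightarrow> norm (f x - f y) \<le> L * norm (x - y)"
  shows "hausdorff_outer k (f ` A) \<le> ennreal (L ^ k) * hausdorff_outer k A"
proof -
  have "hausdorff_pre k \<delta> (f ` A) \<le> ennreal (L ^ k) * hausdorff_outer k A" if \<delta>: "\<delta> > 0" for \<delta>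
  proof -
    have "ennreal (1 / L ^ k) * hausdorff_pre k \<delta> (f ` A) \<le> hausdorff_pre k (\<delta> / L) A"
      unfolding hausdorff_pre_def[of k "\<delta> / L" A]
    proof (rule INF_greatest, clarify)
      fix C :: "nat \<Rightarrow> 'a set"
      assume cov: "A \<subseteq> (\<Union>i. C i)" and C: "\<forall>i. bounded (C i) \<and> diameter (C i) \<le> \<delta> / L"
      have nrm: "norm (f x - f y) \<le> L * diameter (C i)" if "x \<in> A \<inter> C i" "y \<in> A \<inter> C i" for x y i
      proof -
        have "norm (x - y) \<le> diameter (C i)"
          using diameter_bounded_bound[of "C i" x y] C that by (auto simp: dist_norm)
        then have "L * norm (x - y) \<le> L * diameter (C i)"
          using L by simp
        then show ?thesis using f[of x y] that by auto
      qed
      have dia: "diameter (f ` (A \<inter> C i)) \<le> L * diameter (C i)" for i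
        using nrm L diameter_ge_0[of "C i"] C by (intro diameter_le) auto
      have bd: "bounded (f ` (A \<inter> C i))" for i
      proof (cases "A \<inter> C i = {}")
        case False
        then obtain x0 where "x0 \<in> A \<inter> C i" by blast
        then show ?thesis
          using nrm[of x0 i]
          by (intro bounded_subset[OF bounded_cball[of "f x0" "L * diameter (C i)"]]) (auto simp: dist_norm)
      qed simp
      have "hausdorff_pre k \<delta> (f ` A) \<le> (\<Sum>i. hausdorff_weight k (f ` (A \<inter> C i)))"
      proof (rule hausdorff_pre_lower)
        show "f ` A \<subseteq> (\<Union>i. f ` (A \<inter> C i))" using cov by blast
        show "diameter (f ` (A \<inter> C i)) \<le> \<delta>" for i
        proof -
          have "L * diameter (C i) \<le> L * (\<delta> / L)"
            using C L by (intro mult_left_mono) auto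
          then show ?thesis using dia[of i] L by simp
        qed
      qed (rule bd)
      also have "\<dots> \<le> (\<Sum>i. ennreal (L ^ k) * hausdorff_weight k (C i))"
      proof (intro suminf_le)
        fix i
        show "hausdorff_weight k (f ` (A \<inter> C i)) \<le> ennreal (L ^ k) * hausdorff_weight k (C i)"
        proof (cases "A \<inter> C i = {}")
          case False
          then have "C i \<noteq> {}" by blast
          have "(diameter (f ` (A \<inter> C i)) / 2) ^ k \<le> (L * (diameter (C i) / 2)) ^ k"
            using dia[of i] diameter_ge_0[OF bd[of i]] by (intro power_mono) auto
          then have "unit_ball_vol (real k) * (diameter (f ` (A \<inter> C i)) / 2) ^ k
             \<le> unit_ball_vol (real k) * (L * (diameter (C i) / 2)) ^ k"
            by (intro mult_left_mono) auto
          also have "\<dots> = L ^ k * (unit_ball_vol (real k) * (diameter (C i) / 2) ^ k)"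
            by (simp add: power_mult_distrib power_divide)
          finally show ?thesis
            using False \<open>C i \<noteq> {}\<close> L C
            by (simp add: hausdorff_weight_def ennreal_leI diameter_ge_0 flip: ennreal_mult)
        qed (simp add: hausdorff_weight_def)
      qed auto
      also have "\<dots> = ennreal (L ^ k) * (\<Sum>i. hausdorff_weight k (C i))"
        by simp
      finally show "ennreal (1 / L ^ k) * hausdorff_pre k \<delta> (f ` A) \<le> (\<Sum>i. hausdorff_weight k (C i))"
        using L by (subst (asm) le_ennreal_mult_iff) auto
    qed
    also have "\<dots> \<le> hausdorff_outer k A"
      using \<delta> L by (intro hausdorff_pre_le_outer) auto
    finally show ?thesis
      using L by (subst le_ennreal_mult_iff) auto
  qed
  then show ?thesis
    by (subst hausdorff_outer_def) (auto intro!: SUP_least)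
qed

text \<open>The isodiametric inequality for arbitrary sets: covering sets need not be Borel, and
  passing to the closure repairs this without changing the diameter.\<close>

lemma hyper_le_weight:
  fixes C :: "(real^'n::finite) set"
  assumes "bounded C"
  shows "emeasure (hyper j) (closure C) \<le> hausdorff_weight (CARD('n) - 1) C"
proof (cases "C = {}")
  case False
  have "norm (p - q) \<le> diameter C" if "p \<in> closure C" "q \<in> closure C" for p q
    using diameter_bounded_bound[of "closure C" p q] that assms
    by (simp add: diameter_closure dist_norm bounded_closure)
  then have "emeasure (hyper j) (closure C)
     \<le> ennreal (unit_ball_vol (real (CARD('n) - 1)) * (diameter C / 2) ^ (CARD('n) - 1))"
    using assms by (intro isodiametric_hyper diameter_ge_0) auto
  then show ?thesis using False by (simp add: hausdorff_weight_def)
qed simp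

lemma hyper_le_cover:
  fixes C :: "nat \<Rightarrow> (real^'n::finite) set"
  assumes "\<And>i. bounded (C i)"
  shows "emeasure (hyper j) (\<Union>i. closure (C i)) \<le> (\<Sum>i. hausdorff_weight (CARD('n) - 1) (C i))"
proof -
  have "emeasure (hyper j) (\<Union>i. closure (C i)) \<le> (\<Sum>i. emeasure (hyper j) (closure (C i)))"
    by (rule emeasure_subadditive_countably) auto
  also have "\<dots> \<le> (\<Sum>i. hausdorff_weight (CARD('n) - 1) (C i))"
    by (intro suminf_le hyper_le_weight assms) auto
  finally show ?thesis .
qed

lemma Union_le_Union_closure: "(\<Union>i. C i) \<subseteq> (\<Union>i. closure (C i))"
  by (intro UN_mono closure_subset subset_refl)

lemma hyper_le_hausdorff:
  fixes E :: "(real^'n::finite) set"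
  assumes E: "E \<in> sets borel"
  shows "emeasure (hyper j) E \<le> hausdorff_outer (CARD('n) - 1) E"
proof -
  \<comment> \<open>Any scale serves in place of 1, because the isodiametric bound holds for
    covering sets of every size.\<close>
  have "emeasure (hyper j) E \<le> hausdorff_pre (CARD('n) - 1) 1 E"
    unfolding hausdorff_pre_def
  proof (rule INF_greatest, clarify)
    fix C :: "nat \<Rightarrow> (real^'n) set"
    assume cov: "E \<subseteq> (\<Union>i. C i)" and C: "\<forall>i. bounded (C i) \<and> diameter (C i) \<le> 1"
    have "emeasure (hyper j) E \<le> emeasure (hyper j) (\<Union>i. closure (C i))"
      using order_trans[OF cov Union_le_Union_closure] by (intro emeasure_mono) auto
    also have "\<dots> \<le> (\<Sum>i. hausdorff_weight (CARD('n) - 1) (C i))"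
      using C by (intro hyper_le_cover) auto
    finally show "emeasure (hyper j) E \<le> (\<Sum>i. hausdorff_weight (CARD('n) - 1) (C i))" .
  qed
  also have "\<dots> \<le> hausdorff_outer (CARD('n) - 1) E"
    by (rule hausdorff_pre_le_outer) simp
  finally show ?thesis .
qed

text \<open>Meant for projections of null sets of the boundary, whose Borel measurability is not at
  hand; hence a Borel hull \<open>N\<close> in the conclusion. It is the intersection of closed-up
  covers of total weight at most \<open>1 / Suc m\<close>.\<close>

lemma hausdorff_null_imp_hyper_null:
  fixes E :: "(real^'n::finite) set"
  assumes "hausdorff_outer (CARD('n) - 1) E = 0"
  obtains N where "N \<in> sets borel" "E \<subseteq> N" "emeasure (hyper j) N = 0"
proof -
  have "\<exists>N \<in> sets borel. E \<subseteq> N \<and> emeasure (hyper j) N \<le> ennreal (1 / Suc m)" for m :: nat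
  proof -
    have "hausdorff_pre (CARD('n) - 1) 1 E \<le> 0"
      using hausdorff_pre_le_outer[of 1 "CARD('n) - 1" E] assms by simp
    then have "hausdorff_pre (CARD('n) - 1) 1 E < ennreal (1 / Suc m)"
      by (simp add: order.strict_trans1)
    then obtain C where C: "E \<subseteq> (\<Union>i. C i)" "\<And>i. bounded (C i)"
      and less: "(\<Sum>i. hausdorff_weight (CARD('n) - 1) (C i)) < ennreal (1 / Suc m)"
      unfolding hausdorff_pre_def INF_less_iff by auto
    have "emeasure (hyper j) (\<Union>i. closure (C i)) \<le> ennreal (1 / Suc m)"
      using hyper_le_cover[of C j, OF C(2)] less by (rule order_trans[OF _ less_imp_le])
    then show ?thesis
      using order_trans[OF C(1) Union_le_Union_closure]
      by (intro bexI[of _ "\<Union>i. closure (C i)"] conjI) auto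
  qed
  then obtain N where N: "\<And>m. N m \<in> sets borel" "\<And>m. E \<subseteq> N m"
     "\<And>m. emeasure (hyper j) (N m) \<le> ennreal (1 / Suc m)" by metis
  show ?thesis
  proof (rule that[of "\<Inter>m. N m"])
    show "(\<Inter>m. N m) \<in> sets borel" using N by auto
    show "E \<subseteq> (\<Inter>m. N m)" using N by auto
    have "emeasure (hyper j) (\<Inter>m. N m) \<le> ennreal (1 / Suc m)" for m
      using N by (intro order_trans[OF emeasure_mono N(3)[of m]]) auto
    moreover have "(\<lambda>m. ennreal (1 / real (Suc m))) \<longlonglongrightarrow> ennreal 0"
      by (intro tendsto_ennrealI LIMSEQ_Suc lim_1_over_n)
    ultimately have "emeasure (hyper j) (\<Inter>m. N m) \<le> ennreal 0"
      by (intro LIMSEQ_le_const) auto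
    then show "emeasure (hyper j) (\<Inter>m. N m) = 0" by simp
  qed
qed

section \<open>Vitali coverings and the upper bound for Hausdorff measure on a hyperplane\<close>

lemma vitali_sequence:
  fixes S :: "(real^'n::finite) set"
  assumes G: "open G" "S \<subseteq> G" and \<delta>: "\<delta> > 0"
  shows "\<exists>(N :: nat set) a r. (\<forall>n\<in>N. a n \<in> S) \<and> (\<forall>n\<in>N. 0 < r n \<and> r n \<le> \<delta> \<and> cball (a n) (r n) \<subseteq> G) \<and>
    (\<forall>m\<in>N. \<forall>n\<in>N. m \<noteq> n \<longrightarrow> cball (a m) (r m) \<inter> cball (a n) (r n) = {}) \<and>
    S \<subseteq> (\<Union>n\<in>N. cball (a n) (5 * r n))"
proof -
  define K where "K = {p. fst p \<in> S \<and> 0 < snd p \<and> snd p \<le> \<delta> \<and> cball (fst p) (snd p) \<subseteq> G}"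
  have S: "S \<subseteq> (\<Union>p\<in>K. cball (fst p) (snd p))"
  proof
    fix x assume x: "x \<in> S"
    then obtain e where e: "e > 0" "cball x e \<subseteq> G"
      using G open_contains_cball by blast
    have "cball x (min e \<delta>) \<subseteq> cball x e" by auto
    then have "(x, min e \<delta>) \<in> K"
      using e \<delta> x by (auto simp: K_def)
    moreover have "x \<in> cball x (min e \<delta>)"
      using e \<delta> by simp
    ultimately show "x \<in> (\<Union>p\<in>K. cball (fst p) (snd p))"
      by force
  qed
  have "\<And>p. p \<in> K \<Longrightarrow> 0 < snd p \<and> snd p \<le> \<delta>"
    by (auto simp: K_def)
  from Vitali_covering_lemma_cballs[OF S this]
  obtain C where C: "countable C" "C \<subseteq> K"
     "pairwise (\<lambda>i j. disjnt (cball (fst i) (snd i)) (cball (fst j) (snd j))) C"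
     "S \<subseteq> (\<Union>i\<in>C. cball (fst i) (5 * snd i))" by blast
  \<comment> \<open>The selected family may be finite, so it is indexed by its set of codes rather
    than by all of \<open>nat\<close>.\<close>
  let ?N = "to_nat_on C ` C" and ?c = "from_nat_into C"
  have mem: "?c n \<in> C" if "n \<in> ?N" for n
    using that C(1) by auto
  have inj: "?c m \<noteq> ?c n" if "m \<in> ?N" "n \<in> ?N" "m \<noteq> n" for m n
    using that C(1) by auto
  show ?thesis
  proof (intro exI[of _ ?N] exI[of _ "\<lambda>n. fst (?c n)"] exI[of _ "\<lambda>n. snd (?c n)"] conjI)
    show "\<forall>n\<in>?N. fst (?c n) \<in> S"
      "\<forall>n\<in>?N. 0 < snd (?c n) \<and> snd (?c n) \<le> \<delta> \<and> cball (fst (?c n)) (snd (?c n)) \<subseteq> G"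
      using mem C(2) unfolding K_def by blast+
    show "\<forall>m\<in>?N. \<forall>n\<in>?N. m \<noteq> n \<longrightarrow>
        cball (fst (?c m)) (snd (?c m)) \<inter> cball (fst (?c n)) (snd (?c n)) = {}"
    proof (intro ballI impI)
      fix m n assume "m \<in> ?N" "n \<in> ?N" "m \<noteq> n"
      then show "cball (fst (?c m)) (snd (?c m)) \<inter> cball (fst (?c n)) (snd (?c n)) = {}"
        using C(3) mem inj unfolding pairwise_def disjnt_def by blast
    qed
    show "S \<subseteq> (\<Union>n\<in>?N. cball (fst (?c n)) (5 * snd (?c n)))"
      using C(1,4) by auto
  qed
qed

lemma hyper_finite_bounded:
  assumes "bounded G"
  shows "emeasure (hyper j) G < \<infinity>"
proof -
  obtain r where r: "r > 0" "G \<subseteq> cball 0 r"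
    using bounded_subset_ballD[OF assms, of 0] ball_subset_cball by blast
  have "emeasure (hyper j) G \<le> emeasure (hyper j) (cball 0 r)"
    using r by (intro emeasure_mono) auto
  also have "\<dots> < \<infinity>"
    using r by (simp add: emeasure_hyper_cball_0)
  finally show ?thesis .
qed

text \<open>Finitely many disjoint small balls fill a fixed proportion of \<open>G\<close>, and their Hausdorff weight is
  exactly their measure; so any constant \<open>s > 1\<close> that works for all open sets can be improved.\<close>

lemma hausdorff_pre_hyperplane_open_step:
  fixes G :: "(real^'n::finite) set" and j :: 'n and \<delta> :: real
  defines "k \<equiv> CARD('n) - 1" and "P \<equiv> {z :: real^'n. z $ j = 0}"
  assumes \<delta>: "\<delta> > 0" and G: "open G" "bounded G"
  shows "hausdorff_pre k \<delta> (G \<inter> P) \<le> ennreal (5 ^ k) * emeasure (hyper j) G"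
    and "\<lbrakk>s \<ge> 1; \<And>G. open G \<Longrightarrow> bounded G \<Longrightarrow> hausdorff_pre k \<delta> (G \<inter> P) \<le> ennreal s * emeasure (hyper j) G\<rbrakk>
      \<Longrightarrow> hausdorff_pre k \<delta> (G \<inter> P) \<le> ennreal (1 + (s - 1) * (1 - 1 / (2 * 5 ^ k))) * emeasure (hyper j) G"
proof -
  \<comment> \<open>The fivefold enlargement of a ball of radius \<open>r\<close> has diameter
    \<open>10 * r\<close>, which must not exceed \<open>\<delta>\<close>.\<close>
  have \<delta>10: "\<delta> / 10 > 0" using \<delta> by simp
  obtain N :: "nat set" and a r where V: "(\<forall>n\<in>N. a n \<in> G \<inter> P) \<and> (\<forall>n\<in>N. 0 < r n \<and> r n \<le> \<delta> / 10 \<and> cball (a n) (r n) \<subseteq> G) \<and>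
      (\<forall>m\<in>N. \<forall>n\<in>N. m \<noteq> n \<longrightarrow> cball (a m) (r m) \<inter> cball (a n) (r n) = {}) \<and>
      G \<inter> P \<subseteq> (\<Union>n\<in>N. cball (a n) (5 * r n))"
    using vitali_sequence[OF G(1) Int_lower1[of G P] \<delta>10] by (elim exE) (rule that)
  note aP = V[THEN conjunct1, rule_format]
    and r = V[THEN conjunct2, THEN conjunct1, rule_format]
    and disj = V[THEN conjunct2, THEN conjunct2, THEN conjunct1, rule_format]
    and cov = V[THEN conjunct2, THEN conjunct2, THEN conjunct2]
  define B where "B n = (if n \<in> N then cball (a n) (r n) else {})" for n
  define B5 where "B5 n = (if n \<in> N then cball (a n) (5 * r n) else {})" for n
  define v where "v n = emeasure (hyper j) (B n)" for n
  have aj: "a n $ j = 0" if "n \<in> N" for n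
    using aP[OF that] by (simp add: P_def)
  have Bborel [measurable]: "B n \<in> sets borel" "B5 n \<in> sets borel" for n
    by (auto simp: B_def B5_def)
  have wB: "hausdorff_weight k (B n) = v n" for n
    using r[of n] aj[of n] emeasure_hyper_cball[of "r n" "a n" j]
    by (auto simp: v_def B_def hausdorff_weight_def k_def)
  have wB5: "hausdorff_weight k (B5 n) = ennreal (5 ^ k) * v n" for n
    using r[of n] aj[of n] emeasure_hyper_cball[of "r n" "a n" j]
    by (auto simp: v_def B_def B5_def hausdorff_weight_def k_def power_mult_distrib ac_simps simp flip: ennreal_mult)
  have disjB: "disjoint_family B"
    using disj by (auto simp: disjoint_family_on_def B_def)
  have BG: "B n \<subseteq> G" for n using r by (auto simp: B_def)
  have sum_le: "(\<Sum>n. v n) \<le> emeasure (hyper j) G"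
    unfolding v_def using disjB BG G
    by (subst suminf_emeasure) (auto intro!: emeasure_mono)
  have bdB: "bounded (B5 n)" "diameter (B5 n) \<le> \<delta>" "bounded (B n)" "diameter (B n) \<le> \<delta>" for n
    using r[of n] \<delta> by (auto simp: B_def B5_def)
  have "hausdorff_pre k \<delta> (G \<inter> P) \<le> (\<Sum>n. hausdorff_weight k (B5 n))"
    using cov bdB by (intro hausdorff_pre_lower) (auto simp: B5_def split: if_splits)
  also have "\<dots> = ennreal (5 ^ k) * (\<Sum>n. v n)"
    by (simp add: wB5)
  also have "\<dots> \<le> ennreal (5 ^ k) * emeasure (hyper j) G"
    using sum_le by (intro mult_left_mono) auto
  finally show crude: "hausdorff_pre k \<delta> (G \<inter> P) \<le> ennreal (5 ^ k) * emeasure (hyper j) G" .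
  assume s: "s \<ge> 1" and IH: "\<And>G. open G \<Longrightarrow> bounded G \<Longrightarrow> hausdorff_pre k \<delta> (G \<inter> P) \<le> ennreal s * emeasure (hyper j) G"
  show "hausdorff_pre k \<delta> (G \<inter> P) \<le> ennreal (1 + (s - 1) * (1 - 1 / (2 * 5 ^ k))) * emeasure (hyper j) G"
  proof (cases "emeasure (hyper j) G = 0")
    case True
    then show ?thesis using crude by simp
  next
    case False
    obtain m where m: "emeasure (hyper j) G = ennreal m" "m \<ge> 0"
      using hyper_finite_bounded[OF G(2), of j] by (cases "emeasure (hyper j) G") auto
    have m0: "m > 0" using False m by auto
    have "emeasure (hyper j) G = emeasure (hyper j) (G \<inter> P)"
      using AE_hyper[of j] G by (intro emeasure_eq_AE) (auto simp: P_def elim!: eventually_mono)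
    also have "\<dots> \<le> emeasure (hyper j) (\<Union>n. B5 n)"
      using cov by (intro emeasure_mono) (auto simp: B5_def split: if_splits)
    also have "\<dots> \<le> (\<Sum>n. emeasure (hyper j) (B5 n))"
      by (rule emeasure_subadditive_countably) auto
    also have "\<dots> \<le> (\<Sum>n. hausdorff_weight k (B5 n))"
      using hyper_le_weight[OF bdB(1), of j] closure_closed[of "B5 n" for n]
      by (intro suminf_le) (auto simp: k_def B5_def)
    also have "\<dots> = ennreal (5 ^ k) * (\<Sum>n. v n)"
      by (simp add: wB5)
    finally have "ennreal (1 / 5 ^ k) * ennreal m \<le> (\<Sum>n. v n)"
      by (simp add: le_ennreal_mult_iff m(1))
    \<comment> \<open>Giving up half of the proportion \<open>1 / 5 ^ k\<close> makes the inequality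
      strict, so that finitely many balls reach it. Their union \<open>W\<close> is then closed and
      \<open>G - W\<close> is open, as the assumption on \<open>s\<close> requires.\<close>
    moreover have "ennreal (m / (2 * 5 ^ k)) < ennreal (1 / 5 ^ k) * ennreal m"
      using m0 by (simp add: ennreal_less_iff field_simps flip: ennreal_mult)
    ultimately have "ennreal (m / (2 * 5 ^ k)) < (\<Sum>n. v n)"
      by (rule order.strict_trans2[rotated])
    then obtain n where n: "ennreal (m / (2 * 5 ^ k)) < (\<Sum>i<n. v i)"
      by (auto simp: suminf_eq_SUP less_SUP_iff)
    define W where "W = (\<Union>i<n. B i)"
    have "closed (B i)" for i by (simp add: B_def)
    then have "closed W" unfolding W_def by (intro closed_UN) auto
    moreover have "W \<subseteq> G" using BG unfolding W_def by blast
    ultimately have W: "closed W" "W \<subseteq> G" "W \<in> sets borel" by auto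
    have eW: "emeasure (hyper j) W = (\<Sum>i<n. v i)"
      unfolding W_def v_def using disjB
      by (intro sum_emeasure[symmetric]) (auto simp: disjoint_family_on_def)
    have "emeasure (hyper j) G = emeasure (hyper j) W + emeasure (hyper j) (G - W)"
      using W G by (subst plus_emeasure) (auto intro!: arg_cong[where f="emeasure (hyper j)"])
    then obtain w g where wg: "emeasure (hyper j) W = ennreal w" "emeasure (hyper j) (G - W) = ennreal g"
      "w \<ge> 0" "g \<ge> 0" "m = w + g"
      using m by (cases "emeasure (hyper j) W"; cases "emeasure (hyper j) (G - W)")
        (auto simp: top_add simp flip: ennreal_plus)
    have wm: "m / (2 * 5 ^ k) \<le> w"
      using n wg(1,3) m0 unfolding eW[symmetric] by (simp add: ennreal_less_iff)
    have "hausdorff_pre k \<delta> W \<le> (\<Sum>i. hausdorff_weight k (if i < n then B i else {}))"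
      using bdB \<delta> by (intro hausdorff_pre_lower) (auto simp: W_def split: if_splits)
    also have "\<dots> = (\<Sum>i<n. hausdorff_weight k (if i < n then B i else {}))"
      by (rule suminf_finite) auto
    also have "\<dots> = ennreal w"
      by (simp add: wB eW[symmetric] wg)
    finally have preW: "hausdorff_pre k \<delta> W \<le> ennreal w" .
    have preG: "hausdorff_pre k \<delta> ((G - W) \<inter> P) \<le> ennreal s * ennreal g"
      using IH[of "G - W"] G W wg by (auto intro: bounded_subset)
    have "hausdorff_pre k \<delta> (G \<inter> P) \<le> hausdorff_pre k \<delta> (\<Union>i. if i = 0 then W else if i = Suc 0 then (G - W) \<inter> P else {})"
      by (rule hausdorff_pre_mono) (force split: if_splits)
    also have "\<dots> \<le> (\<Sum>i. hausdorff_pre k \<delta> (if i = 0 then W else if i = Suc 0 then (G - W) \<inter> P else {}))"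
      by (rule hausdorff_pre_subadditive)
    also have "\<dots> = (\<Sum>i\<in>{0, Suc 0}. hausdorff_pre k \<delta> (if i = 0 then W else if i = Suc 0 then (G - W) \<inter> P else {}))"
    proof (rule suminf_finite)
      have "hausdorff_pre k \<delta> ({} :: (real^'n) set) = 0"
        using hausdorff_pre_le_outer[OF \<delta>, of k "{} :: (real^'n) set"] by simp
      then show "hausdorff_pre k \<delta> (if i = 0 then W else if i = Suc 0 then (G - W) \<inter> P else {}) = 0"
        if "i \<notin> {0, Suc 0}" for i
        using that by auto
    qed simp
    also have "\<dots> \<le> ennreal w + ennreal s * ennreal g"
      using preW preG by (simp add: add_mono)
    also have "\<dots> = ennreal (w + s * g)"
      using wg s by (simp flip: ennreal_mult)
    \<comment> \<open>Here \<open>w + s * g = m + (s - 1) * (m - w)\<close>, and \<open>w\<close> is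
      at least the fraction \<open>1 / (2 * 5 ^ k)\<close> of \<open>m\<close>.\<close>
    also have "\<dots> \<le> ennreal ((1 + (s - 1) * (1 - 1 / (2 * 5 ^ k))) * m)"
    proof (rule ennreal_leI)
      have "(s - 1) * (m / (2 * 5 ^ k)) \<le> (s - 1) * w"
        using wm s by (intro mult_left_mono) auto
      then show "w + s * g \<le> (1 + (s - 1) * (1 - 1 / (2 * 5 ^ k))) * m"
        unfolding wg(5) by (simp add: algebra_simps)
    qed
    also have "\<dots> = ennreal (1 + (s - 1) * (1 - 1 / (2 * 5 ^ k))) * emeasure (hyper j) G"
    proof -
      have "1 \<le> (5::real) ^ k" by (rule one_le_power) simp
      then have "1 \<le> 2 * (5::real) ^ k" by linarith
      then have "0 \<le> 1 - 1 / (2 * 5 ^ k :: real)"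
        by (simp add: divide_le_eq_1)
      then have "0 \<le> 1 + (s - 1) * (1 - 1 / (2 * 5 ^ k))"
        using s by (intro add_nonneg_nonneg mult_nonneg_nonneg) auto
      then show ?thesis
        using m by (simp add: ennreal_mult)
    qed
    finally show ?thesis .
  qed
qed

text \<open>Starting from the crude constant \<open>5 ^ k\<close>, every application of the
  preceding step multiplies the excess over 1 by the fixed factor \<open>?q < 1\<close>; in the
  limit the constant is 1.\<close>

lemma hausdorff_pre_hyperplane_open:
  fixes G :: "(real^'n::finite) set" and j :: 'n
  assumes \<delta>: "\<delta> > 0" and G: "open G" "bounded G"
  shows "hausdorff_pre (CARD('n) - 1) \<delta> (G \<inter> {z. z $ j = 0}) \<le> emeasure (hyper j) G"
proof -
  let ?k = "CARD('n) - 1"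
  let ?q = "1 - 1 / (2 * 5 ^ ?k) :: real"
  have "1 \<le> (5::real) ^ ?k" by (rule one_le_power) simp
  then have "1 \<le> 2 * (5::real) ^ ?k" by linarith
  then have q: "0 \<le> ?q" "?q < 1" by (auto simp: divide_le_eq_1)
  have ge1: "1 \<le> 1 + (5 ^ ?k - 1) * ?q ^ n" for n
    using q by (simp add: one_le_power)
  have iter: "hausdorff_pre ?k \<delta> (G \<inter> {z. z $ j = 0}) \<le> ennreal (1 + (5 ^ ?k - 1) * ?q ^ n) * emeasure (hyper j) G"
    if "open G" "bounded G" for n and G :: "(real^'n) set"
    using that
  proof (induction n arbitrary: G)
    case 0
    then show ?case
      using hausdorff_pre_hyperplane_open_step(1)[OF \<delta>, of G j] by simp
  next
    case (Suc n)
    have "hausdorff_pre ?k \<delta> (G \<inter> {z. z $ j = 0})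
       \<le> ennreal (1 + (1 + (5 ^ ?k - 1) * ?q ^ n - 1) * ?q) * emeasure (hyper j) G"
      using Suc ge1 by (intro hausdorff_pre_hyperplane_open_step(2)[OF \<delta>]) auto
    moreover have "1 + (1 + (5 ^ ?k - 1) * ?q ^ n - 1) * ?q = 1 + (5 ^ ?k - 1) * ?q ^ Suc n"
      by (simp only: power_Suc add_diff_cancel_left' ac_simps)
    ultimately show ?case by (simp only:)
  qed
  obtain m where m: "emeasure (hyper j) G = ennreal m" "m \<ge> 0"
    using hyper_finite_bounded[OF G(2), of j] by (cases "emeasure (hyper j) G") auto
  have "(\<lambda>n. ennreal ((1 + (5 ^ ?k - 1) * ?q ^ n) * m)) \<longlonglongrightarrow> ennreal ((1 + (5 ^ ?k - 1) * 0) * m)"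
    using q by (intro tendsto_ennrealI tendsto_intros LIMSEQ_power_zero) simp
  moreover have "hausdorff_pre ?k \<delta> (G \<inter> {z. z $ j = 0}) \<le> ennreal ((1 + (5 ^ ?k - 1) * ?q ^ n) * m)" for n
    using iter[OF G, of n] m order_trans[OF zero_le_one ge1[of n]] by (simp add: ennreal_mult)
  ultimately show ?thesis
    unfolding m by (intro LIMSEQ_le_const) auto
qed

lemma hausdorff_hyperplane_le:
  fixes E :: "(real^'n::finite) set"
  assumes E: "E \<in> sets borel" "bounded E"
  shows "hausdorff_outer (CARD('n) - 1) (E \<inter> {z. z $ j = 0}) \<le> emeasure (hyper j) E"
  unfolding hausdorff_outer_def
proof (rule SUP_least)
  fix \<delta> :: real assume "\<delta> \<in> {0<..}"
  then have \<delta>: "\<delta> > 0" by simp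
  obtain r where r: "E \<subseteq> ball 0 r"
    using E(2) bounded_subset_ballD by blast
  \<comment> \<open>Open sets are reached from Borel sets by outer regularity, which is available
    for finite measures; hence the restriction to a ball.\<close>
  define M where "M = density (hyper j) (indicator (ball 0 r))"
  have eM: "emeasure M U = emeasure (hyper j) (U \<inter> ball 0 r)" if "U \<in> sets borel" for U
  proof -
    have "emeasure M U = (\<integral>\<^sup>+x. indicator (U \<inter> ball 0 r) x \<partial>hyper j)"
      unfolding M_def using that
      by (subst emeasure_density, intro borel_measurable_indicator, simp, simp, intro nn_integral_cong)
        (auto simp: indicator_def)
    also have "\<dots> = emeasure (hyper j) (U \<inter> ball 0 r)"
      using that by (intro nn_integral_indicator) auto
    finally show ?thesis .
  qed
  have "emeasure (hyper j) E = emeasure M E"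
    using r E by (simp add: eM Int_absorb2)
  also have "\<dots> = (INF U \<in> {U. E \<subseteq> U \<and> open U}. emeasure M U)"
  proof (rule outer_regular)
    show "emeasure M (space M) \<noteq> \<infinity>"
      using eM[of UNIV] hyper_finite_bounded[of "ball 0 r" j] by (simp add: M_def)
  qed (use E in \<open>auto simp: M_def\<close>)
  finally have eq: "emeasure (hyper j) E = (INF U \<in> {U. E \<subseteq> U \<and> open U}. emeasure M U)" .
  show "hausdorff_pre (CARD('n) - 1) \<delta> (E \<inter> {z. z $ j = 0}) \<le> emeasure (hyper j) E"
    unfolding eq
  proof (rule INF_greatest, clarify)
    fix U assume U: "E \<subseteq> U" "open U"
    have "hausdorff_pre (CARD('n) - 1) \<delta> (E \<inter> {z. z $ j = 0})
       \<le> hausdorff_pre (CARD('n) - 1) \<delta> ((U \<inter> ball 0 r) \<inter> {z. z $ j = 0})"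
      using U r by (intro hausdorff_pre_mono) auto
    also have "\<dots> \<le> emeasure (hyper j) (U \<inter> ball 0 r)"
      using U by (intro hausdorff_pre_hyperplane_open[OF \<delta>]) (auto intro: bounded_subset[OF bounded_ball])
    also have "\<dots> = emeasure M U"
      using U by (simp add: eM)
    finally show "hausdorff_pre (CARD('n) - 1) \<delta> (E \<inter> {z. z $ j = 0}) \<le> emeasure M U" .
  qed
qed

text \<open>The factor \<open>unit_ball_vol\<close> in \<open>hausdorff_weight\<close> is what makes
  the measures equal and not merely proportional. Spherical shells reduce the upper bound to bounded
  sets; the lower bound is the isodiametric inequality.\<close>

theorem hausdorff_hyperplane:
  fixes E :: "(real^'n::finite) set"
  assumes E: "E \<in> sets borel"
  shows "hausdorff_outer (CARD('n) - 1) (E \<inter> {z. z $ j = 0}) = emeasure (hyper j) E"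
proof (rule antisym)
  let ?A = "\<lambda>n::nat. E \<inter> {z. real n \<le> norm z \<and> norm z < real (Suc n)}"
  have A: "?A n \<in> sets borel" "bounded (?A n)" for n
    using E by (auto intro!: bounded_subset[OF bounded_ball[of 0 "real (Suc n)"]])
  have un: "E = (\<Union>n. ?A n)"
  proof (intro equalityI subsetI)
    fix x assume "x \<in> E"
    then have "x \<in> ?A (nat \<lfloor>norm x\<rfloor>)"
      by (auto simp: le_nat_iff) linarith+
    then show "x \<in> (\<Union>n. ?A n)" by blast
  qed auto
  have disj: "disjoint_family ?A"
    unfolding disjoint_family_on_def
  proof (intro ballI impI)
    fix m n :: nat assume "m \<noteq> n"
    then have "Suc m \<le> n \<or> Suc n \<le> m" by linarith
    then show "?A m \<inter> ?A n = {}"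
    proof
      assume "Suc m \<le> n"
      then have "real (Suc m) \<le> real n" by (simp only: of_nat_le_iff)
      then show ?thesis by auto
    next
      assume "Suc n \<le> m"
      then have "real (Suc n) \<le> real m" by (simp only: of_nat_le_iff)
      then show ?thesis by auto
    qed
  qed
  have "hausdorff_outer (CARD('n) - 1) (E \<inter> {z. z $ j = 0})
     = hausdorff_outer (CARD('n) - 1) (\<Union>n. ?A n \<inter> {z. z $ j = 0})"
    by (subst un) (simp only: Int_UN_distrib2 UN_simps)
  also have "\<dots> \<le> (\<Sum>n. hausdorff_outer (CARD('n) - 1) (?A n \<inter> {z. z $ j = 0}))"
    by (rule hausdorff_outer_subadditive)
  also have "\<dots> \<le> (\<Sum>n. emeasure (hyper j) (?A n))"
    using A by (intro suminf_le hausdorff_hyperplane_le) auto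
  also have "\<dots> = emeasure (hyper j) (\<Union>n. ?A n)"
    using A disj by (intro suminf_emeasure) auto
  finally show "hausdorff_outer (CARD('n) - 1) (E \<inter> {z. z $ j = 0}) \<le> emeasure (hyper j) E"
    by (simp only: un[symmetric])
next
  have P: "{z::real^'n. z $ j = 0} \<in> sets borel" by measurable
  have "emeasure (hyper j) E = emeasure (hyper j) (E \<inter> {z. z $ j = 0})"
    using AE_hyper[of j] E P by (intro emeasure_eq_AE) (auto elim!: eventually_mono)
  also have "\<dots> \<le> hausdorff_outer (CARD('n) - 1) (E \<inter> {z. z $ j = 0})"
    using E P by (intro hyper_le_hausdorff) auto
  finally show "emeasure (hyper j) E \<le> hausdorff_outer (CARD('n) - 1) (E \<inter> {z. z $ j = 0})" .
qed


section \<open>Linear images of the base space\<close>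

lemma base_part_eq_drop_coord: "base_part = drop_coord last_index"
  by (auto simp: base_part_def vec_eq_iff drop_coord_nth)

lemma mem_base_space: "z \<in> base_space \<longleftrightarrow> z $ last_index = 0"
  by (simp add: base_space_def)

lemma drop_coord_in_base [simp]: "drop_coord last_index z \<in> base_space"
  by (simp add: mem_base_space drop_coord_nth)

lemma subspace_base_space: "subspace base_space"
  by (simp add: subspace_def mem_base_space)

lemma closed_base_space: "closed base_space"
  unfolding base_space_def by (intro closed_Collect_eq continuous_intros)

lemma base_space_borel [measurable]: "base_space \<in> sets borel"
  by (rule borel_closed[OF closed_base_space])

lemma drop_coord_base: "z \<in> base_space \<Longrightarrow> drop_coord last_index z = z"
  by (simp add: drop_coord_id mem_base_space)

text \<open>Compares two maps without inverting either: points with equal value under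
  \<open>g\<close> have equal value under \<open>f\<close>, so \<open>f\<close> factors through
  \<open>g\<close> by a map that is Lipschitz with constant \<open>L\<close> on the image of
  \<open>A\<close> under \<open>g\<close>.\<close>

lemma hausdorff_outer_compare_images:
  fixes f :: "'a \<Rightarrow> 'b::real_normed_vector" and g :: "'a \<Rightarrow> 'c::real_normed_vector"
  assumes L: "L > 0" and f: "\<And>x y. x \<in> A \<Longrightarrow> y \<in> A \<Longrightarrow> norm (f x - f y) \<le> L * norm (g x - g y)"
  shows "hausdorff_outer k (f ` A) \<le> ennreal (L ^ k) * hausdorff_outer k (g ` A)"
proof -
  let ?h = "\<lambda>u. f (inv_into A g u)"
  have eq: "?h (g x) = f x" if x: "x \<in> A" for x
  proof -
    have "inv_into A g (g x) \<in> A" "g (inv_into A g (g x)) = g x"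
      using x by (auto intro: inv_into_into f_inv_into_f)
    then have "norm (?h (g x) - f x) \<le> L * norm (g x - g x)"
      using f[of "inv_into A g (g x)" x] x by simp
    then show ?thesis by simp
  qed
  have "?h ` (g ` A) = f ` A"
    using eq by (force simp: image_comp)
  moreover have "hausdorff_outer k (?h ` (g ` A)) \<le> ennreal (L ^ k) * hausdorff_outer k (g ` A)"
    using L by (rule hausdorff_outer_lipschitz_image) (use f eq in auto)
  ultimately show ?thesis by simp
qed

lemma hausdorff_outer_isometry_image:
  assumes "\<And>x y. x \<in> A \<Longrightarrow> y \<in> A \<Longrightarrow> norm (f x - f y) = norm (x - y)"
  shows "hausdorff_outer k (f ` A) = hausdorff_outer k A"
  using hausdorff_outer_compare_images[of 1 A f "\<lambda>x. x" k]
    hausdorff_outer_compare_images[of 1 A "\<lambda>x. x" f k] assms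
  by (intro antisym) auto

lemma hausdorff_outer_orthogonal:
  assumes "orthogonal_transformation T"
  shows "hausdorff_outer k (T ` A) = hausdorff_outer k A"
  using assms
  by (intro hausdorff_outer_isometry_image)
    (metis linear_diff orthogonal_transformation_linear orthogonal_transformation_norm)

lemma abs_det_orthogonal:
  fixes T :: "real^'n \<Rightarrow> real^'n"
  assumes "orthogonal_transformation T"
  shows "\<bar>det (matrix T)\<bar> = 1"
  using assms det_orthogonal_matrix[of "matrix T"] by (auto simp: orthogonal_transformation_matrix)

text \<open>Extends \<open>L\<close> from the base space by sending the last axis to
  \<open>v\<close>. With \<open>L\<close> the derivative of a chart and \<open>v\<close> a flight
  direction, it is the derivative of the parametrization of flights by chart parameter and
  time.\<close>

definition side_map :: "(real^'n::{finite,wellorder} \<Rightarrow> real^'n::_) \<Rightarrow> real^'n::_ \<Rightarrow> real^'n::_ \<Rightarrow> real^'n::_" where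
  "side_map L v h = L (drop_coord last_index h) + (h $ last_index) *\<^sub>R v"

definition side_det :: "(real^'n::{finite,wellorder} \<Rightarrow> real^'n::_) \<Rightarrow> real^'n::_ \<Rightarrow> real" where
  "side_det L v = det (matrix (side_map L v))"

text \<open>The generalised cross product of the \<open>L\<close>-images of the axes of the base
  space: a normal vector of the image hyperplane whose length is the (d-1)-dimensional Jacobian of
  \<open>L\<close>.\<close>

definition cross_normal :: "(real^'n::{finite,wellorder} \<Rightarrow> real^'n::_) \<Rightarrow> real^'n::_" where
  "cross_normal L = (\<chi> i. side_det L (axis i 1))"

lemma linear_side_map:
  assumes "linear L"
  shows "linear (side_map L v)"
  using assms by (auto intro!: linearI simp: side_map_def algebra_simps linear_add linear_scale
     linear_add[OF linear_drop_coord] linear_scale[OF linear_drop_coord])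

lemma side_map_axis:
  assumes "linear L"
  shows "side_map L v (axis j 1) = (if j = last_index then v else L (axis j 1))"
proof -
  have "drop_coord last_index (axis j 1) = (if j = last_index then 0 else axis j (1::real))"
    by (simp add: vec_eq_iff drop_coord_nth axis_def)
  then show ?thesis
    using linear_0[OF assms] by (simp add: side_map_def axis_def)
qed

lemma side_det_rows:
  assumes "linear L"
  shows "side_det L v = det (\<chi> i. if i = last_index then v else L (axis i 1))"
proof -
  have "matrix (side_map L v) = transpose (\<chi> i. if i = last_index then v else L (axis i 1))"
    by (simp add: matrix_def transpose_def vec_eq_iff side_map_axis[OF assms])
  then show ?thesis by (simp add: side_det_def)
qed

lemma linear_side_det:
  assumes "linear L"
  shows "linear (side_det L)"
proof (rule linearI)
  show "side_det L (v + w) = side_det L v + side_det L w" for v w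
    unfolding side_det_rows[OF assms]
    using det_row_add[of last_index "\<lambda>_. v" "\<lambda>_. w" "\<lambda>i. L (axis i 1)"] by simp
  show "side_det L (c *\<^sub>R v) = c *\<^sub>R side_det L v" for c v
    unfolding side_det_rows[OF assms] real_scaleR_def scalar_mult_eq_scaleR[symmetric]
    by (rule det_row_mul[of last_index c "\<lambda>_. v" "\<lambda>i. L (axis i 1)"])
qed

lemma side_det_eq_inner:
  assumes "linear L"
  shows "side_det L v = cross_normal L \<bullet> v"
proof -
  have "side_det L v = side_det L (\<Sum>i\<in>UNIV. v $ i *\<^sub>R axis i 1)"
    using basis_expansion[of v] by (simp add: scalar_mult_eq_scaleR)
  also have "\<dots> = (\<Sum>i\<in>UNIV. v $ i * side_det L (axis i 1))"
    by (simp add: linear_sum[OF linear_side_det[OF assms]] linear_scale[OF linear_side_det[OF assms]])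
  finally show ?thesis
    by (simp add: cross_normal_def inner_vec_def mult.commute)
qed

lemma cross_normal_orthogonal:
  assumes L: "linear L" and h: "h \<in> base_space"
  shows "cross_normal L \<bullet> L h = 0"
proof -
  \<comment> \<open>For \<open>v = L h\<close> the nonzero vector
    \<open>axis last_index 1 - h\<close> lies in the kernel, so the determinant vanishes.\<close>
  have "side_map L (L h) (axis last_index 1 - h) = side_map L (L h) 0"
    using h L by (simp add: side_map_def mem_base_space linear_diff[OF linear_drop_coord]
       drop_coord_id linear_diff[OF L] linear_0 linear_neg) (simp add: drop_coord_def linear_0 linear_neg)
  moreover have "axis last_index 1 - h \<noteq> 0"
  proof
    assume "axis last_index 1 - h = 0"
    then have "(axis last_index 1 - h) $ last_index = 0" by (simp only: zero_index)
    then show False using h by (simp add: mem_base_space)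
  qed
  ultimately have "\<not> inj (side_map L (L h))"
    by (metis injD)
  then have "side_det L (L h) = 0"
    using det_nz_iff_inj[OF linear_side_map[OF L]] by (auto simp: side_det_def)
  then show ?thesis by (simp add: side_det_eq_inner[OF L])
qed

text \<open>Pairing with the unit normal \<open>v\<close> reads off the last coordinate, and what
  remains is injectivity on the base space.\<close>

lemma side_map_inj:
  assumes L: "linear L" "inj_on L base_space" and v: "norm v = 1" "\<And>h. h \<in> base_space \<Longrightarrow> v \<bullet> L h = 0"
  shows "inj (side_map L v)"
proof -
  have "h = 0" if h: "side_map L v h = 0" for h
  proof -
    have "v \<bullet> side_map L v h = h $ last_index"
      using v by (simp add: side_map_def inner_right_distrib dot_square_norm)
    then have last: "h $ last_index = 0" using h by simp
    then have "L h = L 0"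
      using h L(1) by (simp add: side_map_def drop_coord_id linear_0)
    then show "h = 0"
      using L(2) last by (auto simp: inj_on_def mem_base_space)
  qed
  then show ?thesis
    using linear_injective_0[OF linear_side_map[OF L(1)]] by blast
qed

lemma exists_unit_normal:
  fixes L :: "real^'n::{finite,wellorder} \<Rightarrow> real^'n::_"
  assumes L: "linear L"
  obtains v where "norm v = 1" "\<And>h. h \<in> base_space \<Longrightarrow> v \<bullet> L h = 0"
proof -
  have "(base_space :: (real^'n::_) set) \<noteq> UNIV"
  proof
    assume "(base_space :: (real^'n::_) set) = UNIV"
    then have "axis last_index 1 \<in> (base_space :: (real^'n::_) set)" by simp
    then show False by (simp add: mem_base_space)
  qed
  moreover have "span (base_space :: (real^'n::_) set) = base_space"
    using subspace_base_space by (simp only: span_eq_iff)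
  ultimately have "span (base_space :: (real^'n::_) set) \<noteq> UNIV"
    by (simp only: not_False_eq_True)
  then have "dim (base_space :: (real^'n::_) set) \<noteq> CARD('n)"
    using dim_eq_full[of "base_space :: (real^'n::_) set"] by simp
  then have "dim (base_space :: (real^'n::_) set) < CARD('n)"
    using dim_subset_UNIV_cart[of "base_space :: (real^'n::_) set"] by linarith
  then have "dim (L ` base_space) < CARD('n)"
    using dim_image_le[OF L, of base_space] by linarith
  then have "dim (L ` base_space) < card (Basis :: (real^'n::_) set)"
    by simp
  then obtain a where a: "a \<noteq> 0" "\<And>x. x \<in> span (L ` base_space) \<Longrightarrow> orthogonal a x"
    using orthogonal_to_subspace_exists by blast
  show ?thesis
  proof (rule that[of "a /\<^sub>R norm a"])
    show "norm (a /\<^sub>R norm a) = 1" using a by simp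
    show "(a /\<^sub>R norm a) \<bullet> L h = 0" if "h \<in> base_space" for h
      using a(2)[of "L h"] that by (auto simp: orthogonal_def span_base)
  qed
qed

text \<open>The difference \<open>?w\<close> is orthogonal to \<open>v\<close> and to the image of
  the base space, and these span everything because \<open>side_map L v\<close> is surjective; so
  \<open>?w\<close> is orthogonal to itself.\<close>

lemma cross_normal_eq_scaled:
  assumes L: "linear L" "inj_on L base_space" and v: "norm v = 1" "\<And>h. h \<in> base_space \<Longrightarrow> v \<bullet> L h = 0"
  shows "cross_normal L = (cross_normal L \<bullet> v) *\<^sub>R v"
proof -
  let ?w = "cross_normal L - (cross_normal L \<bullet> v) *\<^sub>R v"
  have "surj (side_map L v)"
    using side_map_inj[OF L v] linear_injective_imp_surjective[OF linear_side_map[OF L(1)]] by simp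
  then obtain h where h: "?w = side_map L v h" by (metis surjD)
  have "?w \<bullet> v = 0"
    using v(1) by (simp add: inner_diff_left dot_square_norm)
  moreover have "?w \<bullet> L (drop_coord last_index h) = 0"
    using cross_normal_orthogonal[OF L(1)] v(2) by (simp add: inner_diff_left)
  ultimately have "?w \<bullet> ?w = 0"
    by (subst (2) h) (simp add: side_map_def inner_right_distrib)
  then show ?thesis by simp
qed

lemma cross_normal_nonzero:
  assumes L: "linear L" "inj_on L base_space"
  shows "cross_normal L \<noteq> 0"
proof -
  obtain v where v: "norm v = 1" "\<And>h. h \<in> base_space \<Longrightarrow> v \<bullet> L h = 0"
    using exists_unit_normal[OF L(1)] by blast
  have "side_det L v \<noteq> 0"
    using det_nz_iff_inj[OF linear_side_map[OF L(1)]] side_map_inj[OF L v] by (simp add: side_det_def)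
  then show ?thesis using side_det_eq_inner[OF L(1), of v] by auto
qed

text \<open>Source of the cosine factor in the direction law: the volume of a parallelepiped is the
  (d-1)-volume \<open>norm (cross_normal L)\<close> of its base times its height
  \<open>\<bar>u \<bullet> v\<bar>\<close>.\<close>

lemma abs_side_det_eq:
  assumes L: "linear L" "inj_on L base_space" and v: "norm v = 1" "\<And>h. h \<in> base_space \<Longrightarrow> v \<bullet> L h = 0"
  shows "\<bar>side_det L u\<bar> = norm (cross_normal L) * \<bar>u \<bullet> v\<bar>"
proof -
  have eq: "cross_normal L = (cross_normal L \<bullet> v) *\<^sub>R v"
    by (rule cross_normal_eq_scaled[OF L v])
  have "norm (cross_normal L) = \<bar>cross_normal L \<bullet> v\<bar>"
    using arg_cong[OF eq, of norm] v(1) by simp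
  moreover have "side_det L u = (cross_normal L \<bullet> v) * (u \<bullet> v)"
    unfolding side_det_eq_inner[OF L(1)]
    using arg_cong[OF eq, of "\<lambda>w. w \<bullet> u"] by (simp only: inner_scaleR_left inner_commute[of v u])
  ultimately show ?thesis by (simp add: abs_mult)
qed

lemma linear_injective_on_base_bound:
  fixes L :: "real^'n::{finite,wellorder} \<Rightarrow> real^'n::_"
  assumes "linear L" "inj_on L base_space"
  obtains m where "m > 0" "\<And>h. h \<in> base_space \<Longrightarrow> m * norm h \<le> norm (L h)"
proof -
  have "\<exists>m>0. \<forall>h\<in>base_space. norm (L h) \<ge> m * norm h"
  proof (rule injective_imp_isometric[OF closed_base_space subspace_base_space])
    show "bounded_linear L" using assms by (simp add: linear_linear)
    show "\<forall>h\<in>base_space. L h = 0 \<longrightarrow> h = 0"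
      using assms(2) linear_0[OF assms(1)] subspace_0[OF subspace_base_space]
      by (metis inj_onD)
  qed
  then show ?thesis using that by blast
qed

lemma emeasure_lborel_lmeasurable:
  assumes X: "X \<in> sets borel" "X \<in> lmeasurable"
  shows "emeasure lborel X = ennreal (measure lebesgue X)"
proof -
  have "emeasure lborel X = emeasure lebesgue X"
    using X(1) by simp
  also have "\<dots> = ennreal (measure lebesgue X)"
    using fmeasurableD2[OF X(2)] by (rule emeasure_eq_ennreal_measure)
  finally show ?thesis .
qed

text \<open>The rotation \<open>T\<close> turns the image hyperplane into the base space.
  \<open>B\<close> preserves the last coordinate and commutes with the projection, so it maps the
  unit cylinder over \<open>E\<close> onto the unit cylinder over its image; the (d-1)-dimensional
  Jacobian is thus the absolute determinant of \<open>B\<close>.\<close>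

lemma hausdorff_linear_image:
  fixes L :: "real^'n::{finite,wellorder} \<Rightarrow> real^'n::_"
  assumes L: "linear L" "inj_on L base_space" and E: "E \<in> sets borel" "bounded E" "E \<subseteq> base_space"
  shows "hausdorff_outer (CARD('n) - 1) (L ` E) = ennreal (norm (cross_normal L)) * emeasure (hyper last_index) E"
proof -
  obtain v where v: "norm v = 1" "\<And>h. h \<in> base_space \<Longrightarrow> v \<bullet> L h = 0"
    using exists_unit_normal[OF L(1)] by blast
  have "norm v = norm (axis last_index (1::real) :: real^'n::_)"
    using v(1) by simp
  then obtain T :: "real^'n::_ \<Rightarrow> real^'n::_" where T: "orthogonal_transformation T" "T v = axis last_index 1"
    using orthogonal_transformation_exists by blast
  define B where "B = T \<circ> side_map L v"
  have linB: "linear B"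
    unfolding B_def by (intro linear_compose linear_side_map L orthogonal_transformation_linear T)
  have injB: "inj B"
    using side_map_inj[OF L v] orthogonal_transformation_inj[OF T(1)] by (simp add: inj_compose B_def)
  have lastB: "B h $ last_index = h $ last_index" for h
  proof -
    have "B h $ last_index = T (side_map L v h) \<bullet> T v"
      by (simp add: T(2) inner_axis B_def)
    also have "\<dots> = side_map L v h \<bullet> v"
      using T(1) by (simp add: orthogonal_transformation_def)
    also have "\<dots> = h $ last_index"
      using v by (simp add: side_map_def inner_left_distrib dot_square_norm
          inner_commute[of "L (drop_coord last_index h)" v])
    finally show ?thesis .
  qed
  have BL: "B h = T (L h)" if "h \<in> base_space" for h
    using that by (simp add: side_map_def mem_base_space drop_coord_id B_def)
  have Be: "B (axis last_index 1) = axis last_index 1"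
    using linear_0[OF L(1)] T(2) by (simp add: side_map_def drop_coord_def B_def)
  have Bdrop: "drop_coord last_index (B h) = B (drop_coord last_index h)" for h
    unfolding drop_coord_def linear_diff[OF linB] linear_scale[OF linB] Be lastB ..
  obtain C where C: "linear C" "C \<circ> B = id"
    using linear_injective_left_inverse[OF linB injB] by blast
  then have CB: "C (B x) = x" for x by (simp add: fun_eq_iff)
  have BC: "B (C x) = x" for x
    using linear_injective_imp_surjective[OF linB injB] CB by (metis surjD)
  have imB: "B ` X = {x. C x \<in> X}" for X
  proof (intro equalityI subsetI)
    fix x assume "x \<in> {x. C x \<in> X}"
    then show "x \<in> B ` X" using BC[of x] by (metis imageI mem_Collect_eq)
  qed (auto simp: CB)
  have Cm [measurable]: "C \<in> borel_measurable borel"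
    using C(1) by (intro borel_measurable_continuous_onI linear_continuous_on) (simp add: linear_linear)
  note E(1)[measurable]
  let ?X = "{w \<in> slab last_index. drop_coord last_index w \<in> E}"
  have X: "?X \<in> sets borel" by measurable
  have TLE: "T ` L ` E = B ` E" "T ` L ` E \<subseteq> base_space"
  proof -
    show 1: "T ` L ` E = B ` E"
      using BL E(3) by (auto simp: image_image intro!: image_cong)
    show "T ` L ` E \<subseteq> base_space"
      unfolding 1 using lastB E(3) by (auto simp: mem_base_space)
  qed
  have Bbor: "B ` E \<in> sets borel"
    unfolding imB by measurable
  have bX: "bounded ?X"
  proof -
    obtain r where r: "\<And>x. x \<in> E \<Longrightarrow> norm x \<le> r"
      using E(2) by (auto simp: bounded_iff)
    show ?thesis unfolding bounded_iff
    proof (intro exI ballI)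
      fix w assume w: "w \<in> ?X"
      have "norm w \<le> norm (drop_coord last_index w) + norm ((w $ last_index) *\<^sub>R axis last_index (1::real))"
        using norm_triangle_ineq[of "drop_coord last_index w" "(w $ last_index) *\<^sub>R axis last_index (1::real)"]
        by (simp add: drop_coord_decomp)
      then show "norm w \<le> r + 1"
        using w r[of "drop_coord last_index w"] by (simp add: slab_def)
    qed
  qed
  have Xl: "?X \<in> lmeasurable"
    using X bX by (intro bounded_set_imp_lmeasurable) auto
  have fX: "emeasure lborel ?X = ennreal (measure lebesgue ?X)"
    by (rule emeasure_lborel_lmeasurable[OF X Xl])
  have im: "{w \<in> slab last_index. drop_coord last_index w \<in> B ` E} = B ` ?X"
  proof -
    have "C w $ last_index = w $ last_index" for w
      using lastB[of "C w"] by (simp only: BC)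
    moreover have "drop_coord last_index (C w) = C (drop_coord last_index w)" for w
      using arg_cong[OF Bdrop[of "C w"], of C] by (simp only: BC CB)
    ultimately show ?thesis unfolding imB slab_def by simp
  qed
  have "hausdorff_outer (CARD('n) - 1) (L ` E) = hausdorff_outer (CARD('n) - 1) (T ` L ` E)"
    by (rule hausdorff_outer_orthogonal[OF T(1), symmetric])
  also have "T ` L ` E = (B ` E) \<inter> {z. z $ last_index = 0}"
    using TLE by (auto simp: base_space_def)
  also have "hausdorff_outer (CARD('n) - 1) \<dots> = emeasure (hyper last_index) (B ` E)"
    by (rule hausdorff_hyperplane[OF Bbor])
  also have "\<dots> = emeasure lborel (B ` ?X)"
    by (subst emeasure_hyper[OF Bbor]) (simp only: im)
  also have "\<dots> = ennreal (measure lebesgue (B ` ?X))"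
  proof -
    have "B ` ?X \<in> sets borel" unfolding imB by measurable
    then show ?thesis
      using measurable_linear_image[OF linB Xl] by (rule emeasure_lborel_lmeasurable)
  qed
  also have "measure lebesgue (B ` ?X) = \<bar>det (matrix B)\<bar> * measure lebesgue ?X"
    by (rule measure_linear_image[OF linB Xl])
  also have "\<bar>det (matrix B)\<bar> = \<bar>side_det L v\<bar>"
    using abs_det_orthogonal[OF T(1)]
    by (simp add: matrix_compose[OF linear_side_map[OF L(1)] orthogonal_transformation_linear[OF T(1)]]
        det_mul abs_mult side_det_def B_def)
  also have "\<dots> = norm (cross_normal L)"
    using abs_side_det_eq[OF L v, of v] v(1) by (simp add: dot_square_norm)
  also have "ennreal (norm (cross_normal L) * measure lebesgue ?X) = ennreal (norm (cross_normal L)) * emeasure lborel ?X"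
    by (simp add: fX ennreal_mult)
  also have "emeasure lborel ?X = emeasure (hyper last_index) E"
    by (rule emeasure_hyper[OF E(1), symmetric])
  finally show ?thesis .
qed


section \<open>The area formula for C1 charts\<close>

text \<open>The surrounding hypersurface is left out and only Borel measurability of the image is
  kept, so that boundary charts and the graph chart of the hemisphere share one theory.\<close>

locale c1_chart =
  fixes U :: "(real^'n::{finite,wellorder}) set" and \<phi> :: "real^'n::_ \<Rightarrow> real^'n::_"
    and \<phi>' :: "real^'n::_ \<Rightarrow> real^'n::_ \<Rightarrow> real^'n::_" and \<psi> :: "real^'n::_ \<Rightarrow> real^'n::_"
  assumes U_open: "openin (top_of_set base_space) U"
    and hom: "homeomorphism U (\<phi> ` U) \<phi> \<psi>"
    and image_borel: "\<phi> ` U \<in> sets borel"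
    and der: "\<And>z. z \<in> U \<Longrightarrow> (\<phi> has_derivative \<phi>' z) (at z within U)"
    and inj_der: "\<And>z. z \<in> U \<Longrightarrow> inj_on (\<phi>' z) base_space"
    and cont_der: "\<And>h. h \<in> base_space \<Longrightarrow> continuous_on U (\<lambda>z. \<phi>' z h)"
begin

lemma U_base: "U \<subseteq> base_space"
  using U_open openin_imp_subset by blast

lemma U_borel [measurable]: "U \<in> sets borel"
proof -
  obtain T where "open T" "U = base_space \<inter> T"
    using U_open by (auto simp: openin_open)
  then show ?thesis by auto
qed

lemma inj_phi: "inj_on \<phi> U"
  using hom by (metis homeomorphism_apply1 inj_on_inverseI)

lemma linear_der: "z \<in> U \<Longrightarrow> linear (\<phi>' z)"
  using der by (blast intro: has_derivative_linear)

text \<open>Extended by 0 outside \<open>U\<close>, as is \<open>phi0\<close>: both become Borel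
  functions on the whole space, and integrals against \<open>hyper\<close> carry no indicator of
  \<open>U\<close>.\<close>

definition jac :: "real^'n::{finite,wellorder} \<Rightarrow> real" where
  "jac z = (if z \<in> U then norm (cross_normal (\<phi>' z)) else 0)"

definition phi0 :: "real^'n::{finite,wellorder} \<Rightarrow> real^'n::_" where
  "phi0 z = indicator U z *\<^sub>R \<phi> z"

lemma phi0_eq: "z \<in> U \<Longrightarrow> phi0 z = \<phi> z"
  by (simp add: phi0_def)

lemma phi0_measurable [measurable]: "phi0 \<in> borel_measurable borel"
  unfolding phi0_def
  using hom by (intro borel_measurable_continuous_on_indicator U_borel) (auto simp: homeomorphism_def)

lemma continuous_cross: "continuous_on U (\<lambda>z. cross_normal (\<phi>' z))"
proof -
  have "continuous_on U (\<lambda>z. det (\<chi> i. if i = last_index then axis k 1 else \<phi>' z (axis i 1)))" for k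
  proof -
    have "continuous_on U (\<lambda>z. (if i = last_index then axis k 1 else \<phi>' z (axis i 1)) $ l)" for i l
      by (cases "i = last_index") (auto intro!: continuous_intros cont_der simp: mem_base_space axis_def)
    then show ?thesis
      unfolding det_def vec_lambda_beta
      by (intro continuous_on_sum continuous_on_mult continuous_on_const continuous_on_prod)
  qed
  then have "continuous_on U (\<lambda>z. side_det (\<phi>' z) (axis k 1))" for k
    by (rule continuous_on_eq) (simp add: side_det_rows linear_der)
  then show ?thesis
    unfolding cross_normal_def by (intro continuous_on_vec_lambda)
qed

lemma jac_measurable [measurable]: "jac \<in> borel_measurable borel"
proof -
  have "(\<lambda>z. indicator U z *\<^sub>R norm (cross_normal (\<phi>' z))) \<in> borel_measurable borel"
    by (intro borel_measurable_continuous_on_indicator U_borel continuous_on_norm continuous_cross)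
  moreover have "jac = (\<lambda>z. indicator U z *\<^sub>R norm (cross_normal (\<phi>' z)))"
    by (auto simp: jac_def)
  ultimately show ?thesis by simp
qed

lemma jac_nonneg [simp]: "jac z \<ge> 0"
  by (simp add: jac_def)

lemma jac_pos: "z \<in> U \<Longrightarrow> jac z > 0"
  using cross_normal_nonzero[OF linear_der inj_der] by (simp add: jac_def)

text \<open>The estimate is for all pairs near \<open>z0\<close>, not only against \<open>z0\<close>
  itself, because two maps are to be compared metrically. It is the mean value inequality for
  \<open>\<phi>\<close> minus its linearization on a convex piece of the base space, where
  continuity of \<open>\<phi>'\<close> makes the derivative small.\<close>

lemma strict_derivative:
  assumes z0: "z0 \<in> U" and e: "e > 0"
  shows "\<exists>r>0. \<forall>z\<in>U \<inter> ball z0 r. \<forall>w\<in>U \<inter> ball z0 r. norm (\<phi> z - \<phi> w - \<phi>' z0 (z - w)) \<le> e * norm (z - w)"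
proof -
  let ?d = "drop_coord last_index :: real^'n::_ \<Rightarrow> _"
  \<comment> \<open>Dominates the operator norm of \<open>\<phi>' z - \<phi>' z0\<close> on the base
    space and is continuous in \<open>z\<close>.\<close>
  let ?s = "\<lambda>z. \<Sum>i\<in>UNIV. norm (\<phi>' z (?d (axis i 1)) - \<phi>' z0 (?d (axis i 1)))"
  have "continuous_on U ?s"
    by (intro continuous_intros cont_der) auto
  then obtain r1 where r1: "r1 > 0" "\<And>z. z \<in> U \<Longrightarrow> dist z z0 < r1 \<Longrightarrow> dist (?s z) (?s z0) < e"
    using z0 e unfolding continuous_on_iff by blast
  obtain T where T: "open T" "U = base_space \<inter> T"
    using U_open by (auto simp: openin_open)
  then obtain r2 where r2: "r2 > 0" "ball z0 r2 \<subseteq> T"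
    using z0 open_contains_ball by blast
  define r where "r = min r1 r2"
  let ?S = "base_space \<inter> ball z0 r"
  have S: "?S \<subseteq> U" "U \<inter> ball z0 r = ?S"
    using T r2 by (auto simp: r_def)
  have "convex ?S"
    using subspace_base_space by (intro convex_Int subspace_imp_convex convex_ball)
  \<comment> \<open>Precomposition with the projection removes the directions off the base space, in
    which \<open>\<phi>'\<close> is not controlled, so that the full operator norm is small.\<close>
  let ?f = "\<lambda>z. \<phi> (?d z) - \<phi>' z0 (?d z)"
  let ?f' = "\<lambda>z h. \<phi>' z (?d h) - \<phi>' z0 (?d h)"
  have bl0: "bounded_linear (\<phi>' z0)"
    using der[OF z0] by (rule has_derivative_bounded_linear)
  have derf: "(?f has_derivative ?f' z) (at z within ?S)" if z: "z \<in> ?S" for z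
  proof -
    have dz: "?d z = z" using z by (simp add: drop_coord_base)
    have im: "?d ` ?S = ?S" using drop_coord_base by force
    have 1: "(?d has_derivative ?d) (at z within ?S)"
      using bounded_linear_drop_coord by (rule bounded_linear_imp_has_derivative)
    have "(\<phi> has_derivative \<phi>' z) (at z within ?S)"
      using der[of z] z S by (blast intro: has_derivative_subset)
    then have "(\<phi> has_derivative \<phi>' z) (at (?d z) within ?d ` ?S)"
      by (simp only: dz im)
    from diff_chain_within[OF 1 this]
    have 2: "((\<lambda>z. \<phi> (?d z)) has_derivative (\<lambda>h. \<phi>' z (?d h))) (at z within ?S)"
      by (simp add: o_def)
    have 3: "((\<lambda>z. \<phi>' z0 (?d z)) has_derivative (\<lambda>h. \<phi>' z0 (?d h))) (at z within ?S)"
      by (intro bounded_linear_imp_has_derivative bounded_linear_compose[OF bl0] bounded_linear_drop_coord)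
    show ?thesis by (rule has_derivative_diff[OF 2 3])
  qed
  have on: "onorm (?f' z) \<le> e" if z: "z \<in> ?S" for z
  proof (rule onorm_le)
    fix h :: "real^'n::_"
    have zU: "z \<in> U" using z S by blast
    have lin: "linear (?f' z)"
      using linear_der[OF zU] linear_der[OF z0]
      by (auto intro!: linearI simp: linear_add[OF linear_drop_coord] linear_scale[OF linear_drop_coord]
          linear_add linear_scale algebra_simps)
    have "h = (\<Sum>i\<in>UNIV. h $ i *\<^sub>R axis i 1)"
      using basis_expansion[of h] by (simp add: scalar_mult_eq_scaleR)
    then have "?f' z h = (\<Sum>i\<in>UNIV. h $ i *\<^sub>R ?f' z (axis i 1))"
      using linear_sum[OF lin, of "\<lambda>i. h $ i *\<^sub>R axis i 1" UNIV] linear_scale[OF lin] by simp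
    then have "norm (?f' z h) \<le> (\<Sum>i\<in>UNIV. norm (h $ i *\<^sub>R ?f' z (axis i 1)))"
      by (simp only: norm_sum)
    also have "\<dots> \<le> (\<Sum>i\<in>UNIV. norm h * norm (?f' z (axis i 1)))"
      by (intro sum_mono) (simp add: mult_right_mono component_le_norm_cart)
    also have "\<dots> = norm h * ?s z" by (simp add: sum_distrib_left)
    also have "\<dots> \<le> norm h * e"
    proof (rule mult_left_mono)
      have "dist (?s z) (?s z0) < e"
        using z zU by (intro r1) (auto simp: r_def dist_commute)
      then show "?s z \<le> e" by (simp add: dist_real_def)
    qed simp
    finally show "norm (?f' z h) \<le> e * norm h" by (simp add: mult.commute)
  qed
  show ?thesis
  proof (intro exI conjI ballI)
    show "r > 0" using r1 r2 by (simp add: r_def)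
    fix z w assume "z \<in> U \<inter> ball z0 r" "w \<in> U \<inter> ball z0 r"
    then have zw: "z \<in> ?S" "w \<in> ?S" unfolding S by auto
    have "norm (?f z - ?f w) \<le> e * norm (z - w)"
      using differentiable_bound[OF \<open>convex ?S\<close> derf on zw] .
    moreover have "?f z - ?f w = \<phi> z - \<phi> w - \<phi>' z0 (z - w)"
      using zw by (simp add: drop_coord_base linear_diff[OF linear_der[OF z0]])
    ultimately show "norm (\<phi> z - \<phi> w - \<phi>' z0 (z - w)) \<le> e * norm (z - w)" by simp
  qed
qed

definition area_measure :: "(real^'n::{finite,wellorder}) measure" where
  "area_measure = density (hyper last_index) (\<lambda>z. ennreal (jac z))"

lemma sets_area_measure [simp, measurable_cong]: "sets area_measure = sets borel"
  by (simp add: area_measure_def)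

lemma emeasure_area_measure:
  "E \<in> sets borel \<Longrightarrow> emeasure area_measure E = (\<integral>\<^sup>+z. ennreal (jac z) * indicator E z \<partial>hyper last_index)"
  unfolding area_measure_def by (subst emeasure_density) auto

text \<open>Near \<open>z0\<close> distances under \<open>\<phi>\<close> and under its linearization
  agree up to the factor \<open>l\<close>, which costs \<open>l\<close> to the power d-1 in
  Hausdorff measure; one more factor \<open>l\<close> bounds the variation of \<open>jac\<close>.
  Together this is \<open>l ^ CARD('n)\<close>.\<close>

lemma local_area:
  assumes z0: "z0 \<in> U" and l: "l > 1"
  shows "\<exists>r>0. \<forall>E\<in>sets borel. E \<subseteq> U \<inter> ball z0 r \<longrightarrow>
     hausdorff_outer (CARD('n) - 1) (\<phi> ` E) \<le> ennreal (l ^ CARD('n)) * emeasure area_measure E \<and>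
     emeasure area_measure E \<le> ennreal (l ^ CARD('n)) * hausdorff_outer (CARD('n) - 1) (\<phi> ` E)"
proof -
  let ?A = "\<phi>' z0"
  let ?k = "CARD('n) - 1"
  have linA: "linear ?A" by (rule linear_der[OF z0])
  have injA: "inj_on ?A base_space" by (rule inj_der[OF z0])
  obtain m where m: "m > 0" "\<And>h. h \<in> base_space \<Longrightarrow> m * norm h \<le> norm (?A h)"
    using linear_injective_on_base_bound[OF linA injA] by blast
  \<comment> \<open>Makes the error at most \<open>(l - 1) / l\<close> times the length of the
    linear image: the lower factor is then exactly \<open>1 / l\<close>, and the upper factor
    \<open>1 + (l - 1) / l\<close> is at most \<open>l\<close>.\<close>
  define e where "e = m * (l - 1) / l"
  have e: "e > 0" using m l by (simp add: e_def)
  obtain r1 where r1: "r1 > 0"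
    "\<And>z w. z \<in> U \<inter> ball z0 r1 \<Longrightarrow> w \<in> U \<inter> ball z0 r1 \<Longrightarrow> norm (\<phi> z - \<phi> w - ?A (z - w)) \<le> e * norm (z - w)"
    using strict_derivative[OF z0 e] by blast
  let ?J0 = "jac z0"
  have J0: "?J0 > 0" by (rule jac_pos[OF z0])
  define c where "c = ?J0 * (l - 1) / l"
  have c: "c > 0" using J0 l by (simp add: c_def)
  have "continuous_on U (\<lambda>z. norm (cross_normal (\<phi>' z)))"
    by (intro continuous_on_norm continuous_cross)
  then obtain r2 where r2: "r2 > 0"
    "\<And>z. z \<in> U \<Longrightarrow> dist z z0 < r2 \<Longrightarrow> dist (norm (cross_normal (\<phi>' z))) (norm (cross_normal (\<phi>' z0))) < c"
    using z0 c unfolding continuous_on_iff by blast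
  have l2: "1 + (l - 1) / l \<le> l"
  proof -
    have "0 \<le> (l - 1)\<^sup>2 / l" using l by simp
    also have "\<dots> = l - (1 + (l - 1) / l)" using l by (simp add: field_simps power2_eq_square)
    finally show ?thesis by simp
  qed
  define r where "r = min r1 r2"
  show ?thesis
  proof (intro exI conjI ballI impI)
    show "r > 0" using r1 r2 by (simp add: r_def)
    fix E :: "(real^'n::_) set" assume E: "E \<in> sets borel" and sub: "E \<subseteq> U \<inter> ball z0 r"
    have Eb: "E \<subseteq> base_space" using sub U_base by blast
    have bdd: "bounded E" using sub bounded_subset[OF bounded_ball] by blast
    have two: "norm (\<phi> z - \<phi> w) \<le> l * norm (?A z - ?A w)" "norm (?A z - ?A w) \<le> l * norm (\<phi> z - \<phi> w)"
      if zw: "z \<in> E" "w \<in> E" for z w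
    proof -
      have d: "?A z - ?A w = ?A (z - w)" by (simp add: linear_diff[OF linA])
      have "z - w \<in> base_space"
        using zw Eb subspace_diff[OF subspace_base_space] by blast
      then have "m * norm (z - w) \<le> norm (?A (z - w))" by (rule m(2))
      then have "(l - 1) / l * (m * norm (z - w)) \<le> (l - 1) / l * norm (?A (z - w))"
        using l by (intro mult_left_mono) auto
      moreover have "norm (\<phi> z - \<phi> w - ?A (z - w)) \<le> e * norm (z - w)"
        using zw sub by (intro r1(2)) (auto simp: r_def)
      moreover have "e * norm (z - w) = (l - 1) / l * (m * norm (z - w))"
        by (simp add: e_def)
      ultimately have n: "norm (\<phi> z - \<phi> w - ?A (z - w)) \<le> (l - 1) / l * norm (?A (z - w))"
        by linarith
      have "norm (\<phi> z - \<phi> w) \<le> (1 + (l - 1) / l) * norm (?A (z - w))"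
        using n norm_triangle_sub[of "\<phi> z - \<phi> w" "?A (z - w)"] unfolding distrib_right mult_1 by linarith
      also have "\<dots> \<le> l * norm (?A (z - w))"
        using l2 by (intro mult_right_mono) auto
      finally show "norm (\<phi> z - \<phi> w) \<le> l * norm (?A z - ?A w)" by (simp only: d)
      have "norm (?A (z - w)) - (l - 1) / l * norm (?A (z - w)) \<le> norm (\<phi> z - \<phi> w)"
        using n norm_triangle_sub[of "?A (z - w)" "\<phi> z - \<phi> w"] norm_minus_commute[of "?A (z - w)" "\<phi> z - \<phi> w"]
        by linarith
      then have "l * (norm (?A (z - w)) - (l - 1) / l * norm (?A (z - w))) \<le> l * norm (\<phi> z - \<phi> w)"
        using l by (intro mult_left_mono) auto
      then show "norm (?A z - ?A w) \<le> l * norm (\<phi> z - \<phi> w)"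
        using l unfolding d by (simp add: field_simps)
    qed
    have JJ: "jac z \<le> l * ?J0" "?J0 \<le> l * jac z" if z: "z \<in> E" for z
    proof -
      have zU: "z \<in> U" using z sub by blast
      have "dist (norm (cross_normal (\<phi>' z))) (norm (cross_normal (\<phi>' z0))) < c"
        using z sub by (intro r2) (auto simp: r_def dist_commute)
      then have d: "\<bar>jac z - ?J0\<bar> < ?J0 * ((l - 1) / l)"
        using zU z0 by (simp add: jac_def dist_real_def c_def)
      then have "jac z \<le> ?J0 * (1 + (l - 1) / l)"
        unfolding distrib_left mult_1_right by linarith
      also have "\<dots> \<le> ?J0 * l" using l2 J0 by (intro mult_left_mono) auto
      finally show "jac z \<le> l * ?J0" by (simp add: mult.commute)
      have "?J0 - ?J0 * ((l - 1) / l) \<le> jac z" using d by linarith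
      then have "l * (?J0 - ?J0 * ((l - 1) / l)) \<le> l * jac z"
        using l by (intro mult_left_mono) auto
      then show "?J0 \<le> l * jac z" using l by (simp add: field_simps)
    qed
    have HA: "hausdorff_outer ?k (?A ` E) = ennreal ?J0 * emeasure (hyper last_index) E"
      using hausdorff_linear_image[OF linA injA E bdd Eb] z0 by (simp add: jac_def)
    have lk: "ennreal (l ^ ?k) * ennreal l = ennreal (l ^ CARD('n))"
    proof -
      have "CARD('n) = Suc ?k" by simp
      then have "l ^ CARD('n) = l ^ ?k * l" by (metis power_Suc2)
      then show ?thesis using l by (simp add: ennreal_mult)
    qed
    have up: "emeasure area_measure E \<le> ennreal l * (ennreal ?J0 * emeasure (hyper last_index) E)"
    proof -
      have "emeasure area_measure E \<le> (\<integral>\<^sup>+z. ennreal (l * ?J0) * indicator E z \<partial>hyper last_index)"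
        unfolding emeasure_area_measure[OF E]
        by (intro nn_integral_mono) (auto simp: indicator_def intro!: ennreal_leI JJ)
      also have "\<dots> = ennreal (l * ?J0) * emeasure (hyper last_index) E"
        using E by (subst nn_integral_cmult_indicator) auto
      finally show ?thesis using l by (simp add: ennreal_mult mult.assoc)
    qed
    have low: "ennreal ?J0 * emeasure (hyper last_index) E \<le> ennreal l * emeasure area_measure E"
    proof -
      have "ennreal ?J0 * emeasure (hyper last_index) E = (\<integral>\<^sup>+z. ennreal ?J0 * indicator E z \<partial>hyper last_index)"
        using E by (subst nn_integral_cmult_indicator) auto
      also have "\<dots> \<le> (\<integral>\<^sup>+z. ennreal l * (ennreal (jac z) * indicator E z) \<partial>hyper last_index)"
        using l by (intro nn_integral_mono) (auto simp: indicator_def ennreal_mult[symmetric] intro!: ennreal_leI JJ)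
      also have "\<dots> = ennreal l * emeasure area_measure E"
        unfolding emeasure_area_measure[OF E]
        by (rule nn_integral_cmult) (use E in \<open>auto intro!: borel_measurable_times_ennreal borel_measurable_indicator\<close>)
      finally show ?thesis .
    qed
    have "hausdorff_outer ?k (\<phi> ` E) \<le> ennreal (l ^ ?k) * hausdorff_outer ?k (?A ` E)"
      using l two(1) by (intro hausdorff_outer_compare_images) auto
    also have "\<dots> \<le> ennreal (l ^ ?k) * (ennreal l * emeasure area_measure E)"
      unfolding HA by (intro mult_left_mono low) auto
    finally show "hausdorff_outer ?k (\<phi> ` E) \<le> ennreal (l ^ CARD('n)) * emeasure area_measure E"
      by (simp only: lk mult.assoc[symmetric])
    have "emeasure area_measure E \<le> ennreal l * hausdorff_outer ?k (?A ` E)"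
      unfolding HA by (rule up)
    also have "\<dots> \<le> ennreal l * (ennreal (l ^ ?k) * hausdorff_outer ?k (\<phi> ` E))"
      using l two(2) by (intro mult_left_mono hausdorff_outer_compare_images) auto
    also have "\<dots> = ennreal (l ^ CARD('n)) * hausdorff_outer ?k (\<phi> ` E)"
      by (simp only: lk mult.assoc[symmetric] mult.commute[of "ennreal l"])
    finally show "emeasure area_measure E \<le> ennreal (l ^ CARD('n)) * hausdorff_outer ?k (\<phi> ` E)" .
  qed
qed

text \<open>The image is a preimage under the inverse chart, extended by 0 to a Borel map.\<close>

lemma borel_image:
  assumes E: "E \<in> sets borel" "E \<subseteq> U"
  shows "\<phi> ` E \<in> sets borel"
proof -
  define \<psi>0 where "\<psi>0 y = indicator (\<phi> ` U) y *\<^sub>R \<psi> y" for y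
  have [measurable]: "\<psi>0 \<in> borel_measurable borel"
    unfolding \<psi>0_def using hom image_borel
    by (intro borel_measurable_continuous_on_indicator) (auto simp: homeomorphism_def)
  note image_borel[measurable] E(1)[measurable]
  have inv: "\<psi> (\<phi> z) = z" if "z \<in> U" for z
    using hom that by (rule homeomorphism_apply1)
  have "\<phi> ` E = {y \<in> \<phi> ` U. \<psi>0 y \<in> E}"
    using E(2) inv by (auto simp: \<psi>0_def)
  then show ?thesis by simp
qed

end

section \<open>From the local estimates to the area formula\<close>

lemma surface_measure_eq_hausdorff:
  fixes A :: "(real^'n) set"
  assumes "A \<in> sets borel"
  shows "emeasure surface_measure A = hausdorff_outer (CARD('n) - 1) A"
  using assms unfolding surface_measure_def by (rule emeasure_hausdorff_measure)

lemma sets_surface_measure [simp, measurable_cong]: "sets surface_measure = sets borel"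
  by (simp add: surface_measure_def)

lemma space_surface_measure [simp]: "space surface_measure = UNIV"
  by (simp add: surface_measure_def)

lemma ennreal_le_of_le_powers:
  assumes "\<And>l::real. l > 1 \<Longrightarrow> x \<le> ennreal (l ^ n) * y"
  shows "x \<le> y"
proof (cases y)
  case (real b)
  have "((\<lambda>l. ennreal (l ^ n * b)) \<longlongrightarrow> ennreal (1 ^ n * b)) (at_right (1::real))"
    by (intro tendsto_intros)
  moreover have "\<forall>\<^sub>F l in at_right (1::real). x \<le> ennreal (l ^ n * b)"
    using eventually_at_right_less
  proof (rule eventually_mono)
    fix l :: real assume "1 < l"
    then show "x \<le> ennreal (l ^ n * b)"
      using assms[of l] real by (simp add: ennreal_mult)
  qed
  ultimately show ?thesis
    using real by (intro tendsto_lowerbound) auto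
qed simp

context c1_chart
begin

text \<open>Countably many of the small balls cover \<open>U\<close> by Lindelof. On the resulting
  disjoint pieces of \<open>E\<close> the local estimates hold with one and the same
  \<open>l\<close>, and both sides are countably additive because \<open>\<phi>\<close> is
  injective.\<close>

lemma area_estimates:
  assumes l: "l > 1" and E: "E \<in> sets borel" "E \<subseteq> U"
  shows "hausdorff_outer (CARD('n) - 1) (\<phi> ` E) \<le> ennreal (l ^ CARD('n)) * emeasure area_measure E \<and>
     emeasure area_measure E \<le> ennreal (l ^ CARD('n)) * hausdorff_outer (CARD('n) - 1) (\<phi> ` E)"
proof (cases "U = {}")
  case True
  then show ?thesis using E by auto
next
  case False
  let ?k = "CARD('n) - 1" and ?c = "ennreal (l ^ CARD('n))"
  define P where "P E \<longleftrightarrow> hausdorff_outer ?k (\<phi> ` E) \<le> ?c * emeasure area_measure E \<and>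
     emeasure area_measure E \<le> ?c * hausdorff_outer ?k (\<phi> ` E)" for E
  have "\<forall>z\<in>U. \<exists>r>0. \<forall>E\<in>sets borel. E \<subseteq> U \<inter> ball z r \<longrightarrow> P E"
    unfolding P_def using local_area[OF _ l] by blast
  then obtain r where r: "\<And>z. z \<in> U \<Longrightarrow> r z > 0"
     "\<And>z E. z \<in> U \<Longrightarrow> E \<in> sets borel \<Longrightarrow> E \<subseteq> U \<inter> ball z (r z) \<Longrightarrow> P E"
    by metis
  let ?F = "(\<lambda>z. ball z (r z)) ` U"
  obtain F where F: "F \<subseteq> ?F" "countable F" "\<Union>F = \<Union>?F"
    using Lindelof[of ?F] by (metis (no_types, lifting) imageE open_ball)
  have cov: "U \<subseteq> \<Union>F"
    unfolding F(3) using r(1) by force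
  then have Fne: "F \<noteq> {}" using False by auto
  define B where "B = from_nat_into F"
  have B: "B n \<in> F" for n unfolding B_def by (rule from_nat_into[OF Fne])
  have UB: "(\<Union>n. B n) = \<Union>F"
    using range_from_nat_into[OF Fne F(2)] unfolding B_def by auto
  define C where "C n = E \<inter> disjointed B n" for n
  have "open (B n)" for n
    using B[of n] F(1) by auto
  then have Bopen: "B n \<in> sets borel" for n by simp
  then have dB: "disjointed B n \<in> sets borel" for n
    by (simp add: disjointed_def)
  have C: "C n \<in> sets borel" "C n \<subseteq> U" for n
    using dB E by (auto simp: C_def)
  have PC: "P (C n)" for n
  proof -
    obtain z where z: "z \<in> U" "B n = ball z (r z)" using B[of n] F(1) by blast
    have "C n \<subseteq> U \<inter> ball z (r z)"
      using E(2) disjointed_subset[of B n] z(2) by (auto simp: C_def)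
    then show ?thesis using r(2)[OF z(1) C(1)] by blast
  qed
  have EC: "E = (\<Union>n. C n)"
    using E(2) cov UB by (auto simp: C_def UN_disjointed_eq Int_UN_distrib[symmetric] simp del: Int_UN_distrib)
  have disjC: "disjoint_family C"
    using disjoint_family_disjointed[of B] by (auto simp: C_def disjoint_family_on_def)
  have disjI: "disjoint_family (\<lambda>n. \<phi> ` C n)"
    unfolding disjoint_family_on_def
  proof (intro ballI impI)
    fix m n :: nat assume "m \<noteq> n"
    then have "C m \<inter> C n = {}" using disjC by (auto simp: disjoint_family_on_def)
    then show "\<phi> ` C m \<inter> \<phi> ` C n = {}"
      using inj_on_image_Int[OF inj_phi C(2) C(2), of m n] by simp
  qed
  have CI: "\<phi> ` C n \<in> sets borel" for n by (rule borel_image[OF C])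
  have "emeasure surface_measure (\<Union>n. \<phi> ` C n) = (\<Sum>n. emeasure surface_measure (\<phi> ` C n))"
    using CI disjI by (intro suminf_emeasure[symmetric]) auto
  moreover have "(\<Union>n. \<phi> ` C n) = \<phi> ` E"
    using arg_cong[OF EC, of "(`) \<phi>"] by (simp only: image_UN)
  ultimately have H: "hausdorff_outer ?k (\<phi> ` E) = (\<Sum>n. hausdorff_outer ?k (\<phi> ` C n))"
    using borel_image[OF E] CI by (simp add: surface_measure_eq_hausdorff)
  have M: "emeasure area_measure E = (\<Sum>n. emeasure area_measure (C n))"
  proof -
    have "(\<Sum>n. emeasure area_measure (C n)) = emeasure area_measure (\<Union>n. C n)"
      using C disjC by (intro suminf_emeasure) auto
    then show ?thesis by (simp only: EC[symmetric])
  qed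
  have "(\<Sum>n. hausdorff_outer ?k (\<phi> ` C n)) \<le> (\<Sum>n. ?c * emeasure area_measure (C n))"
    by (rule suminf_le[OF PC[unfolded P_def, THEN conjunct1]]) (rule summableI)+
  moreover have "(\<Sum>n. emeasure area_measure (C n)) \<le> (\<Sum>n. ?c * hausdorff_outer ?k (\<phi> ` C n))"
    by (rule suminf_le[OF PC[unfolded P_def, THEN conjunct2]]) (rule summableI)+
  ultimately show ?thesis
    unfolding H M ennreal_suminf_cmult by (rule conjI)
qed

theorem area_formula:
  assumes "E \<in> sets borel" "E \<subseteq> U"
  shows "hausdorff_outer (CARD('n) - 1) (\<phi> ` E) = emeasure area_measure E"
proof (rule antisym)
  show "hausdorff_outer (CARD('n) - 1) (\<phi> ` E) \<le> emeasure area_measure E"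
    using area_estimates[OF _ assms, THEN conjunct1] by (rule ennreal_le_of_le_powers)
  show "emeasure area_measure E \<le> hausdorff_outer (CARD('n) - 1) (\<phi> ` E)"
    using area_estimates[OF _ assms, THEN conjunct2] by (rule ennreal_le_of_le_powers)
qed

lemma nn_integral_chart:
  assumes h [measurable]: "h \<in> borel_measurable borel"
  shows "(\<integral>\<^sup>+x. indicator (\<phi> ` U) x * h x \<partial>surface_measure) = (\<integral>\<^sup>+z. ennreal (jac z) * h (phi0 z) \<partial>hyper last_index)"
proof -
  note image_borel[measurable]
  have "density surface_measure (indicator (\<phi> ` U)) = distr area_measure borel phi0"
  proof (rule measure_eqI)
    fix A assume "A \<in> sets (density surface_measure (indicator (\<phi> ` U)))"
    then have A [measurable]: "A \<in> sets borel" by simp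
    let ?E = "{z \<in> U. phi0 z \<in> A}"
    have E: "?E \<in> sets borel" by measurable
    have "emeasure (distr area_measure borel phi0) A = emeasure area_measure {z. phi0 z \<in> A}"
      by (subst emeasure_distr) (auto simp: vimage_def area_measure_def)
    also have "\<dots> = emeasure area_measure ?E"
    proof -
      have "{z. phi0 z \<in> A} \<in> sets borel" by measurable
      then show ?thesis
        using E by (simp add: emeasure_area_measure) (auto intro!: nn_integral_cong simp: indicator_def jac_def)
    qed
    also have "\<dots> = hausdorff_outer (CARD('n) - 1) (\<phi> ` ?E)"
      using E by (intro area_formula[symmetric]) auto
    also have "\<phi> ` ?E = \<phi> ` U \<inter> A"
      by (auto simp: phi0_eq)
    also have "hausdorff_outer (CARD('n) - 1) \<dots> = emeasure surface_measure (\<phi> ` U \<inter> A)"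
      by (subst surface_measure_eq_hausdorff) auto
    also have "\<dots> = emeasure (density surface_measure (indicator (\<phi> ` U))) A"
    proof -
      have "emeasure (density surface_measure (indicator (\<phi> ` U))) A
         = (\<integral>\<^sup>+x. indicator (\<phi> ` U) x * indicator A x \<partial>surface_measure)"
        by (rule emeasure_density) measurable
      also have "\<dots> = (\<integral>\<^sup>+x. indicator (\<phi> ` U \<inter> A) x \<partial>surface_measure)"
        by (intro nn_integral_cong) (auto simp: indicator_def)
      also have "\<dots> = emeasure surface_measure (\<phi> ` U \<inter> A)"
        by (rule nn_integral_indicator) measurable
      finally show ?thesis ..
    qed
    finally show "emeasure (density surface_measure (indicator (\<phi> ` U))) A = emeasure (distr area_measure borel phi0) A" ..
  qed simp
  then have "(\<integral>\<^sup>+x. h x \<partial>density surface_measure (indicator (\<phi> ` U))) = (\<integral>\<^sup>+x. h x \<partial>distr area_measure borel phi0)"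
    by simp
  also have "\<dots> = (\<integral>\<^sup>+z. h (phi0 z) \<partial>area_measure)"
    by (subst nn_integral_distr) (auto simp: area_measure_def)
  also have "\<dots> = (\<integral>\<^sup>+z. ennreal (jac z) * h (phi0 z) \<partial>hyper last_index)"
    unfolding area_measure_def by (subst nn_integral_density) auto
  also have "(\<integral>\<^sup>+x. h x \<partial>density surface_measure (indicator (\<phi> ` U))) = (\<integral>\<^sup>+x. indicator (\<phi> ` U) x * h x \<partial>surface_measure)"
    by (subst nn_integral_density) auto
  finally show ?thesis .
qed

end


section \<open>The unit sphere\<close>

lemma last_index_ge: "i \<le> (last_index :: 'n::{finite,wellorder})"
  unfolding last_index_def by (rule Max_ge) auto

abbreviation (input) last_axis :: "real^'n::{finite,wellorder}" where
  "last_axis \<equiv> axis last_index 1"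

section \<open>The open hemisphere as a graph over the unit disc\<close>

definition hemi_height :: "real^'n::{finite,wellorder} \<Rightarrow> real" where
  "hemi_height z = sqrt (1 - (norm z)\<^sup>2)"

definition hemi_base :: "(real^'n::{finite,wellorder}) set" where
  "hemi_base = base_space \<inter> ball 0 1"

definition hemi :: "real^'n::{finite,wellorder} \<Rightarrow> real^'n::_" where
  "hemi z = z + hemi_height z *\<^sub>R last_axis"

definition hemi_der :: "real^'n::{finite,wellorder} \<Rightarrow> real^'n::_ \<Rightarrow> real^'n::_" where
  "hemi_der z h = h - ((z \<bullet> h) / hemi_height z) *\<^sub>R last_axis"

lemma hemi_height_pos: "z \<in> hemi_base \<Longrightarrow> hemi_height z > 0"
  by (simp add: hemi_base_def hemi_height_def power_less_one_iff abs_square_less_1)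

lemma norm_add_last_axis:
  assumes "z \<in> base_space"
  shows "(norm (z + t *\<^sub>R last_axis))\<^sup>2 = (norm z)\<^sup>2 + t\<^sup>2"
  using norm_drop_coord_sq[of "z + t *\<^sub>R last_axis" last_index] assms
  by (simp add: drop_coord_add_axis drop_coord_base) (simp add: mem_base_space)

lemma norm_hemi:
  assumes "z \<in> hemi_base"
  shows "norm (hemi z) = 1"
proof -
  have "(norm z)\<^sup>2 < 1"
    using assms by (simp add: hemi_base_def power_less_one_iff abs_square_less_1)
  then have "(norm (hemi z))\<^sup>2 = 1\<^sup>2"
    using assms unfolding hemi_def by (subst norm_add_last_axis) (auto simp: hemi_base_def hemi_height_def)
  then show ?thesis by (simp only: power2_eq_iff_nonneg norm_ge_zero zero_le_one)
qed

lemma hemi_nth_last: "z \<in> base_space \<Longrightarrow> hemi z $ last_index = hemi_height z"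
  by (simp add: hemi_def mem_base_space)

lemma hemi_image: "hemi ` hemi_base = half_sphere (last_axis :: real^'n::{finite,wellorder})"
proof (intro equalityI subsetI)
  fix x :: "real^'n::_" assume "x \<in> hemi ` hemi_base"
  then obtain z where z: "z \<in> hemi_base" "x = hemi z" by blast
  then show "x \<in> half_sphere last_axis"
    using norm_hemi[OF z(1)] hemi_height_pos[OF z(1)] hemi_nth_last[of z]
    by (simp add: half_sphere_def inner_axis' hemi_base_def)
next
  fix x :: "real^'n::_" assume "x \<in> half_sphere last_axis"
  then have x: "norm x = 1" "x $ last_index > 0"
    by (auto simp: half_sphere_def inner_axis')
  let ?z = "drop_coord last_index x"
  have sq: "(norm ?z)\<^sup>2 = 1 - (x $ last_index)\<^sup>2"
    using norm_drop_coord_sq[of x last_index] x by simp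
  moreover have "(x $ last_index)\<^sup>2 > 0" using x by simp
  ultimately have "(norm ?z)\<^sup>2 < 1\<^sup>2" by simp
  then have "norm ?z < 1" by (rule power2_less_imp_less) simp
  then have "?z \<in> hemi_base" by (simp add: hemi_base_def)
  moreover have "hemi ?z = x"
    using x drop_coord_decomp[of last_index x] by (simp add: hemi_def hemi_height_def sq)
  ultimately show "x \<in> hemi ` hemi_base" by (metis imageI)
qed

lemma half_sphere_borel [measurable]: "half_sphere v \<in> sets borel"
proof -
  have eq: "half_sphere v = sphere 0 1 \<inter> {w. v \<bullet> w > 0}"
    by (auto simp: half_sphere_def)
  have "open {w. v \<bullet> w > 0}"
    by (intro open_Collect_less continuous_intros)
  then show ?thesis
    unfolding eq by (intro sets.Int borel_open borel_closed) auto
qed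

lemma hemi_chart:
  "c1_chart hemi_base hemi hemi_der (drop_coord (last_index :: 'n::{finite,wellorder}))"
proof
  show "openin (top_of_set base_space) (hemi_base :: (real^'n::_) set)"
    unfolding hemi_base_def by (auto simp: openin_open)
  have cont: "continuous_on hemi_base hemi"
    unfolding hemi_def hemi_height_def by (intro continuous_intros)
  show "homeomorphism (hemi_base :: (real^'n::_) set) (hemi ` hemi_base) hemi (drop_coord last_index)"
  proof (rule homeomorphismI[OF cont])
    show "continuous_on (hemi ` hemi_base) (drop_coord (last_index :: 'n))"
      by (intro continuous_intros)
    have inv: "drop_coord last_index (hemi z) = z" if "z \<in> hemi_base" for z :: "real^'n::_"
      using that by (simp add: hemi_def drop_coord_add_axis drop_coord_base hemi_base_def)
    then show "drop_coord last_index ` hemi ` hemi_base \<subseteq> (hemi_base :: (real^'n::_) set)" by auto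
    show "\<And>x :: real^'n::_. x \<in> hemi_base \<Longrightarrow> drop_coord last_index (hemi x) = x" by (rule inv)
    show "hemi (drop_coord last_index y) = y" if y: "y \<in> hemi ` hemi_base" for y :: "real^'n::_"
    proof -
      obtain z where "z \<in> hemi_base" "y = hemi z" using y by blast
      then show ?thesis using inv by simp
    qed
  qed simp
  show "hemi ` hemi_base \<in> sets (borel :: (real^'n::_) measure)"
    by (simp only: hemi_image half_sphere_borel)
  fix z :: "real^'n::_" assume z: "z \<in> hemi_base"
  have pos: "1 - (norm z)\<^sup>2 > 0"
    using hemi_height_pos[OF z] by (simp add: hemi_height_def)
  have fn: "hemi_height = (\<lambda>z :: real^'n::_. sqrt (1 - z \<bullet> z))"
    by (simp add: fun_eq_iff hemi_height_def power2_norm_eq_inner)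
  have "(hemi_height has_derivative (\<lambda>h. (0 - (z \<bullet> h + h \<bullet> z)) * (inverse (sqrt (1 - z \<bullet> z)) / 2))) (at z within hemi_base)"
    unfolding fn
  proof (rule has_derivative_real_sqrt)
    show "1 - z \<bullet> z > 0" using pos by (simp add: power2_norm_eq_inner)
    show "((\<lambda>z. 1 - z \<bullet> z) has_derivative (\<lambda>h. 0 - (z \<bullet> h + h \<bullet> z))) (at z within hemi_base)"
      by (intro has_derivative_diff has_derivative_const has_derivative_inner has_derivative_ident)
  qed
  moreover have "(\<lambda>h. (0 - (z \<bullet> h + h \<bullet> z)) * (inverse (sqrt (1 - z \<bullet> z)) / 2)) = (\<lambda>h. - (z \<bullet> h) / hemi_height z)"
  proof
    fix h
    have alg: "(0 - (a + a)) * (inverse s / 2) = - a / s" for a s :: real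
      by (cases "s = 0") (simp_all add: field_simps)
    show "(0 - (z \<bullet> h + h \<bullet> z)) * (inverse (sqrt (1 - z \<bullet> z)) / 2) = - (z \<bullet> h) / hemi_height z"
      unfolding fn inner_commute[of h z] by (rule alg)
  qed
  ultimately have 1: "(hemi_height has_derivative (\<lambda>h. - (z \<bullet> h) / hemi_height z)) (at z within hemi_base)"
    by (rule has_derivative_eq_rhs)
  have "(hemi has_derivative (\<lambda>h. h + (- (z \<bullet> h) / hemi_height z) *\<^sub>R last_axis)) (at z within hemi_base)"
    unfolding hemi_def[abs_def] by (intro has_derivative_add has_derivative_ident has_derivative_scaleR_left 1)
  then show "(hemi has_derivative hemi_der z) (at z within hemi_base)"
    by (simp add: hemi_der_def[abs_def])
  show "inj_on (hemi_der z) base_space"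
  proof (rule inj_on_inverseI)
    fix x :: "real^'n::_" assume x: "x \<in> base_space"
    have "hemi_der z x = x + (- ((z \<bullet> x) / hemi_height z)) *\<^sub>R last_axis"
      by (simp add: hemi_der_def)
    then show "drop_coord last_index (hemi_der z x) = x"
      by (simp only: drop_coord_add_axis drop_coord_base[OF x])
  qed
next
  fix h :: "real^'n::_" assume "h \<in> base_space"
  show "continuous_on hemi_base (\<lambda>z. hemi_der z h)"
    unfolding hemi_der_def
  proof (intro continuous_intros)
    show "continuous_on hemi_base (hemi_height :: real^'n::_ \<Rightarrow> real)"
      unfolding hemi_height_def[abs_def] by (intro continuous_intros)
    show "\<forall>x\<in>hemi_base. hemi_height (x :: real^'n::_) \<noteq> 0"
      using hemi_height_pos by (metis less_irrefl)
  qed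
qed

lemma linear_hemi_der: "linear (hemi_der z)"
  by (auto intro!: linearI simp: hemi_der_def algebra_simps add_divide_distrib)

text \<open>Off the last column the matrix is the identity. As \<open>last_index\<close> is the
  greatest index, the matrix is upper triangular with unit diagonal.\<close>

lemma side_det_hemi_der:
  fixes z :: "real^'n::{finite,wellorder}"
  shows "side_det (hemi_der z) last_axis = 1"
proof -
  let ?A = "\<chi> i. if i = last_index then last_axis else hemi_der z (axis i 1)"
  have nth: "?A $ i $ l = (if i = l then 1 else 0)" if "l \<noteq> last_index" for i l
    using that by (auto simp: hemi_der_def axis_def)
  have "det ?A = (\<Prod>i\<in>UNIV. ?A $ i $ i)"
  proof (rule det_upperdiagonal)
    fix i l :: 'n assume "i > l"
    then have "l \<noteq> last_index" using last_index_ge[of i] by auto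
    then show "?A $ i $ l = 0" using nth[of l i] \<open>i > l\<close> by simp
  qed
  also have "\<dots> = 1"
  proof (intro prod.neutral ballI)
    fix i :: 'n
    show "?A $ i $ i = 1"
      using nth[of i i] by (cases "i = last_index") auto
  qed
  finally show ?thesis
    by (simp add: side_det_rows[OF linear_hemi_der])
qed

text \<open>The point \<open>hemi z\<close> is its own unit normal and has cosine
  \<open>hemi_height z\<close> with the last axis; base times height is 1 by the determinant just
  computed.\<close>

lemma jac_hemi:
  fixes z :: "real^'n::{finite,wellorder}"
  assumes z: "z \<in> hemi_base"
  shows "c1_chart.jac hemi_base hemi_der z = 1 / hemi_height z"
proof -
  interpret c1_chart "hemi_base :: (real^'n::_) set" hemi hemi_der "drop_coord last_index"
    by (rule hemi_chart)
  have zb: "z $ last_index = 0" using z by (simp add: hemi_base_def mem_base_space)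
  have "hemi z \<bullet> hemi_der z h = 0" if "h \<in> base_space" for h
    using that zb hemi_height_pos[OF z]
    by (simp add: hemi_def hemi_der_def mem_base_space inner_add_left inner_diff_right inner_axis inner_axis')
  then have "\<bar>side_det (hemi_der z) last_axis\<bar> = norm (cross_normal (hemi_der z)) * \<bar>last_axis \<bullet> hemi z\<bar>"
    by (intro abs_side_det_eq linear_hemi_der inj_der[OF z] norm_hemi[OF z])
  moreover have "last_axis \<bullet> hemi z = hemi_height z"
    using hemi_nth_last[of z] z by (simp add: inner_axis' hemi_base_def)
  ultimately show ?thesis
    using z hemi_height_pos[OF z] by (simp add: jac_def side_det_hemi_der field_simps)
qed

lemma nn_integral_half_sphere_last:
  assumes [measurable]: "f \<in> borel_measurable borel"
  shows "(\<integral>\<^sup>+x. indicator (half_sphere last_axis) x * f (x \<bullet> (last_axis :: real^'n::{finite,wellorder})) \<partial>surface_measure) =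
    (\<integral>\<^sup>+z. indicator hemi_base z * (ennreal (1 / hemi_height z) * f (hemi_height z)) \<partial>hyper (last_index :: 'n))"
proof -
  interpret c1_chart "hemi_base :: (real^'n::_) set" hemi hemi_der "drop_coord last_index"
    by (rule hemi_chart)
  have "(\<integral>\<^sup>+x. indicator (half_sphere last_axis) x * f (x \<bullet> (last_axis :: real^'n::_)) \<partial>surface_measure)
     = (\<integral>\<^sup>+z. ennreal (jac z) * f (phi0 z \<bullet> last_axis) \<partial>hyper (last_index :: 'n))"
    unfolding hemi_image[symmetric] by (rule nn_integral_chart[where h="\<lambda>x. f (x \<bullet> last_axis)"]) measurable
  also have "\<dots> = (\<integral>\<^sup>+z. indicator hemi_base z * (ennreal (1 / hemi_height z) * f (hemi_height z)) \<partial>hyper (last_index :: 'n))"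
  proof (rule nn_integral_cong)
    fix z :: "real^'n::_"
    show "ennreal (jac z) * f (phi0 z \<bullet> last_axis) = indicator hemi_base z * (ennreal (1 / hemi_height z) * f (hemi_height z))"
    proof (cases "z \<in> hemi_base")
      case True
      then have "phi0 z \<bullet> last_axis = hemi_height z"
        using hemi_nth_last[of z] unfolding phi0_eq[OF True] by (simp add: inner_axis hemi_base_def)
      then show ?thesis using True by (simp add: jac_hemi[OF True])
    next
      case False
      then show ?thesis by (simp add: jac_def)
    qed
  qed
  finally show ?thesis .
qed

section \<open>Rotation invariance and cosine integrals over the sphere\<close>

lemma surface_measure_orthogonal:
  fixes T :: "real^'n \<Rightarrow> real^'n"
  assumes T: "orthogonal_transformation T" and f: "f \<in> borel_measurable borel"
  shows "(\<integral>\<^sup>+x. f (T x) \<partial>surface_measure) = (\<integral>\<^sup>+x. f x \<partial>surface_measure)"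
proof -
  have Tm [measurable]: "T \<in> borel_measurable borel"
    using orthogonal_transformation_linear[OF T]
    by (intro borel_measurable_continuous_onI linear_continuous_on) (simp add: linear_linear)
  have "distr surface_measure borel T = surface_measure"
  proof (rule measure_eqI)
    fix A assume "A \<in> sets (distr surface_measure borel T)"
    then have A [measurable]: "A \<in> sets borel" by simp
    have TA: "T -` A \<in> sets borel"
      using measurable_sets[OF Tm A] by simp
    have "emeasure (distr surface_measure borel T) A = emeasure surface_measure (T -` A)"
      by (subst emeasure_distr) auto
    also have "\<dots> = hausdorff_outer (CARD('n) - 1) (T ` (T -` A))"
      unfolding surface_measure_eq_hausdorff[OF TA] hausdorff_outer_orthogonal[OF T] ..
    also have "T ` (T -` A) = A"
      using orthogonal_transformation_surj[OF T] by (simp add: surj_image_vimage_eq)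
    finally show "emeasure (distr surface_measure borel T) A = emeasure surface_measure A"
      by (simp add: surface_measure_eq_hausdorff[OF A])
  qed simp
  then have "(\<integral>\<^sup>+x. f x \<partial>surface_measure) = (\<integral>\<^sup>+x. f x \<partial>distr surface_measure borel T)" by simp
  also have "\<dots> = (\<integral>\<^sup>+x. f (T x) \<partial>surface_measure)"
    using f by (subst nn_integral_distr) auto
  finally show ?thesis ..
qed

lemma nn_integral_half_sphere_rotate:
  fixes v w :: "real^'n"
  assumes [measurable]: "f \<in> borel_measurable borel" and v: "norm v = 1" and w: "norm w = 1"
  shows "(\<integral>\<^sup>+x. indicator (half_sphere v) x * f (x \<bullet> v) \<partial>surface_measure) =
    (\<integral>\<^sup>+x. indicator (half_sphere w) x * f (x \<bullet> w) \<partial>surface_measure)"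
proof -
  have "norm w = norm v" using v w by simp
  then obtain T :: "real^'n \<Rightarrow> real^'n" where T: "orthogonal_transformation T" "T w = v"
    using orthogonal_transformation_exists by blast
  have inn: "T x \<bullet> v = x \<bullet> w" "v \<bullet> T x = w \<bullet> x" for x
    unfolding T(2)[symmetric] using T(1) by (auto simp: orthogonal_transformation_def)
  have half: "indicator (half_sphere v) (T x) = (indicator (half_sphere w) x :: ennreal)" for x
    using orthogonal_transformation_norm[OF T(1)] by (simp add: indicator_def half_sphere_def inn)
  have "(\<lambda>x. indicator (half_sphere v) x * f (x \<bullet> v)) \<in> borel_measurable borel"
    by measurable
  from surface_measure_orthogonal[OF T(1) this] show ?thesis
    by (simp add: half inn)
qed

lemma hyper_unit_ball:
  "emeasure (hyper j) (ball (0 :: real^'n::finite) 1) = ennreal (unit_ball_vol (real (CARD('n) - 1)))"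
proof (rule antisym)
  have "emeasure (hyper j) (ball (0 :: real^'n) 1) \<le> emeasure (hyper j) (cball 0 1)"
    by (intro emeasure_mono) auto
  then show "emeasure (hyper j) (ball (0 :: real^'n) 1) \<le> ennreal (unit_ball_vol (real (CARD('n) - 1)))"
    by (simp add: emeasure_hyper_cball_0)
next
  let ?c = "unit_ball_vol (real (CARD('n) - 1))"
  have "((\<lambda>r. ennreal (?c * r ^ (CARD('n) - 1))) \<longlongrightarrow> ennreal (?c * 1 ^ (CARD('n) - 1))) (at_left (1::real))"
    by (intro tendsto_intros)
  moreover have "\<forall>\<^sub>F r in at_left (1::real). ennreal (?c * r ^ (CARD('n) - 1)) \<le> emeasure (hyper j) (ball (0 :: real^'n) 1)"
  proof -
    have "\<forall>\<^sub>F r in at_left (1::real). r \<in> {0<..<1}"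
      by (rule eventually_at_left_real) simp
    then show ?thesis
    proof (rule eventually_mono)
      fix r :: real assume r: "r \<in> {0<..<1}"
      then have "emeasure (hyper j) (cball (0 :: real^'n) r) \<le> emeasure (hyper j) (ball (0 :: real^'n) 1)"
        by (intro emeasure_mono) auto
      then show "ennreal (?c * r ^ (CARD('n) - 1)) \<le> emeasure (hyper j) (ball (0 :: real^'n) 1)"
        using r by (simp add: emeasure_hyper_cball_0)
    qed
  qed
  ultimately have "ennreal (?c * 1 ^ (CARD('n) - 1)) \<le> emeasure (hyper j) (ball (0 :: real^'n) 1)"
    by (intro tendsto_upperbound) auto
  then show "ennreal ?c \<le> emeasure (hyper j) (ball (0 :: real^'n) 1)" by simp
qed

lemma hemi_base_borel [measurable]: "hemi_base \<in> sets borel"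
  unfolding hemi_base_def by (intro sets.Int base_space_borel) auto

lemma hemi_height_measurable [measurable]: "hemi_height \<in> borel_measurable borel"
  unfolding hemi_height_def[abs_def] by measurable

lemma AE_hyper_hemi:
  "AE z in hyper (last_index :: 'n::{finite,wellorder}). z \<in> hemi_base \<longleftrightarrow> z \<in> ball 0 1"
  using AE_hyper[of "last_index :: 'n"] by (auto elim!: eventually_mono simp: hemi_base_def mem_base_space)

text \<open>The cosine cancels the Jacobian of the hemisphere, leaving the area of its shadow, the
  equatorial disc.\<close>

lemma nn_integral_half_sphere_cos:
  fixes v :: "real^'n::{finite,wellorder}"
  assumes "norm v = 1"
  shows "(\<integral>\<^sup>+x. indicator (half_sphere v) x * ennreal (x \<bullet> v) \<partial>surface_measure) =
    ennreal (unit_ball_vol (real (CARD('n) - 1)))"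
proof -
  have "(\<integral>\<^sup>+x. indicator (half_sphere v) x * ennreal (x \<bullet> v) \<partial>surface_measure) =
    (\<integral>\<^sup>+x. indicator (half_sphere last_axis) x * ennreal (x \<bullet> (last_axis :: real^'n::_)) \<partial>surface_measure)"
    using assms by (intro nn_integral_half_sphere_rotate[where f=ennreal]) auto
  also have "\<dots> = (\<integral>\<^sup>+z. indicator hemi_base z * (ennreal (1 / hemi_height z) * ennreal (hemi_height z)) \<partial>hyper (last_index :: 'n))"
    by (rule nn_integral_half_sphere_last) measurable
  also have "\<dots> = (\<integral>\<^sup>+z. indicator (ball 0 1) z \<partial>hyper (last_index :: 'n))"
  proof (rule nn_integral_cong_AE)
    show "AE z in hyper (last_index :: 'n). indicator hemi_base z * (ennreal (1 / hemi_height z) * ennreal (hemi_height z))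
        = indicator (ball 0 1) z"
      using AE_hyper_hemi
    proof eventually_elim
      case (elim z)
      have "ennreal (1 / hemi_height z) * ennreal (hemi_height z) = 1" if "z \<in> hemi_base"
        using hemi_height_pos[OF that] by (simp flip: ennreal_mult')
      then show ?case using elim by (simp add: indicator_def)
    qed
  qed
  also have "\<dots> = ennreal (unit_ball_vol (real (CARD('n) - 1)))"
    by (subst nn_integral_indicator) (auto simp: hyper_unit_ball)
  finally show ?thesis .
qed

text \<open>One cosine cancels the Jacobian; the other, \<open>hemi_height z\<close>, is half the
  length of the chord of the unit ball over \<open>z\<close>. Twice the integral is therefore the
  volume of the ball.\<close>

lemma nn_integral_half_sphere_cos_sq:
  fixes v :: "real^'n::{finite,wellorder}"
  assumes "norm v = 1"
  shows "2 * (\<integral>\<^sup>+x. indicator (half_sphere v) x * ennreal ((x \<bullet> v)\<^sup>2) \<partial>surface_measure) =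
    ennreal (unit_ball_vol (real CARD('n)))"
proof -
  have "(\<integral>\<^sup>+x. indicator (half_sphere v) x * ennreal ((x \<bullet> v)\<^sup>2) \<partial>surface_measure) =
    (\<integral>\<^sup>+x. indicator (half_sphere last_axis) x * ennreal ((x \<bullet> (last_axis :: real^'n::_))\<^sup>2) \<partial>surface_measure)"
    using assms by (intro nn_integral_half_sphere_rotate[where f="\<lambda>t. ennreal (t\<^sup>2)"]) auto
  also have "\<dots> = (\<integral>\<^sup>+z. indicator hemi_base z * (ennreal (1 / hemi_height z) * ennreal ((hemi_height z)\<^sup>2)) \<partial>hyper (last_index :: 'n))"
    by (rule nn_integral_half_sphere_last[where f="\<lambda>t. ennreal (t\<^sup>2)"]) measurable
  also have "2 * \<dots> = (\<integral>\<^sup>+z. 2 * (indicator hemi_base z * (ennreal (1 / hemi_height z) * ennreal ((hemi_height z)\<^sup>2))) \<partial>hyper (last_index :: 'n))"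
    by (rule nn_integral_cmult[symmetric]) measurable
  also have "\<dots> = (\<integral>\<^sup>+z. \<integral>\<^sup>+t. indicator (ball 0 1) (z + t *\<^sub>R last_axis) \<partial>lborel \<partial>hyper (last_index :: 'n))"
  proof (rule nn_integral_cong_AE)
    show "AE z in hyper (last_index :: 'n). 2 * (indicator hemi_base z * (ennreal (1 / hemi_height z) * ennreal ((hemi_height z)\<^sup>2)))
      = (\<integral>\<^sup>+t. indicator (ball 0 1) (z + t *\<^sub>R last_axis) \<partial>lborel)"
      using AE_hyper[of "last_index :: 'n"]
    proof eventually_elim
      case (elim z)
      then have zb: "z \<in> base_space" by (simp add: mem_base_space)
      have iff: "z + t *\<^sub>R last_axis \<in> ball 0 1 \<longleftrightarrow> z \<in> hemi_base \<and> t \<in> {- hemi_height z<..<hemi_height z}" for t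
      proof -
        have "z + t *\<^sub>R last_axis \<in> ball 0 1 \<longleftrightarrow> (norm z)\<^sup>2 + t\<^sup>2 < 1"
          unfolding norm_add_last_axis[OF zb, of t, symmetric] by (simp add: abs_square_less_1)
        also have "\<dots> \<longleftrightarrow> (norm z)\<^sup>2 < 1 \<and> t\<^sup>2 < 1 - (norm z)\<^sup>2"
          using zero_le_power2[of t] by linarith
        also have "\<dots> \<longleftrightarrow> z \<in> hemi_base \<and> \<bar>t\<bar> < hemi_height z"
        proof -
          have "t\<^sup>2 < 1 - (norm z)\<^sup>2 \<longleftrightarrow> \<bar>t\<bar> < hemi_height z"
            unfolding hemi_height_def real_sqrt_abs[of t, symmetric] by (rule real_sqrt_less_iff[symmetric])
          then show ?thesis using zb by (simp add: hemi_base_def abs_square_less_1)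
        qed
        finally show ?thesis by auto
      qed
      show ?case
      proof (cases "z \<in> hemi_base")
        case True
        have h: "hemi_height z > 0" by (rule hemi_height_pos[OF True])
        have "(\<integral>\<^sup>+t. indicator (ball 0 1) (z + t *\<^sub>R last_axis) \<partial>lborel)
          = (\<integral>\<^sup>+t. indicator {- hemi_height z<..<hemi_height z} t \<partial>lborel)"
          using True by (intro nn_integral_cong) (simp only: indicator_def iff simp_thms)
        also have "\<dots> = ennreal (2 * hemi_height z)"
          using h by simp
        also have "\<dots> = 2 * (ennreal (1 / hemi_height z) * ennreal ((hemi_height z)\<^sup>2))"
        proof -
          have "ennreal (1 / hemi_height z) * ennreal ((hemi_height z)\<^sup>2) = ennreal (1 / hemi_height z * (hemi_height z)\<^sup>2)"
            using h by (intro ennreal_mult[symmetric]) auto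
          also have "1 / hemi_height z * (hemi_height z)\<^sup>2 = hemi_height z"
            using h by (simp add: power2_eq_square)
          finally show ?thesis
            using h by (simp add: ennreal_mult)
        qed
        finally have "(\<integral>\<^sup>+t. indicator (ball 0 1) (z + t *\<^sub>R last_axis) \<partial>lborel)
          = 2 * (ennreal (1 / hemi_height z) * ennreal ((hemi_height z)\<^sup>2))" .
        then show ?thesis
          using True by (simp only: indicator_simps mult_1)
      next
        case False
        then have "indicator (ball 0 1) (z + t *\<^sub>R last_axis) = (0::ennreal)" for t
          by (simp only: indicator_def iff simp_thms if_False of_bool_eq)
        then show ?thesis using False by simp
      qed
    qed
  qed
  also have "\<dots> = (\<integral>\<^sup>+w. indicator (ball 0 1) (w :: real^'n::_) \<partial>lborel)"
    by (rule nn_integral_lborel_hyper[symmetric], rule borel_measurable_indicator) simp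
  also have "\<dots> = emeasure lborel (ball (0 :: real^'n::_) 1)"
    by (rule nn_integral_indicator) auto
  also have "\<dots> = ennreal (unit_ball_vol (real CARD('n)))"
    by (subst emeasure_ball) auto
  finally show ?thesis .
qed

text \<open>The squared coordinates sum to 1 on the sphere, and each contributes the volume of the
  unit ball through the two hemispheres around its axis. The equator between them is harmless, since
  the integrand vanishes there.\<close>

lemma surface_sphere:
  "emeasure surface_measure (sphere (0 :: real^'n::{finite,wellorder}) 1) =
     ennreal (real CARD('n) * unit_ball_vol (real CARD('n)))"
proof -
  let ?S = "sphere (0 :: real^'n::_) 1"
  let ?I = "\<lambda>v. (\<integral>\<^sup>+x. indicator (half_sphere v) x * ennreal ((x \<bullet> v)\<^sup>2) \<partial>surface_measure)"
  have split: "(\<integral>\<^sup>+x. indicator ?S x * ennreal ((x $ i)\<^sup>2) \<partial>surface_measure) = ennreal (unit_ball_vol (real CARD('n)))" for i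
  proof -
    let ?e = "axis i 1 :: real^'n::_"
    have I2: "?I (- ?e) = ?I ?e"
      by (intro nn_integral_half_sphere_rotate[where f="\<lambda>t. ennreal (t\<^sup>2)"]) auto
    have "(\<integral>\<^sup>+x. indicator ?S x * ennreal ((x $ i)\<^sup>2) \<partial>surface_measure)
      = (\<integral>\<^sup>+x. indicator (half_sphere ?e) x * ennreal ((x \<bullet> ?e)\<^sup>2) + indicator (half_sphere (- ?e)) x * ennreal ((x \<bullet> (- ?e))\<^sup>2) \<partial>surface_measure)"
    proof (rule nn_integral_cong)
      fix x :: "real^'n::_"
      show "indicator ?S x * ennreal ((x $ i)\<^sup>2) = indicator (half_sphere ?e) x * ennreal ((x \<bullet> ?e)\<^sup>2)
         + indicator (half_sphere (- ?e)) x * ennreal ((x \<bullet> (- ?e))\<^sup>2)"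
        by (cases "x $ i" "0::real" rule: linorder_cases)
          (auto simp: half_sphere_def indicator_def inner_axis inner_axis')
    qed
    also have "\<dots> = ?I ?e + ?I (- ?e)"
      by (rule nn_integral_add) measurable
    also have "\<dots> = 2 * ?I ?e"
      unfolding I2 by (rule mult_2[symmetric])
    also have "\<dots> = ennreal (unit_ball_vol (real CARD('n)))"
      by (rule nn_integral_half_sphere_cos_sq) simp
    finally show ?thesis .
  qed
  have [measurable]: "?S \<in> sets borel" by simp
  have "emeasure surface_measure ?S = (\<integral>\<^sup>+x. indicator ?S x \<partial>surface_measure)"
    by simp
  also have "\<dots> = (\<integral>\<^sup>+x. (\<Sum>i\<in>UNIV. indicator ?S x * ennreal ((x $ i)\<^sup>2)) \<partial>surface_measure)"
  proof (rule nn_integral_cong)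
    fix x :: "real^'n::_"
    have "(\<Sum>i\<in>UNIV. ennreal ((x $ i)\<^sup>2)) = ennreal ((norm x)\<^sup>2)"
      unfolding power2_norm_eq_inner inner_vec_def inner_real_def
      by (subst sum_ennreal) (auto simp: power2_eq_square)
    then show "indicator ?S x = (\<Sum>i\<in>UNIV. indicator ?S x * ennreal ((x $ i)\<^sup>2))"
      by (simp add: sum_distrib_left[symmetric] indicator_def)
  qed
  also have "\<dots> = (\<Sum>i\<in>UNIV. \<integral>\<^sup>+x. indicator ?S x * ennreal ((x $ i)\<^sup>2) \<partial>surface_measure)"
    by (rule nn_integral_sum) measurable
  also have "\<dots> = ennreal (real CARD('n) * unit_ball_vol (real CARD('n)))"
    by (simp add: split ennreal_mult ennreal_of_nat_eq_real_of_nat)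
  finally show ?thesis .
qed

section \<open>The constants \<open>knudsen_gamma\<close> and \<open>knudsen_kappa\<close>\<close>

lemma knudsen_gamma_eq:
  "knudsen_gamma TYPE('n::{finite,wellorder}) = 1 / unit_ball_vol (real (CARD('n) - 1))"
proof -
  let ?v = "first_unit :: real^'n::_"
  have "(LINT u:half_sphere ?v|surface_measure. u \<bullet> ?v) = enn2real (\<integral>\<^sup>+u. ennreal (indicator (half_sphere ?v) u *\<^sub>R (u \<bullet> ?v)) \<partial>surface_measure)"
    unfolding set_lebesgue_integral_def
  proof (rule integral_eq_nn_integral)
    show "(\<lambda>u. indicator (half_sphere ?v) u *\<^sub>R (u \<bullet> ?v)) \<in> borel_measurable surface_measure"
      by measurable
    show "AE u in surface_measure. 0 \<le> indicator (half_sphere ?v) u *\<^sub>R (u \<bullet> ?v)"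
      by (intro AE_I2) (auto simp: indicator_def half_sphere_def inner_commute)
  qed
  also have "(\<integral>\<^sup>+u. ennreal (indicator (half_sphere ?v) u *\<^sub>R (u \<bullet> ?v)) \<partial>surface_measure)
    = (\<integral>\<^sup>+u. indicator (half_sphere ?v) u * ennreal (u \<bullet> ?v) \<partial>surface_measure)"
    by (intro nn_integral_cong) (simp add: indicator_def)
  also have "\<dots> = ennreal (unit_ball_vol (real (CARD('n) - 1)))"
    by (rule nn_integral_half_sphere_cos) (simp add: first_unit_def)
  finally show ?thesis
    by (simp add: knudsen_gamma_def inverse_eq_divide)
qed

lemma knudsen_gamma_pos: "knudsen_gamma TYPE('n::{finite,wellorder}) > 0"
  by (simp add: knudsen_gamma_eq)

lemma measure_surface_sphere:
  "measure surface_measure (sphere (0 :: real^'n::{finite,wellorder}) 1) =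
     real CARD('n) * unit_ball_vol (real CARD('n))"
  unfolding measure_def surface_sphere by (rule enn2real_ennreal) simp

lemma knudsen_kappa_eq_sphere:
  "ennreal (knudsen_kappa TYPE('n::{finite,wellorder})) =
    ennreal (knudsen_gamma TYPE('n)) * emeasure surface_measure (sphere (0 :: real^'n::_) 1)"
  unfolding knudsen_kappa_def measure_surface_sphere surface_sphere
  using knudsen_gamma_pos[where 'n='n] by (intro ennreal_mult) auto

lemma knudsen_kappa_formula:
  "knudsen_kappa TYPE('n::{finite,wellorder}) =
     pi powr (1/2) * Gamma ((real CARD('n) + 1) / 2) * real CARD('n) / Gamma (real CARD('n) / 2 + 1)"
proof -
  have c: "real (CARD('n) - 1) = real CARD('n) - 1"
    by (simp add: of_nat_diff)
  have G: "Gamma ((real CARD('n) + 1) / 2) > 0" "Gamma (real CARD('n) / 2 + 1) > 0"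
    by (intro Gamma_real_pos; simp add: add_pos_pos)+
  have e: "(real CARD('n) - 1) / 2 + 1 = (real CARD('n) + 1) / 2"
    by (simp add: field_simps)
  have p: "pi powr (real CARD('n) / 2) = pi powr (1 / 2) * pi powr ((real CARD('n) - 1) / 2)"
    by (simp add: powr_add[symmetric] field_simps)
  have "knudsen_kappa TYPE('n) = real CARD('n) * unit_ball_vol (real CARD('n)) / unit_ball_vol (real CARD('n) - 1)"
    by (simp add: knudsen_kappa_def measure_surface_sphere knudsen_gamma_eq c)
  also have "\<dots> = pi powr (1/2) * Gamma ((real CARD('n) + 1) / 2) * real CARD('n) / Gamma (real CARD('n) / 2 + 1)"
    using G unfolding unit_ball_vol_def e p by (simp add: field_simps)
  finally show ?thesis .
qed


section \<open>Boundary geometry\<close>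

lemma C1_parametrization_chart:
  assumes "C1_parametrization S U \<phi> \<phi>'" and S: "closed S"
  shows "\<exists>\<psi>. c1_chart U \<phi> \<phi>' \<psi>"
proof -
  from assms obtain \<psi> where "homeomorphism U (\<phi> ` U) \<phi> \<psi>" and op: "openin (top_of_set S) (\<phi> ` U)"
    by (auto simp: C1_parametrization_def)
  obtain T where "open T" "\<phi> ` U = S \<inter> T"
    using op by (auto simp: openin_open)
  then have "\<phi> ` U \<in> sets borel" using S by auto
  then have "c1_chart U \<phi> \<phi>' \<psi>"
    using assms \<open>homeomorphism U (\<phi> ` U) \<phi> \<psi>\<close> unfolding C1_parametrization_def by unfold_locales auto
  then show ?thesis by blast
qed

text \<open>For a regular hypersurface this says that \<open>v\<close> is orthogonal to its tangent
  plane at \<open>x\<close>, without naming a parametrization. It is the bridge from the one chart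
  that \<open>inward_unit_normal\<close> provides to every other chart.\<close>

definition flat_at :: "'a::euclidean_space set \<Rightarrow> 'a \<Rightarrow> 'a \<Rightarrow> bool" where
  "flat_at S x v \<longleftrightarrow> (\<forall>c>0. \<exists>r>0. \<forall>y\<in>S. norm (y - x) < r \<longrightarrow> \<bar>v \<bullet> (y - x)\<bar> \<le> c * norm (y - x))"

text \<open>Continuity of the inverse chart brings points of \<open>S\<close> near
  \<open>\<phi> z0\<close> back to parameters near \<open>z0\<close>, and injectivity of the
  derivative bounds the parameter distance by the distance in space.\<close>

lemma parametrization_flat:
  assumes C: "C1_parametrization S U \<phi> \<phi>'" and z0: "z0 \<in> U"
    and v: "\<And>h. h \<in> base_space \<Longrightarrow> v \<bullet> \<phi>' z0 h = 0"
  shows "flat_at S (\<phi> z0) v"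
  unfolding flat_at_def
proof (intro allI impI)
  fix c :: real assume c: "c > 0"
  have der: "(\<phi> has_derivative \<phi>' z0) (at z0 within U)" and inj: "inj_on (\<phi>' z0) base_space"
    and op: "openin (top_of_set S) (\<phi> ` U)" and Ub: "U \<subseteq> base_space"
    using C z0 openin_imp_subset unfolding C1_parametrization_def by blast+
  obtain \<psi> where hom: "homeomorphism U (\<phi> ` U) \<phi> \<psi>"
    using C unfolding C1_parametrization_def by blast
  obtain m where m: "m > 0" "\<And>h. h \<in> base_space \<Longrightarrow> m * norm h \<le> norm (\<phi>' z0 h)"
    using linear_injective_on_base_bound[OF has_derivative_linear[OF der] inj] by blast
  \<comment> \<open>The first bound lets half of the linear growth survive the error term; the
    second turns the error, paired with \<open>v\<close>, into at most \<open>c * (m / 2)\<close>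
    times the parameter distance. The 1 added to \<open>norm v\<close> avoids division by 0.\<close>
  define e where "e = min (m / 2) (c * m / (2 * (1 + norm v)))"
  have e: "e > 0" "e \<le> m / 2" "norm v * e \<le> c * (m / 2)"
  proof -
    have n: "1 + norm v > 0" by (simp add: add_pos_nonneg)
    show e0: "e > 0" using m c n by (simp add: e_def)
    show "e \<le> m / 2" unfolding e_def by (rule min.cobounded1)
    have "e \<le> c * m / (2 * (1 + norm v))" unfolding e_def by (rule min.cobounded2)
    then have "norm v * e \<le> (1 + norm v) * (c * m / (2 * (1 + norm v)))"
      using n e0 by (intro mult_mono) auto
    also have "\<dots> = c * (m / 2)" using n by (simp add: field_simps)
    finally show "norm v * e \<le> c * (m / 2)" .
  qed
  obtain d where d: "d > 0" "\<And>z. z \<in> U \<Longrightarrow> norm (z - z0) < d \<Longrightarrow>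
      norm (\<phi> z - \<phi> z0 - \<phi>' z0 (z - z0)) \<le> e * norm (z - z0)"
    using der e(1) unfolding has_derivative_within_alt by blast
  obtain T where T: "open T" "\<phi> ` U = S \<inter> T"
    using op by (auto simp: openin_open)
  then have "\<phi> z0 \<in> T" using z0 by blast
  then obtain r0 where r0: "r0 > 0" "ball (\<phi> z0) r0 \<subseteq> T"
    using T(1) open_contains_ball by blast
  have "continuous_on (\<phi> ` U) \<psi>" using hom by (simp add: homeomorphism_def)
  then obtain r1 where r1: "r1 > 0" "\<And>y. y \<in> \<phi> ` U \<Longrightarrow> dist y (\<phi> z0) < r1 \<Longrightarrow> dist (\<psi> y) (\<psi> (\<phi> z0)) < d"
    using z0 d(1) unfolding continuous_on_iff by blast
  show "\<exists>r>0. \<forall>y\<in>S. norm (y - \<phi> z0) < r \<longrightarrow> \<bar>v \<bullet> (y - \<phi> z0)\<bar> \<le> c * norm (y - \<phi> z0)"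
  proof (intro exI conjI ballI impI)
    show "min r0 r1 > 0" using r0 r1 by simp
    fix y assume y: "y \<in> S" "norm (y - \<phi> z0) < min r0 r1"
    then have "y \<in> ball (\<phi> z0) r0" by (simp add: dist_norm norm_minus_commute)
    then have "y \<in> \<phi> ` U" using T(2) r0(2) y(1) by blast
    then obtain z where z: "z \<in> U" "y = \<phi> z" by blast
    have "dist (\<psi> y) (\<psi> (\<phi> z0)) < d"
      using y \<open>y \<in> \<phi> ` U\<close> by (intro r1) (auto simp: dist_norm)
    then have zd: "norm (z - z0) < d"
      using z z0 homeomorphism_apply1[OF hom] by (simp add: dist_norm)
    let ?h = "z - z0"
    have hb: "?h \<in> base_space"
      using z z0 Ub subspace_diff[OF subspace_base_space] by blast
    have err: "norm (y - \<phi> z0 - \<phi>' z0 ?h) \<le> e * norm ?h"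
      using d(2)[OF z(1) zd] z by simp
    have "m * norm ?h \<le> norm (\<phi>' z0 ?h)" by (rule m(2)[OF hb])
    moreover have "norm (\<phi>' z0 ?h) \<le> norm (y - \<phi> z0) + e * norm ?h"
      using err norm_triangle_sub[of "\<phi>' z0 ?h" "y - \<phi> z0"]
        norm_minus_commute[of "\<phi>' z0 ?h" "y - \<phi> z0"] by linarith
    moreover have "e * norm ?h \<le> m / 2 * norm ?h" using e by (intro mult_right_mono) auto
    moreover have "m * norm ?h = m / 2 * norm ?h + m / 2 * norm ?h" by (simp add: field_simps)
    ultimately have lo: "m / 2 * norm ?h \<le> norm (y - \<phi> z0)" by linarith
    have "\<bar>v \<bullet> (y - \<phi> z0)\<bar> = \<bar>v \<bullet> (y - \<phi> z0 - \<phi>' z0 ?h)\<bar>"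
      by (simp add: inner_diff_right v[OF hb])
    also have "\<dots> \<le> norm v * norm (y - \<phi> z0 - \<phi>' z0 ?h)"
      by (rule Cauchy_Schwarz_ineq2)
    also have "\<dots> \<le> norm v * (e * norm ?h)"
      using err by (intro mult_left_mono) auto
    also have "\<dots> \<le> c * (m / 2) * norm ?h"
      using mult_right_mono[OF e(3), of "norm ?h"] by (simp add: mult.assoc)
    also have "\<dots> \<le> c * norm (y - \<phi> z0)"
      using mult_left_mono[OF lo, of c] c by (simp add: mult.assoc)
    finally show "\<bar>v \<bullet> (y - \<phi> z0)\<bar> \<le> c * norm (y - \<phi> z0)" .
  qed
qed

text \<open>Along \<open>z + t *\<^sub>R h\<close> the inner product with \<open>v\<close> grows
  like \<open>t * (v \<bullet> \<phi>' z h)\<close>, whereas flatness makes it of smaller order than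
  \<open>t\<close>.\<close>

lemma flat_at_orthogonal:
  assumes C: "C1_parametrization S U \<phi> \<phi>'" and z: "z \<in> U"
    and flat: "flat_at S (\<phi> z) v" and h: "h \<in> base_space"
  shows "v \<bullet> \<phi>' z h = 0"
proof (rule ccontr)
  assume nz: "v \<bullet> \<phi>' z h \<noteq> 0"
  let ?a = "\<bar>v \<bullet> \<phi>' z h\<bar>" and ?N = "norm (\<phi>' z h) + 1"
  have a: "?a > 0" using nz by simp
  have N: "?N > 0" by (simp add: add_nonneg_pos)
  have cancel: "b / (2 * n) * n = b / 2" if "n > 0" for b n :: real
    using that by simp
  have der: "(\<phi> has_derivative \<phi>' z) (at z within U)" and op: "openin (top_of_set S) (\<phi> ` U)"
    and Uo: "openin (top_of_set base_space) U"
    using C z unfolding C1_parametrization_def by blast+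
  have lin: "linear (\<phi>' z)" by (rule has_derivative_linear[OF der])
  have h0: "h \<noteq> 0" using a linear_0[OF lin] by auto
  then have nh: "norm h > 0" by simp
  have "?a / (2 * ?N) > 0" using a N by simp
  then obtain r where r: "r > 0"
     "\<And>y. y \<in> S \<Longrightarrow> norm (y - \<phi> z) < r \<Longrightarrow> \<bar>v \<bullet> (y - \<phi> z)\<bar> \<le> ?a / (2 * ?N) * norm (y - \<phi> z)"
    using flat unfolding flat_at_def by blast
  \<comment> \<open>The first bound yields \<open>norm ?y \<le> t * ?N\<close>, the second an error
    of at most \<open>t * (?a / 4)\<close>. Flatness contributes \<open>t * (?a / 2)\<close>, and
    the two together stay below \<open>t * ?a\<close>.\<close>
  define e where "e = min (1 / norm h) (?a / (4 * (1 + norm v) * norm h))"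
  have nv: "1 + norm v > 0" by (simp add: add_pos_nonneg)
  have e: "e > 0" "e * norm h \<le> 1" "norm v * (e * norm h) \<le> ?a / 4"
  proof -
    show e0: "e > 0" using nv a nh by (simp add: e_def)
    have "e \<le> 1 / norm h" unfolding e_def by (rule min.cobounded1)
    then have "e * norm h \<le> 1 / norm h * norm h" using nh by (intro mult_right_mono) auto
    then show "e * norm h \<le> 1" using nh by simp
    have "e \<le> ?a / (4 * (1 + norm v) * norm h)" unfolding e_def by (rule min.cobounded2)
    then have "norm v * (e * norm h) \<le> (1 + norm v) * (?a / (4 * (1 + norm v) * norm h) * norm h)"
      using e0 nv by (intro mult_mono mult_right_mono) auto
    also have "\<dots> = ?a / 4" using nv nh by (simp add: divide_simps)
    finally show "norm v * (e * norm h) \<le> ?a / 4" .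
  qed
  obtain d where d: "d > 0" "\<And>y. y \<in> U \<Longrightarrow> norm (y - z) < d \<Longrightarrow>
      norm (\<phi> y - \<phi> z - \<phi>' z (y - z)) \<le> e * norm (y - z)"
    using der e(1) unfolding has_derivative_within_alt by blast
  obtain T where T: "open T" "U = base_space \<inter> T"
    using Uo by (auto simp: openin_open)
  then obtain q where q: "q > 0" "ball z q \<subseteq> T" using z open_contains_ball by blast
  \<comment> \<open>Small enough for the parameter to stay in \<open>U\<close> (\<open>q\<close>)
    and within the derivative estimate (\<open>d\<close>), and for the image to stay where flatness
    applies (\<open>r\<close>).\<close>
  define t where "t = min (min (d / 2) (q / 2) / norm h) (r / (2 * ?N))"
  have t: "t > 0" "t * norm h < d" "t * norm h < q" "t * ?N < r"
  proof -
    show "t > 0" using d q r N nh by (simp add: t_def)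
    have "t \<le> min (d / 2) (q / 2) / norm h" unfolding t_def by (rule min.cobounded1)
    then have "t * norm h \<le> min (d / 2) (q / 2) / norm h * norm h"
      using nh by (intro mult_right_mono) auto
    then have "t * norm h \<le> min (d / 2) (q / 2)" using nh by simp
    then show "t * norm h < d" "t * norm h < q" using d q by auto
    have "t \<le> r / (2 * ?N)" unfolding t_def by (rule min.cobounded2)
    then have "t * ?N \<le> r / (2 * ?N) * ?N"
      using N by (intro mult_right_mono) auto
    also have "\<dots> = r / 2" by (rule cancel[OF N])
    finally show "t * ?N < r" using r by linarith
  qed
  let ?z = "z + t *\<^sub>R h"
  have zU: "?z \<in> U"
  proof -
    have "?z \<in> ball z q" using t by (simp add: dist_norm)
    moreover have "?z \<in> base_space"
      using z h T(2) subspace_add[OF subspace_base_space] subspace_scale[OF subspace_base_space] by blast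
    ultimately show ?thesis using T q by blast
  qed
  then have yS: "\<phi> ?z \<in> S" using op openin_imp_subset by blast
  let ?y = "\<phi> ?z - \<phi> z"
  have "norm (\<phi> ?z - \<phi> z - \<phi>' z (?z - z)) \<le> e * norm (?z - z)"
    using zU t by (intro d(2)) auto
  then have err: "norm (?y - t *\<^sub>R \<phi>' z h) \<le> t * (e * norm h)"
    using t by (simp add: linear_scale[OF lin] mult.left_commute)
  have "norm ?y \<le> norm (t *\<^sub>R \<phi>' z h) + norm (?y - t *\<^sub>R \<phi>' z h)"
    using norm_triangle_sub[of ?y "t *\<^sub>R \<phi>' z h"] by simp
  also have "\<dots> \<le> t * norm (\<phi>' z h) + t * 1"
  proof -
    have "norm (t *\<^sub>R \<phi>' z h) = t * norm (\<phi>' z h)" using t by simp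
    moreover have "t * (e * norm h) \<le> t * 1" using e(2) t by (intro mult_left_mono) auto
    ultimately show ?thesis using err by linarith
  qed
  finally have ny: "norm ?y \<le> t * ?N" by (simp add: distrib_left)
  have "\<bar>v \<bullet> ?y\<bar> \<le> ?a / (2 * ?N) * norm ?y"
    using ny t by (intro r(2) yS) auto
  also have "\<dots> \<le> ?a / (2 * ?N) * (t * ?N)"
    using ny a N by (intro mult_left_mono) auto
  also have "\<dots> = t * (?a / 2)" using cancel[OF N, of ?a] by (simp only: mult.left_commute[of _ t])
  finally have up: "\<bar>v \<bullet> ?y\<bar> \<le> t * (?a / 2)" .
  have "\<bar>v \<bullet> (?y - t *\<^sub>R \<phi>' z h)\<bar> \<le> norm v * norm (?y - t *\<^sub>R \<phi>' z h)"
    by (rule Cauchy_Schwarz_ineq2)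
  also have "\<dots> \<le> norm v * (t * (e * norm h))"
    using err by (intro mult_left_mono) auto
  also have "\<dots> \<le> t * (?a / 4)"
    using mult_left_mono[OF e(3), of t] t by (simp add: mult.left_commute)
  finally have "\<bar>v \<bullet> ?y - t * (v \<bullet> \<phi>' z h)\<bar> \<le> t * (?a / 4)"
    by (simp add: inner_diff_right)
  moreover have "\<bar>t * (v \<bullet> \<phi>' z h)\<bar> = t * ?a" using t by (simp add: abs_mult)
  ultimately have "t * ?a \<le> t * (?a / 2) + t * (?a / 4)" using up by linarith
  then have "t * ?a \<le> t * (3 / 4 * ?a)" by (simp add: algebra_simps)
  then show False using t a by simp
qed

text \<open>In local coordinates the downward axis lies in an exterior cone whose aperture is
  governed by \<open>L\<close>. If that direction is orthogonal to \<open>v\<close>, a small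
  multiple of \<open>v\<close> is added, which the open cone tolerates.\<close>

lemma lipschitz_exterior_direction:
  fixes D :: "(real^'n::{finite,wellorder}) set"
  assumes lip: "lipschitz_boundary D" and x: "x \<in> frontier D" and v: "v \<noteq> 0"
  obtains w s0 where "w \<bullet> v \<noteq> 0" "s0 > 0" "\<And>s. 0 < s \<Longrightarrow> s < s0 \<Longrightarrow> x + s *\<^sub>R w \<notin> D"
proof -
  obtain \<epsilon> I f L where e: "\<epsilon> > 0" and I: "affine_isometry I" "I x = 0"
    and f: "L-lipschitz_on base_space f" "f 0 = (0::real)"
    and im: "I ` (D \<inter> ball x \<epsilon>) = {z \<in> ball 0 \<epsilon>. z $ last_index > f (base_part z)}"
    using lip x unfolding lipschitz_boundary_def by blast
  obtain T c where T: "orthogonal_transformation T" "I = (\<lambda>y. T y + c)"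
    using I(1) by (auto simp: affine_isometry_def)
  have lin: "linear T" by (rule orthogonal_transformation_linear[OF T(1)])
  have Ix: "I (x + w) = T w" for w
    using I(2) by (simp add: T(2) linear_add[OF lin])
  have L: "L \<ge> 0" using f(1) by (rule lipschitz_on_nonneg)
  have ext: "x + s *\<^sub>R w \<notin> D"
    if q: "T w $ last_index < - L * norm (drop_coord last_index (T w))" and s: "0 < s" "s < \<epsilon> / (1 + norm w)" for w s
  proof
    assume inD: "x + s *\<^sub>R w \<in> D"
    have nw: "1 + norm w > 0" by (simp add: add_pos_nonneg)
    have "s * norm w \<le> s * (1 + norm w)" using s by (intro mult_left_mono) auto
    also have "\<dots> < \<epsilon>" using s nw by (simp add: pos_less_divide_eq)
    finally have "x + s *\<^sub>R w \<in> ball x \<epsilon>" using s by (simp add: dist_norm)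
    then have "I (x + s *\<^sub>R w) \<in> I ` (D \<inter> ball x \<epsilon>)" using inD by blast
    then have "T (s *\<^sub>R w) $ last_index > f (drop_coord last_index (T (s *\<^sub>R w)))"
      unfolding im Ix base_part_eq_drop_coord by simp
    then have 1: "s * T w $ last_index > f (s *\<^sub>R drop_coord last_index (T w))"
      by (simp add: linear_scale[OF lin] linear_scale[OF linear_drop_coord])
    have "s *\<^sub>R drop_coord last_index (T w) \<in> base_space"
      by (simp add: mem_base_space drop_coord_nth)
    then have "dist (f (s *\<^sub>R drop_coord last_index (T w))) (f 0) \<le> L * dist (s *\<^sub>R drop_coord last_index (T w)) 0"
      using f(1) subspace_0[OF subspace_base_space] by (intro lipschitz_onD)
    then have "\<bar>f (s *\<^sub>R drop_coord last_index (T w))\<bar> \<le> s * (L * norm (drop_coord last_index (T w)))"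
      using s f(2) by (simp add: dist_norm mult.left_commute)
    moreover have "s * T w $ last_index < s * (- L * norm (drop_coord last_index (T w)))"
      using q s by (intro mult_strict_left_mono) auto
    ultimately show False using 1 by (simp add: abs_le_iff) 
  qed
  \<comment> \<open>Gives \<open>(1 + L) * (d * norm v) < 1\<close>, which keeps the perturbed
    direction inside the exterior cone.\<close>
  define d where "d = 1 / (2 * (1 + L) * (1 + norm v))"
  have d: "d > 0" using L by (simp add: d_def add_pos_nonneg)
  obtain w0 where w0: "T w0 = - axis last_index 1"
    using orthogonal_transformation_surj[OF T(1)] by (metis surjD)
  have pos: "0 < \<epsilon> / (1 + norm w)" for w :: "real^'n::_"
    using e by (simp add: add_pos_nonneg)
  show ?thesis
  proof (cases "w0 \<bullet> v = 0")
    case False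
    have "T w0 $ last_index < - L * norm (drop_coord last_index (T w0))"
      unfolding w0 by (simp add: drop_coord_def linear_neg)
    then show ?thesis using that[of w0, OF False pos] ext by blast
  next
    case True
    let ?w = "w0 + d *\<^sub>R v"
    have Tw: "T ?w = d *\<^sub>R T v - axis last_index 1"
      by (simp add: linear_add[OF lin] linear_scale[OF lin] w0)
    have last: "T ?w $ last_index \<le> d * norm v - 1"
    proof -
      have "T v $ last_index \<le> norm (T v)" using component_le_norm_cart[of "T v" last_index] by linarith
      then have "d * T v $ last_index \<le> d * norm v"
        using d orthogonal_transformation_norm[OF T(1)] by (intro mult_left_mono) auto
      then show ?thesis unfolding Tw by simp
    qed
    have "drop_coord last_index (T ?w) = d *\<^sub>R drop_coord last_index (T v)"
      unfolding Tw linear_diff[OF linear_drop_coord] linear_scale[OF linear_drop_coord] by (simp add: drop_coord_def)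
    then have "norm (drop_coord last_index (T ?w)) \<le> d * norm v"
      using d norm_drop_coord_le[of last_index "T v"] orthogonal_transformation_norm[OF T(1)]
      by (simp add: mult_left_mono)
    then have "L * norm (drop_coord last_index (T ?w)) \<le> L * (d * norm v)"
      using L by (intro mult_left_mono) auto
    moreover have "(1 + L) * (d * norm v) < 1"
    proof -
      have n: "1 + norm v > 0" "1 + L > 0" using L by (auto simp: add_pos_nonneg)
      have "(1 + L) * (d * norm v) \<le> (1 + L) * (d * (1 + norm v))"
        using L d by (intro mult_left_mono) auto
      also have "\<dots> = 1 / 2" using n by (simp add: d_def)
      finally show ?thesis by simp
    qed
    ultimately have "T ?w $ last_index < - L * norm (drop_coord last_index (T ?w))"
      using last by (simp add: distrib_right)
    moreover have "?w \<bullet> v \<noteq> 0"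
      using True d v by (simp add: inner_add_left)
    ultimately show ?thesis using that[of ?w, OF _ pos] ext by blast
  qed
qed

text \<open>If \<open>D\<close> were met arbitrarily close to \<open>x\<close> along
  \<open>u\<close>, it would contain cones on both sides of the tangent plane. The exterior
  direction of the Lipschitz condition is not tangential, so it would run inside one of these
  cones.\<close>

lemma flat_at_one_sided:
  fixes D :: "(real^'n::{finite,wellorder}) set"
  assumes lip: "lipschitz_boundary D" and x: "x \<in> frontier D" and v: "norm v = 1"
    and flat: "flat_at (frontier D) x v"
    and inw: "\<forall>\<^sub>F t in at_right 0. x + t *\<^sub>R v \<in> D"
    and u: "u \<bullet> v < 0"
  shows "\<forall>\<^sub>F t in at_right 0. x + t *\<^sub>R u \<notin> D"
proof (rule ccontr)
  assume "\<not> (\<forall>\<^sub>F t in at_right 0. x + t *\<^sub>R u \<notin> D)"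
  then have freq: "\<exists>\<^sub>F t in at_right 0. x + t *\<^sub>R u \<in> D" by (simp add: not_eventually)
  have "v \<noteq> 0" using v by auto
  obtain w s0 where w: "w \<bullet> v \<noteq> 0" "s0 > 0" "\<And>s. 0 < s \<Longrightarrow> s < s0 \<Longrightarrow> x + s *\<^sub>R w \<notin> D"
    using lipschitz_exterior_direction[OF lip x \<open>v \<noteq> 0\<close>] by blast
  have u0: "norm u > 0" and w0: "norm w > 0" using u w by auto
  \<comment> \<open>The cones must contain \<open>u\<close>, \<open>w\<close> and \<open>v\<close>
    strictly; hence half of the smallest of the three cosines, the one of \<open>v\<close> being
    1.\<close>
  define c where "c = min (min (\<bar>u \<bullet> v\<bar> / norm u) (\<bar>w \<bullet> v\<bar> / norm w)) 1 / 2"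
  have c: "c > 0" "c < 1" "c * norm u < \<bar>u \<bullet> v\<bar>" "c * norm w < \<bar>w \<bullet> v\<bar>"
  proof -
    show c0: "c > 0" using u w u0 w0 by (simp add: c_def divide_neg_pos)
    show "c < 1" by (simp add: c_def)
    have "2 * c \<le> \<bar>u \<bullet> v\<bar> / norm u" "2 * c \<le> \<bar>w \<bullet> v\<bar> / norm w" by (auto simp: c_def)
    then have "2 * c * norm u \<le> \<bar>u \<bullet> v\<bar>" "2 * c * norm w \<le> \<bar>w \<bullet> v\<bar>"
      using u0 w0 by (simp_all add: pos_le_divide_eq)
    moreover have "0 < c * norm u" "0 < c * norm w" using c0 u0 w0 by simp_all
    ultimately have "c * norm u < \<bar>u \<bullet> v\<bar> \<and> c * norm w < \<bar>w \<bullet> v\<bar>" by linarith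
    then show "c * norm u < \<bar>u \<bullet> v\<bar>" "c * norm w < \<bar>w \<bullet> v\<bar>" by auto
  qed
  obtain r where r: "r > 0" "\<And>y. y \<in> frontier D \<Longrightarrow> norm (y - x) < r \<Longrightarrow> \<bar>v \<bullet> (y - x)\<bar> \<le> c * norm (y - x)"
    using flat c(1) unfolding flat_at_def by blast
  \<comment> \<open>The two open half cones around \<open>v\<close> and \<open>-v\<close> miss the boundary, so each lies on one side of it.\<close>
  define K where "K \<sigma> = {y. norm (y - x) < r \<and> c * norm (y - x) < \<sigma> * (v \<bullet> (y - x))}" for \<sigma> :: real
  have conv: "convex (K \<sigma>)" for \<sigma>
  proof (rule convexI)
    fix y y' and a b :: real
    assume y: "y \<in> K \<sigma>" "y' \<in> K \<sigma>" and ab: "0 \<le> a" "0 \<le> b" "a + b = 1"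
    have eq: "a *\<^sub>R y + b *\<^sub>R y' - x = a *\<^sub>R (y - x) + b *\<^sub>R (y' - x)"
      using ab(3) by (simp add: algebra_simps) (metis scaleR_left.add scaleR_one)
    have n: "norm (a *\<^sub>R y + b *\<^sub>R y' - x) \<le> a * norm (y - x) + b * norm (y' - x)"
      unfolding eq using norm_triangle_ineq[of "a *\<^sub>R (y - x)" "b *\<^sub>R (y' - x)"] ab by simp
    have ab': "a > 0 \<or> b > 0" using ab by linarith
    have 1: "a * norm (y - x) + b * norm (y' - x) < a * r + b * r"
      using y ab ab' unfolding K_def
      by (metis (no_types, lifting) add_le_less_mono add_less_le_mono less_imp_le mem_Collect_eq mult_left_mono mult_strict_left_mono)
    have 2: "a * (c * norm (y - x)) + b * (c * norm (y' - x)) < a * (\<sigma> * (v \<bullet> (y - x))) + b * (\<sigma> * (v \<bullet> (y' - x)))"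
      using y ab ab' unfolding K_def
      by (metis (no_types, lifting) add_le_less_mono add_less_le_mono less_imp_le mem_Collect_eq mult_left_mono mult_strict_left_mono)
    have "a * r + b * r = r" using ab(3) by (metis distrib_right mult_1)
    moreover have "c * norm (a *\<^sub>R y + b *\<^sub>R y' - x) \<le> c * (a * norm (y - x) + b * norm (y' - x))"
      using n c by (intro mult_left_mono) auto
    moreover have "c * (a * norm (y - x) + b * norm (y' - x)) = a * (c * norm (y - x)) + b * (c * norm (y' - x))"
      by (simp add: algebra_simps)
    moreover have "\<sigma> * (v \<bullet> (a *\<^sub>R y + b *\<^sub>R y' - x)) = a * (\<sigma> * (v \<bullet> (y - x))) + b * (\<sigma> * (v \<bullet> (y' - x)))"
      by (simp only: eq inner_add_right inner_scaleR_right distrib_left mult.left_commute)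
    ultimately show "a *\<^sub>R y + b *\<^sub>R y' \<in> K \<sigma>"
      using n 1 2 unfolding K_def mem_Collect_eq by linarith
  qed
  have miss: "K \<sigma> \<inter> frontier D = {}" if "\<bar>\<sigma>\<bar> = 1" for \<sigma>
  proof (rule ccontr)
    assume "K \<sigma> \<inter> frontier D \<noteq> {}"
    then obtain y where y: "y \<in> frontier D" "norm (y - x) < r" "c * norm (y - x) < \<sigma> * (v \<bullet> (y - x))"
      by (auto simp: K_def)
    have "\<sigma> * (v \<bullet> (y - x)) \<le> \<bar>\<sigma> * (v \<bullet> (y - x))\<bar>" by simp
    also have "\<dots> = \<bar>v \<bullet> (y - x)\<bar>" using that by (simp add: abs_mult)
    finally show False using r(2)[OF y(1,2)] y(3) by linarith
  qed
  have KD: "K \<sigma> \<subseteq> D" if "\<bar>\<sigma>\<bar> = 1" "y \<in> K \<sigma>" "y \<in> D" for \<sigma> y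
    using connected_Int_frontier[OF convex_connected[OF conv], of \<sigma> D] miss[OF that(1)] that(2,3) by blast
  have inK: "x + s *\<^sub>R a \<in> K \<sigma>" if "0 < s" "s < r / (1 + norm a)" "c * norm a < \<sigma> * (v \<bullet> a)" for s a \<sigma>
  proof -
    have "1 + norm a > 0" by (simp add: add_pos_nonneg)
    then have "s * (1 + norm a) < r" using that by (simp add: pos_less_divide_eq)
    moreover have "s * norm a \<le> s * (1 + norm a)" using that by (intro mult_left_mono) auto
    ultimately have 1: "s * norm a < r" by linarith
    have "s * (c * norm a) < s * (\<sigma> * (v \<bullet> a))" using that by (intro mult_strict_left_mono)
    then have 2: "c * (s * norm a) < \<sigma> * (s * (v \<bullet> a))" by (simp only: mult.left_commute)
    have "x + s *\<^sub>R a - x = s *\<^sub>R a" "norm (s *\<^sub>R a) = s * norm a" using that by simp_all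
    then show ?thesis using 1 2 by (simp only: K_def mem_Collect_eq inner_scaleR_right)
  qed
  have rpos: "r / (1 + norm a) > 0" for a :: "real^'n::_" using r by (simp add: add_pos_nonneg)
  have Kplus: "K 1 \<subseteq> D"
  proof -
    have "\<forall>\<^sub>F t in at_right 0. t \<in> {0<..<r / (1 + norm v)}"
      by (rule eventually_at_right_real) (rule rpos)
    with inw have "\<forall>\<^sub>F t in at_right (0::real). x + t *\<^sub>R v \<in> D \<and> t \<in> {0<..<r / (1 + norm v)}"
      by (rule eventually_conj)
    then obtain t where t: "x + t *\<^sub>R v \<in> D" "0 < t" "t < r / (1 + norm v)"
      using eventually_happens'[OF trivial_limit_at_right_real] by auto
    have "x + t *\<^sub>R v \<in> K 1"
      using t v c by (intro inK) (auto simp: dot_square_norm)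
    then show ?thesis using KD[of 1] t by auto
  qed
  have Kminus: "K (- 1) \<subseteq> D"
  proof -
    have "\<forall>\<^sub>F t in at_right 0. t \<in> {0<..<r / (1 + norm u)}"
      by (rule eventually_at_right_real) (rule rpos)
    then have "\<forall>\<^sub>F t in at_right (0::real). x + t *\<^sub>R u \<in> D \<longrightarrow> x + t *\<^sub>R u \<in> D \<and> t \<in> {0<..<r / (1 + norm u)}"
      by (rule eventually_mono) blast
    from frequently_ex[OF frequently_rev_mp[OF freq this]]
    obtain t where t: "x + t *\<^sub>R u \<in> D" "0 < t" "t < r / (1 + norm u)"
      by auto
    have "x + t *\<^sub>R u \<in> K (- 1)"
      using t u c by (intro inK) (auto simp: inner_commute)
    then show ?thesis using KD[of "- 1"] t by auto
  qed
  define s where "s = min s0 (r / (1 + norm w)) / 2"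
  have half_min: "0 < min p q / 2 \<and> min p q / 2 < p \<and> min p q / 2 < q" if "p > 0" "q > 0" for p q :: real
    using that by (auto simp: min_def)
  have s: "0 < s" "s < s0" "s < r / (1 + norm w)"
    using half_min[OF w(2) rpos[of w]] unfolding s_def by blast+
  have "x + s *\<^sub>R w \<in> K 1 \<or> x + s *\<^sub>R w \<in> K (- 1)"
  proof (cases "w \<bullet> v < 0")
    case True
    then have "c * norm w < - 1 * (v \<bullet> w)" using c(4) by (simp add: inner_commute)
    then show ?thesis using inK[OF s(1,3)] by blast
  next
    case False
    then have "c * norm w < 1 * (v \<bullet> w)" using c(4) by (simp add: inner_commute)
    then show ?thesis using inK[OF s(1,3)] by blast
  qed
  then show False using w(3)[OF s(1,2)] Kplus Kminus by blast
qed

lemma inward_unit_normal_flat: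
  assumes "inward_unit_normal D x v"
  shows "flat_at (frontier D) x v"
  using assms parametrization_flat unfolding inward_unit_normal_def by blast

lemma inward_unit_normal_orthogonal:
  assumes "inward_unit_normal D x v" "C1_parametrization (frontier D) U \<phi> \<phi>'" "z \<in> U" "\<phi> z = x" "h \<in> base_space"
  shows "v \<bullet> \<phi>' z h = 0"
  using flat_at_orthogonal[OF assms(2,3) _ assms(5)] inward_unit_normal_flat[OF assms(1)] assms(4) by simp

lemma inward_unit_normal_one_sided:
  assumes "lipschitz_boundary D" "inward_unit_normal D x v" "x \<in> frontier D" "u \<bullet> v < 0"
  shows "\<forall>\<^sub>F t in at_right 0. x + t *\<^sub>R u \<notin> D"
  using assms(2)
  by (intro flat_at_one_sided[OF assms(1,3) _ inward_unit_normal_flat[OF assms(2)] _ assms(4)])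
    (auto simp: inward_unit_normal_def)

section \<open>Measurability of the flight condition, and null sets of lines\<close>

lemma closed_compact_projection:
  fixes C :: "('a::metric_space \<times> 'b::metric_space) set"
  assumes C: "closed C" and K: "compact K"
  shows "closed {p. \<exists>r\<in>K. (p, r) \<in> C}"
  unfolding closed_sequential_limits
proof (intro allI impI, elim conjE)
  fix p l assume p: "\<forall>n. p n \<in> {p. \<exists>r\<in>K. (p, r) \<in> C}" and lim: "p \<longlonglongrightarrow> l"
  then have "\<forall>n. \<exists>r. r \<in> K \<and> (p n, r) \<in> C" by blast
  then obtain r where r: "\<And>n. r n \<in> K" "\<And>n. (p n, r n) \<in> C" by metis
  obtain a q where a: "a \<in> K" "strict_mono q" "(r \<circ> q) \<longlonglongrightarrow> a"
    using K r(1) unfolding compact_def by blast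
  have lim2: "(\<lambda>n. ((p \<circ> q) n, (r \<circ> q) n)) \<longlonglongrightarrow> (l, a)"
    by (intro tendsto_Pair LIMSEQ_subseq_LIMSEQ[OF lim a(2)] a(3))
  have "(l, a) \<in> C"
    by (rule Lim_in_closed_set[OF C _ _ lim2]) (use r in auto)
  then show "l \<in> {p. \<exists>r\<in>K. (p, r) \<in> C}" using a by blast
qed

text \<open>For \<open>x\<close> on the frontier and a time \<open>t > 0\<close> at which the flight
  is in \<open>D\<close>, this is the condition \<open>t \<le> hit_time D x u\<close>, but in a form
  that is visibly Borel in all three arguments and determines the starting point.\<close>

definition flies :: "(real^'n) set \<Rightarrow> real^'n \<Rightarrow> real^'n \<Rightarrow> real \<Rightarrow> bool" where
  "flies D x u t \<longleftrightarrow> 0 < t \<and> (\<forall>s\<in>{0<..t}. x + s *\<^sub>R u \<in> D)"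

text \<open>Times are written \<open>t * r\<close>, with \<open>r\<close> in a range independent of
  \<open>t\<close>. For \<open>r\<close> between \<open>1 / Suc k\<close> and 1 the failing triples
  are the projection of a closed set along a compact factor, hence closed; letting \<open>k\<close>
  vary exhausts the half-open time interval.\<close>

lemma flies_borel:
  fixes D :: "(real^'n) set"
  assumes D: "open D"
  shows "{p. flies D (fst p) (fst (snd p)) (snd (snd p))} \<in> sets borel"
proof -
  let ?f = "\<lambda>q :: ((real^'n) \<times> (real^'n) \<times> real) \<times> real. fst (fst q) + (snd (snd (fst q)) * snd q) *\<^sub>R fst (snd (fst q))"
  have "continuous_on UNIV ?f"
    by (intro continuous_on_add continuous_on_scaleR continuous_on_mult continuous_on_fst continuous_on_snd continuous_on_id)
  then have "closed (?f -` (- D))"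
    using D by (intro closed_vimage) auto
  then have cl: "closed {q. ?f q \<in> - D}"
    by (simp only: vimage_def)
  let ?O = "\<lambda>k::nat. {p. \<exists>r\<in>{1 / Suc k..1}. (p, r) \<in> {q. ?f q \<in> - D}}"
  have O: "closed (?O k)" for k
    by (rule closed_compact_projection[OF cl compact_Icc])
  have "{p. flies D (fst p) (fst (snd p)) (snd (snd p))} = {p. 0 < snd (snd p)} \<inter> (\<Inter>k. - ?O k)"
  proof (intro equalityI subsetI)
    fix p :: "(real^'n) \<times> (real^'n) \<times> real"
    obtain x u t where p: "p = (x, u, t)" by (cases p) auto
    {
      assume "p \<in> {p. flies D (fst p) (fst (snd p)) (snd (snd p))}"
      then have fl: "0 < t" "\<And>s. 0 < s \<Longrightarrow> s \<le> t \<Longrightarrow> x + s *\<^sub>R u \<in> D" by (auto simp: p flies_def)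
      have neg: "p \<in> - ?O k" for k
      proof -
        have "x + (t * r) *\<^sub>R u \<in> D" if r: "r \<in> {1 / Suc k..1}" for r
        proof (rule fl(2))
          have "0 < 1 / real (Suc k)" by simp
          then have "0 < r" using r by (simp only: atLeastAtMost_iff) linarith
          then show "0 < t * r" using fl(1) by simp
          show "t * r \<le> t" using fl(1) r by (simp add: mult_left_le)
        qed
        then show ?thesis by (auto simp: p)
      qed
      have "p \<in> {p. 0 < snd (snd p)}" using fl(1) by (simp add: p)
      then show "p \<in> {p. 0 < snd (snd p)} \<inter> (\<Inter>k. - ?O k)" using neg by blast
    next
      assume a: "p \<in> {p. 0 < snd (snd p)} \<inter> (\<Inter>k. - ?O k)"
      then have t: "0 < t" by (simp add: p)
      have "x + s *\<^sub>R u \<in> D" if s: "0 < s" "s \<le> t" for s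
      proof -
        have st: "0 < s / t" "s / t \<le> 1" using s t by auto
        obtain k where "inverse (real (Suc k)) < s / t" using reals_Archimedean[OF st(1)] by blast
        then have "s / t \<in> {1 / Suc k..1}" using st by (simp add: inverse_eq_divide)
        moreover have "p \<notin> ?O k" using a by blast
        ultimately have "(p, s / t) \<notin> {q. ?f q \<in> - D}" by blast
        then show ?thesis using t by (simp add: p)
      qed
      then show "p \<in> {p. flies D (fst p) (fst (snd p)) (snd (snd p))}" using t by (simp add: p flies_def)
    }
  qed
  moreover have "open {p :: (real^'n) \<times> (real^'n) \<times> real. 0 < snd (snd p)}"
    by (intro open_Collect_less continuous_intros)
  moreover have "(\<Inter>k. - ?O k) \<in> sets borel"
    using O by (intro sets.countable_INT) auto
  ultimately show ?thesis by auto
qed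

text \<open>Projection along \<open>u\<close> is 1-Lipschitz, so the shadow of \<open>Z\<close> on
  the hyperplane orthogonal to \<open>u\<close> is null. After a rotation the lines lie in the
  cylinder over a Borel null set, which has volume 0 by Fubini.\<close>

lemma negligible_lines:
  fixes Z :: "(real^'n::{finite,wellorder}) set"
  assumes Z: "hausdorff_outer (CARD('n) - 1) Z = 0" and u: "norm u = 1"
  shows "negligible {x + t *\<^sub>R u |x t. x \<in> Z}"
proof -
  have "norm u = norm (axis last_index (1::real) :: real^'n::_)" using u by simp
  then obtain T :: "real^'n::_ \<Rightarrow> real^'n::_" where T: "orthogonal_transformation T" "T u = axis last_index 1"
    using orthogonal_transformation_exists by blast
  have lin: "linear T" by (rule orthogonal_transformation_linear[OF T(1)])
  have "hausdorff_outer (CARD('n) - 1) ((\<lambda>x. drop_coord last_index (T x)) ` Z) \<le> ennreal (1 ^ (CARD('n) - 1)) * hausdorff_outer (CARD('n) - 1) Z"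
  proof (rule hausdorff_outer_lipschitz_image)
    fix x y
    have "norm (drop_coord last_index (T x) - drop_coord last_index (T y)) \<le> norm (T (x - y))"
      using norm_drop_coord_le[of last_index "T (x - y)"] by (simp add: linear_diff[OF lin] linear_diff[OF linear_drop_coord])
    then show "norm (drop_coord last_index (T x) - drop_coord last_index (T y)) \<le> 1 * norm (x - y)"
      using orthogonal_transformation_norm[OF T(1)] by simp
  qed simp
  then have "hausdorff_outer (CARD('n) - 1) ((\<lambda>x. drop_coord last_index (T x)) ` Z) = 0"
    using Z by simp
  then obtain N where N: "N \<in> sets borel" "(\<lambda>x. drop_coord last_index (T x)) ` Z \<subseteq> N" "emeasure (hyper last_index) N = 0"
    by (rule hausdorff_null_imp_hyper_null)
  note N(1)[measurable]
  let ?Y = "{w. drop_coord last_index w \<in> N}"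
  have "emeasure lborel ?Y = (\<integral>\<^sup>+w. indicator ?Y w \<partial>lborel)"
    by (rule nn_integral_indicator[symmetric]) measurable
  also have "\<dots> = (\<integral>\<^sup>+z. \<integral>\<^sup>+t. indicator ?Y (z + t *\<^sub>R axis last_index 1) \<partial>lborel \<partial>hyper last_index)"
    by (rule nn_integral_lborel_hyper) measurable
  also have "\<dots> = (\<integral>\<^sup>+z. 0 \<partial>hyper (last_index :: 'n))"
  proof (rule nn_integral_cong_AE)
    have "AE z in hyper last_index. z \<notin> N"
      using N by (intro AE_not_in) (auto simp: null_sets_def)
    then show "AE z in hyper last_index. (\<integral>\<^sup>+t. indicator ?Y (z + t *\<^sub>R axis last_index 1) \<partial>lborel) = 0"
      using AE_hyper[of "last_index :: 'n"]
      by eventually_elim (simp add: drop_coord_add_axis drop_coord_id)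
  qed
  finally have "emeasure lborel ?Y = 0" by simp
  moreover have "?Y \<in> sets borel" by measurable
  ultimately have "?Y \<in> null_sets lborel" by (simp add: null_sets_def)
  then have nY: "negligible ?Y"
    by (simp add: negligible_iff_null_sets null_sets_completionI)
  have linv: "linear (inv T)" 
    using orthogonal_transformation_inv[OF T(1)] by (rule orthogonal_transformation_linear)
  have "negligible (inv T ` ?Y)"
    using nY linv by (intro negligible_differentiable_image_negligible linear_imp_differentiable_on) auto
  moreover have "{x + t *\<^sub>R u |x t. x \<in> Z} \<subseteq> inv T ` ?Y"
  proof clarify
    fix x t assume x: "x \<in> Z"
    have "T (x + t *\<^sub>R u) \<in> ?Y"
      using N(2) x by (auto simp: linear_add[OF lin] linear_scale[OF lin] T(2) drop_coord_add_axis)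
    then show "x + t *\<^sub>R u \<in> inv T ` ?Y"
      using inv_f_f[OF orthogonal_transformation_inj[OF T(1)]] by (metis imageI)
  qed
  ultimately show ?thesis by (rule negligible_subset)
qed

lemma countable_parametrizations:
  assumes R: "\<And>x. x \<in> R \<Longrightarrow> locally_C1_at S x"
  obtains U \<phi> \<phi>' where "\<And>i::nat. C1_parametrization S (U i) (\<phi> i) (\<phi>' i)" "R \<subseteq> (\<Union>i. \<phi> i ` U i)"
proof -
  let ?F = "{\<phi> ` U |U \<phi> \<phi>'. C1_parametrization S U \<phi> \<phi>'}"
  have "openin (top_of_set S) A" if "A \<in> ?F" for A
    using that by (auto simp: C1_parametrization_def)
  then obtain F where F: "F \<subseteq> ?F" "countable F" "\<Union>F = \<Union>?F"
    by (rule Lindelof_openin)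
  have RF: "R \<subseteq> \<Union>F"
  proof
    fix x assume "x \<in> R"
    then obtain U \<phi> \<phi>' where "C1_parametrization S U \<phi> \<phi>'" "x \<in> \<phi> ` U"
      using R unfolding locally_C1_at_def by blast
    moreover from this(1) have "\<phi> ` U \<in> ?F" by blast
    ultimately show "x \<in> \<Union>F" unfolding F(3) by (intro UnionI)
  qed
  \<comment> \<open>The empty chart makes the family nonempty, so that it can be enumerated even if
    \<open>R\<close> is empty.\<close>
  have "C1_parametrization S {} (\<lambda>x. x) (\<lambda>x. id)"
    by (auto simp: C1_parametrization_def homeomorphism_def)
  then have "(\<lambda>x. x) ` {} \<in> ?F" by blast
  then have ne: "insert {} F \<noteq> {}" "insert {} F \<subseteq> ?F" "countable (insert {} F)"
    using F by auto
  define A where "A = from_nat_into (insert {} F)"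
  have "A i \<in> ?F" for i
    using from_nat_into[OF ne(1), of i] ne(2) unfolding A_def by blast
  then have "\<forall>i. \<exists>U \<phi> \<phi>'. C1_parametrization S U \<phi> \<phi>' \<and> A i = \<phi> ` U" by blast
  then obtain U \<phi> \<phi>' where *: "\<And>i. C1_parametrization S (U i) (\<phi> i) (\<phi>' i)" "\<And>i. A i = \<phi> i ` U i"
    by metis
  have "\<Union>F \<subseteq> (\<Union>i. A i)"
    using range_from_nat_into[OF ne(1,3)] unfolding A_def by auto
  then have "R \<subseteq> (\<Union>i. \<phi> i ` U i)" using RF *(2) by simp
  then show ?thesis using that * by blast
qed


section \<open>Flights in a fixed direction\<close>

lemma flies_measurable [measurable (raw)]:
  fixes D :: "(real^'n) set"
  assumes D: "open D"
    and [measurable]: "f \<in> M \<rightarrow>\<^sub>M borel" "g \<in> M \<rightarrow>\<^sub>M borel" "h \<in> M \<rightarrow>\<^sub>M borel"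
  shows "Measurable.pred M (\<lambda>p. flies D (f p) (g p) (h p))"
proof -
  have [measurable]: "{q. flies D (fst q) (fst (snd q)) (snd (snd q))} \<in> sets borel"
    by (rule flies_borel[OF D])
  have [measurable]: "(\<lambda>p. (f p, g p, h p)) \<in> M \<rightarrow>\<^sub>M borel"
    by (simp add: borel_prod[symmetric])
  have "Measurable.pred M (\<lambda>p. (f p, g p, h p) \<in> {q. flies D (fst q) (fst (snd q)) (snd (snd q))})"
    by measurable
  then show ?thesis by simp
qed

definition path_time :: "(real^'n) set \<Rightarrow> (real^'n) set \<Rightarrow> real^'n \<Rightarrow> real^'n \<Rightarrow> ennreal" where
  "path_time D B x u = (\<integral>\<^sup>+t. indicator {t. flies D x u t} t * indicator B (x + t *\<^sub>R u) \<partial>lborel)"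

lemma path_time_measurable [measurable (raw)]:
  fixes D :: "(real^'n) set"
  assumes D: "open D" and B: "B \<in> sets borel"
    and f [measurable]: "f \<in> M \<rightarrow>\<^sub>M borel" and g [measurable]: "g \<in> M \<rightarrow>\<^sub>M borel"
  shows "(\<lambda>p. path_time D B (f p) (g p)) \<in> borel_measurable M"
proof -
  note B[measurable]
  have [measurable]: "Measurable.pred (M \<Otimes>\<^sub>M lborel) (\<lambda>p. flies D (f (fst p)) (g (fst p)) (snd p))"
    by (intro flies_measurable[OF D]) measurable
  have "(\<lambda>(p, t). indicator {t. flies D (f p) (g p) t} t * indicator B (f p + t *\<^sub>R g p)) \<in> borel_measurable (M \<Otimes>\<^sub>M lborel)"
    unfolding indicator_def split_beta mem_Collect_eq by measurable
  then show ?thesis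
    unfolding path_time_def by (rule lborel.borel_measurable_nn_integral)
qed

locale knudsen_charts =
  fixes D R :: "(real^'n::{finite,wellorder}) set"
    and \<nn> :: "real^'n::_ \<Rightarrow> real^'n::_"
    and U :: "nat \<Rightarrow> (real^'n::_) set" and \<phi> :: "nat \<Rightarrow> real^'n::_ \<Rightarrow> real^'n::_"
    and \<phi>' :: "nat \<Rightarrow> real^'n::_ \<Rightarrow> real^'n::_ \<Rightarrow> real^'n::_" and \<psi> :: "nat \<Rightarrow> real^'n::_ \<Rightarrow> real^'n::_"
  assumes D_open: "open D" and D_bounded: "bounded D"
    and lipschitz: "lipschitz_boundary D"
    and R_open: "openin (top_of_set (frontier D)) R"
    and R_full: "emeasure surface_measure (frontier D - R) = 0"
    and normal: "\<And>x. x \<in> R \<Longrightarrow> inward_unit_normal D x (\<nn> x)"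
    and C1: "\<And>i. C1_parametrization (frontier D) (U i) (\<phi> i) (\<phi>' i)"
    and chart: "\<And>i. c1_chart (U i) (\<phi> i) (\<phi>' i) (\<psi> i)"
    and cover: "R \<subseteq> (\<Union>i. \<phi> i ` U i)"
begin

lemma D_borel [measurable]: "D \<in> sets borel"
  using D_open by simp

lemma frontier_disjoint: "x \<in> frontier D \<Longrightarrow> x \<notin> D"
  using D_open by (simp add: frontier_def interior_open)

lemma R_frontier: "R \<subseteq> frontier D"
  using R_open openin_imp_subset by blast

lemma R_borel [measurable]: "R \<in> sets borel"
proof -
  obtain T where "open T" "R = frontier D \<inter> T"
    using R_open by (auto simp: openin_open)
  then show ?thesis by auto
qed

definition piece :: "nat \<Rightarrow> (real^'n::_) set" where
  "piece i = R \<inter> \<phi> i ` U i - (\<Union>j<i. \<phi> j ` U j)"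

lemma piece_borel [measurable]: "piece i \<in> sets borel"
  unfolding piece_def using c1_chart.image_borel[OF chart] by (intro sets.Diff sets.Int sets.finite_UN) auto

lemma piece_subset: "piece i \<subseteq> R" "piece i \<subseteq> \<phi> i ` U i"
  by (auto simp: piece_def)

lemma disjoint_pieces: "disjoint_family piece"
  unfolding disjoint_family_on_def
proof (intro ballI impI)
  fix i j :: nat assume "i \<noteq> j"
  then consider "i < j" | "j < i" by linarith
  then show "piece i \<inter> piece j = {}"
    by cases (auto simp: piece_def)
qed

lemma Union_pieces: "(\<Union>i. piece i) = R"
proof
  show "R \<subseteq> (\<Union>i. piece i)"
  proof
    fix x assume x: "x \<in> R"
    then have "\<exists>i. x \<in> \<phi> i ` U i" using cover by blast
    then obtain i where "x \<in> \<phi> i ` U i" "\<And>j. j < i \<Longrightarrow> x \<notin> \<phi> j ` U j"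
      using exists_least_iff[of "\<lambda>i. x \<in> \<phi> i ` U i"] by blast
    then have "x \<in> piece i" using x by (auto simp: piece_def)
    then show "x \<in> (\<Union>i. piece i)" by blast
  qed
qed (use piece_subset in auto)

lemma nn_integral_piece:
  assumes [measurable]: "h \<in> borel_measurable borel"
  shows "(\<integral>\<^sup>+x. h x * indicator (piece i) x \<partial>surface_measure) =
    (\<integral>\<^sup>+z. ennreal (c1_chart.jac (U i) (\<phi>' i) z) * (h (c1_chart.phi0 (U i) (\<phi> i) z) *
      indicator (piece i) (c1_chart.phi0 (U i) (\<phi> i) z)) \<partial>hyper last_index)"
proof -
  interpret C: c1_chart "U i" "\<phi> i" "\<phi>' i" "\<psi> i" by (rule chart)
  have "(\<integral>\<^sup>+x. h x * indicator (piece i) x \<partial>surface_measure) =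
      (\<integral>\<^sup>+x. indicator (\<phi> i ` U i) x * (h x * indicator (piece i) x) \<partial>surface_measure)"
    using piece_subset(2)[of i] by (intro nn_integral_cong) (auto simp: indicator_def)
  also have "\<dots> = (\<integral>\<^sup>+z. ennreal (C.jac z) * (h (C.phi0 z) * indicator (piece i) (C.phi0 z)) \<partial>hyper last_index)"
    by (rule C.nn_integral_chart) measurable
  finally show ?thesis .
qed

text \<open>The values of \<open>\<nn>\<close> off \<open>R\<close> are arbitrary. With 0 in their
  place the field is Borel, and points off \<open>R\<close> carry no weight in any integral against
  the cosine.\<close>

definition normal0 :: "real^'n::_ \<Rightarrow> real^'n::_" where
  "normal0 x = (if x \<in> R then \<nn> x else 0)"

lemma normal0_unit: "x \<in> R \<Longrightarrow> norm (normal0 x) = 1"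
  using normal[of x] by (simp add: normal0_def inward_unit_normal_def)

lemma normal0_orthogonal:
  assumes "z \<in> U i" "\<phi> i z \<in> R" "h \<in> base_space"
  shows "normal0 (\<phi> i z) \<bullet> \<phi>' i z h = 0"
  using inward_unit_normal_orthogonal[OF normal[OF assms(2)] C1 assms(1) refl assms(3)] assms(2)
  by (simp add: normal0_def)

lemma one_sided:
  assumes "x \<in> R" "u \<bullet> normal0 x < 0"
  shows "\<forall>\<^sub>F t in at_right 0. x + t *\<^sub>R u \<notin> D"
  using inward_unit_normal_one_sided[OF lipschitz normal[OF assms(1)], of u] assms R_frontier
  by (auto simp: normal0_def)

lemma normal0_measurable [measurable]: "normal0 \<in> borel_measurable borel"
proof (rule measurable_piecewise_restrict[where C="insert (- R) (range piece)"])
  show "countable (insert (- R) (range piece))" by simp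
  show "\<Omega> \<inter> space borel \<in> sets borel" if "\<Omega> \<in> insert (- R) (range piece)" for \<Omega>
    using that by auto
  show "space borel \<subseteq> \<Union> (insert (- R) (range piece))"
    using Union_pieces by auto
  fix \<Omega> assume "\<Omega> \<in> insert (- R) (range piece)"
  then consider "\<Omega> = - R" | i where "\<Omega> = piece i" by auto
  then show "normal0 \<in> borel_measurable (restrict_space borel \<Omega>)"
  proof cases
    case 1
    have "(\<lambda>x. 0) \<in> borel_measurable (restrict_space borel \<Omega>)" by simp
    then show ?thesis
      by (rule measurable_cong[THEN iffD1, rotated]) (auto simp: 1 normal0_def space_restrict_space)
  next
    case 2
    interpret C: c1_chart "U i" "\<phi> i" "\<phi>' i" "\<psi> i" by (rule chart)
    let ?c = "\<lambda>x. cross_normal (\<phi>' i (\<psi> i x))"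
    define m where "m x = indicator (\<phi> i ` U i) x *\<^sub>R ((1 / norm (?c x)) *\<^sub>R ?c x)" for x
    have inv: "\<psi> i (\<phi> i z) = z" if "z \<in> U i" for z
      using C.hom that by (rule homeomorphism_apply1)
    have c0: "norm (?c x) \<noteq> 0" if "x \<in> \<phi> i ` U i" for x
      using that inv cross_normal_nonzero[OF C.linear_der C.inj_der] by auto
    have contc: "continuous_on (\<phi> i ` U i) ?c"
      using C.hom by (intro continuous_on_compose2[OF C.continuous_cross]) (auto simp: homeomorphism_def)
    have [measurable]: "m \<in> borel_measurable borel"
      unfolding m_def
      by (intro borel_measurable_continuous_on_indicator C.image_borel continuous_intros contc) (use c0 in auto)
    \<comment> \<open>The points at which the orientation of the chart is the inward one, tested
      along the times \<open>1 / Suc k\<close> so that only countable quantifiers occur.\<close>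
    define P where "P = {x. \<exists>K. \<forall>k\<ge>K. x + (1 / Suc k) *\<^sub>R m x \<in> D}"
    have "P = {x. \<exists>K. \<forall>k. K \<le> k \<longrightarrow> x + (1 / Suc k) *\<^sub>R m x \<in> D}" by (simp add: P_def)
    then have [measurable]: "P \<in> sets borel" by simp
    have lim: "filterlim (\<lambda>k::nat. 1 / real (Suc k)) (at_right 0) sequentially"
      unfolding filterlim_at_right_to_0[symmetric] filterlim_at
      using LIMSEQ_Suc[OF lim_1_over_n] by (auto intro!: always_eventually)
    have eq: "normal0 x = (if x \<in> P then m x else - m x)" if x: "x \<in> piece i" for x
    proof -
      have xR: "x \<in> R" and xI: "x \<in> \<phi> i ` U i" using x piece_subset by blast+
      then obtain z where z: "z \<in> U i" "x = \<phi> i z" by blast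
      let ?v = "normal0 x"
      have v1: "norm ?v = 1" by (rule normal0_unit[OF xR])
      have cz: "?c x = cross_normal (\<phi>' i z)" using inv[OF z(1)] z by simp
      have "cross_normal (\<phi>' i z) = (cross_normal (\<phi>' i z) \<bullet> ?v) *\<^sub>R ?v"
        using normal0_orthogonal[of z i] z xR
        by (intro cross_normal_eq_scaled C.linear_der C.inj_der v1) auto
      then obtain a where a: "?c x = a *\<^sub>R ?v" unfolding cz by blast
      have a0: "a \<noteq> 0" using c0[OF xI] a by auto
      have m: "m x = (a / \<bar>a\<bar>) *\<^sub>R ?v"
        using xI v1 by (simp add: m_def a)
      consider "a > 0" | "a < 0" using a0 by linarith
      then show ?thesis
      proof cases
        case 1
        then have mv: "m x = ?v" using m by simp
        have "\<forall>\<^sub>F t in at_right 0. x + t *\<^sub>R ?v \<in> D"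
          using normal[OF xR] xR by (simp add: inward_unit_normal_def normal0_def)
        then have "\<forall>\<^sub>F k in sequentially. x + (1 / real (Suc k)) *\<^sub>R m x \<in> D"
          unfolding mv using lim by (rule eventually_compose_filterlim)
        then have "x \<in> P" by (simp add: P_def eventually_sequentially)
        then show ?thesis using mv by simp
      next
        case 2
        then have mv: "m x = - ?v" using m by simp
        \<comment> \<open>One-sidedness enters here: the outward direction must fail the test
          defining \<open>P\<close>.\<close>
        have "(- ?v) \<bullet> ?v < 0" using v1 by (simp add: dot_square_norm)
        then have "\<forall>\<^sub>F t in at_right 0. x + t *\<^sub>R m x \<notin> D"
          unfolding mv by (rule one_sided[OF xR])
        then have "\<forall>\<^sub>F k in sequentially. x + (1 / real (Suc k)) *\<^sub>R m x \<notin> D"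
          using lim by (rule eventually_compose_filterlim)
        then obtain K where K: "\<And>k. k \<ge> K \<Longrightarrow> x + (1 / real (Suc k)) *\<^sub>R m x \<notin> D"
          unfolding eventually_sequentially by blast
        have "x \<notin> P"
        proof
          assume "x \<in> P"
          then obtain K' where "\<forall>k\<ge>K'. x + (1 / real (Suc k)) *\<^sub>R m x \<in> D" unfolding P_def by blast
          then show False using K[of "max K K'"] by simp
        qed
        then show ?thesis using mv by simp
      qed
    qed
    have "(\<lambda>x. if x \<in> P then m x else - m x) \<in> borel_measurable (restrict_space borel \<Omega>)"
      by (intro measurable_restrict_space1) measurable
    then show ?thesis
      by (rule measurable_cong[THEN iffD1, rotated]) (auto simp: 2 eq space_restrict_space)
  qed
qed

section \<open>Change of variables for the flights that start in one chart\<close>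

definition part :: "(real^'n::_) set \<Rightarrow> real^'n::_ \<Rightarrow> nat \<Rightarrow> (real^'n::_) set" where
  "part B u i = {x + t *\<^sub>R u |x t. x \<in> piece i \<and> 0 < u \<bullet> normal0 x \<and> flies D x u t \<and> x + t *\<^sub>R u \<in> B}"

text \<open>The flight time occupies the last coordinate, which the chart parameter leaves free;
  parameter and time together range over \<open>real^'n\<close>, where the d-dimensional change of
  variables applies.\<close>

definition sweep :: "nat \<Rightarrow> real^'n::_ \<Rightarrow> real^'n::_ \<Rightarrow> real^'n::_" where
  "sweep i u w = \<phi> i (drop_coord last_index w) + (w $ last_index) *\<^sub>R u"

lemma sweep_derivative:
  assumes w: "w \<in> W" and W: "\<And>w. w \<in> W \<Longrightarrow> drop_coord last_index w \<in> U i"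
  shows "(sweep i u has_derivative side_map (\<phi>' i (drop_coord last_index w)) u) (at w within W)"
proof -
  interpret C: c1_chart "U i" "\<phi> i" "\<phi>' i" "\<psi> i" by (rule chart)
  have 1: "(drop_coord last_index has_derivative drop_coord last_index) (at w within W)"
    using bounded_linear_drop_coord by (rule bounded_linear_imp_has_derivative)
  have "(\<phi> i has_derivative \<phi>' i (drop_coord last_index w)) (at (drop_coord last_index w) within drop_coord last_index ` W)"
    using C.der[OF W[OF w]] W by (blast intro: has_derivative_subset)
  from diff_chain_within[OF 1 this]
  have 2: "((\<lambda>w. \<phi> i (drop_coord last_index w)) has_derivative (\<lambda>h. \<phi>' i (drop_coord last_index w) (drop_coord last_index h))) (at w within W)"
    by (simp add: o_def)
  have 3: "((\<lambda>w. (w $ last_index) *\<^sub>R u) has_derivative (\<lambda>h. (h $ last_index) *\<^sub>R u)) (at w within W)"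
    by (intro bounded_linear_imp_has_derivative bounded_linear_scaleR_left[THEN bounded_linear_compose] bounded_linear_vec_nth)
  show ?thesis
    using has_derivative_add[OF 2 3] by (simp add: sweep_def[abs_def] side_map_def[abs_def])
qed

text \<open>Of two flights of different length with the same direction and end point, the longer
  would pass through the start of the shorter, a frontier point and hence outside the open set
  \<open>D\<close>.\<close>

lemma flies_unique:
  assumes x: "x \<in> frontier D" "y \<in> frontier D" and f: "flies D x u s" "flies D y u t"
    and eq: "x + s *\<^sub>R u = y + t *\<^sub>R u"
  shows "x = y \<and> s = t"
proof -
  have False if "x \<in> frontier D" "flies D y u t" "x + s *\<^sub>R u = y + t *\<^sub>R u" "s < t" "0 < s" for x y s t
  proof -
    have "x = y + (t - s) *\<^sub>R u" using that(3) by (simp add: algebra_simps)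
    moreover have "y + (t - s) *\<^sub>R u \<in> D" using that by (auto simp: flies_def)
    ultimately show False using frontier_disjoint[OF that(1)] by simp
  qed
  from this[OF x(1) f(2) eq] this[OF x(2) f(1) eq[symmetric]] f
  have "s = t" by (cases s t rule: linorder_cases) (auto simp: flies_def)
  then show ?thesis using eq by simp
qed

text \<open>The sweep is injective on \<open>W\<close> because flights have a unique start, and its
  Jacobian is \<open>C.jac\<close> times the cosine. \<open>W\<close> is Borel, while its
  differentiable image \<open>part B u i\<close> is only shown to be Lebesgue measurable.\<close>

lemma chart_part:
  assumes B [measurable]: "B \<in> sets borel" and BD: "B \<subseteq> D"
  shows "part B u i \<in> sets lebesgue"
    and "(\<integral>\<^sup>+x. ennreal (u \<bullet> normal0 x) * path_time D B x u * indicator (piece i) x \<partial>surface_measure) = emeasure lebesgue (part B u i)"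
proof -
  interpret C: c1_chart "U i" "\<phi> i" "\<phi>' i" "\<psi> i" by (rule chart)
  let ?d = "drop_coord last_index :: real^'n::_ \<Rightarrow> real^'n::_"
  let ?L = "\<lambda>w. side_map (\<phi>' i (?d w)) u"
  note fm [measurable] = flies_measurable[OF D_open] and pm [measurable] = path_time_measurable[OF D_open B]
  have inv: "\<psi> i (\<phi> i z) = z" if "z \<in> U i" for z
    using C.hom that by (rule homeomorphism_apply1)
  define W where "W = {w. ?d w \<in> U i \<and> C.phi0 (?d w) \<in> piece i \<and> 0 < u \<bullet> normal0 (C.phi0 (?d w)) \<and>
      flies D (C.phi0 (?d w)) u (w $ last_index) \<and> C.phi0 (?d w) + (w $ last_index) *\<^sub>R u \<in> B}"
  have Wb [measurable]: "W \<in> sets borel" unfolding W_def by measurable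
  have WU: "?d w \<in> U i" if "w \<in> W" for w using that by (simp add: W_def)
  have Wd: "\<phi> i (?d w) \<in> piece i" "0 < u \<bullet> normal0 (\<phi> i (?d w))" "flies D (\<phi> i (?d w)) u (w $ last_index)"
    "sweep i u w \<in> B" if "w \<in> W" for w
    using that C.phi0_eq[OF WU[OF that]] by (auto simp: W_def sweep_def)
  have der: "(sweep i u has_derivative ?L w) (at w within W)" if "w \<in> W" for w
    using that WU by (rule sweep_derivative)
  have inj: "inj_on (sweep i u) W"
  proof (rule inj_onI)
    fix w w' assume w: "w \<in> W" "w' \<in> W" and eq: "sweep i u w = sweep i u w'"
    have "\<phi> i (?d w) \<in> frontier D" "\<phi> i (?d w') \<in> frontier D"
      using Wd(1)[OF w(1)] Wd(1)[OF w(2)] piece_subset R_frontier by blast+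
    from flies_unique[OF this Wd(3)[OF w(1)] Wd(3)[OF w(2)] eq[unfolded sweep_def]]
    have 1: "\<phi> i (?d w) = \<phi> i (?d w')" "w $ last_index = w' $ last_index" by auto
    then have "?d w = ?d w'" using C.inj_phi WU[OF w(1)] WU[OF w(2)] by (auto dest: inj_onD)
    then show "w = w'" using 1(2) drop_coord_decomp[of last_index w] drop_coord_decomp[of last_index w'] by metis
  qed
  have im: "sweep i u ` W = part B u i"
  proof (intro equalityI subsetI)
    fix y assume "y \<in> sweep i u ` W"
    then obtain w where w: "w \<in> W" "y = sweep i u w" by blast
    then show "y \<in> part B u i"
      using Wd[OF w(1)] unfolding part_def sweep_def by blast
  next
    fix y assume "y \<in> part B u i"
    then obtain x t where x: "y = x + t *\<^sub>R u" "x \<in> piece i" "0 < u \<bullet> normal0 x" "flies D x u t" "x + t *\<^sub>R u \<in> B"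
      unfolding part_def by blast
    obtain z where z: "z \<in> U i" "x = \<phi> i z" using x(2) piece_subset by blast
    have zb: "z \<in> base_space" using z C.U_base by blast
    let ?w = "z + t *\<^sub>R axis last_index 1"
    have w: "?d ?w = z" "?w $ last_index = t"
      using zb by (simp_all add: drop_coord_add_axis drop_coord_base) (simp add: mem_base_space)
    have "?w \<in> W" unfolding W_def mem_Collect_eq w using z x C.phi0_eq[OF z(1)] by simp
    moreover have "sweep i u ?w = y" using x z by (simp only: sweep_def w)
    ultimately show "y \<in> sweep i u ` W" by (metis imageI)
  qed
  have Wl: "W \<in> sets lebesgue" by simp
  show partl: "part B u i \<in> sets lebesgue"
    unfolding im[symmetric]
  proof (rule differentiable_image_in_sets_lebesgue[OF Wl])
    show "sweep i u differentiable_on W"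
      using der by (auto simp: differentiable_on_def differentiable_def)
  qed simp
  \<comment> \<open>Boundedness of \<open>D\<close> gives the image finite volume, and this in turn
    yields integrability of the determinant over \<open>W\<close>, which itself may be
    unbounded.\<close>
  have "part B u i \<subseteq> B" by (auto simp: part_def)
  then have "bounded (part B u i)" using BD D_bounded bounded_subset by blast
  then have pm2: "part B u i \<in> lmeasurable"
    using partl by (intro bounded_set_imp_lmeasurable)
  then have int: "(\<lambda>w. \<bar>det (matrix (?L w))\<bar>) integrable_on W"
    using measurable_differentiable_image_eq[OF Wl der inj] im by simp
  have "measure lebesgue (part B u i) = integral W (\<lambda>w. \<bar>det (matrix (?L w))\<bar>)"
    using measure_differentiable_image_eq[OF Wl der inj int] im by simp
  then have hi: "((\<lambda>w. \<bar>det (matrix (?L w))\<bar>) has_integral measure lebesgue (part B u i)) W"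
    using int by (simp add: has_integral_integral)
  have "(\<integral>\<^sup>+w. ennreal (indicator W w * \<bar>det (matrix (?L w))\<bar>) \<partial>lborel) = ennreal (measure lebesgue (part B u i))"
    by (rule nn_integral_has_integral_lebesgue[OF _ hi]) simp
  also have "\<dots> = emeasure lebesgue (part B u i)"
    using fmeasurableD2[OF pm2] by (rule emeasure_eq_ennreal_measure[symmetric])
  finally have vol: "(\<integral>\<^sup>+w. ennreal (indicator W w * \<bar>det (matrix (?L w))\<bar>) \<partial>lborel) = emeasure lebesgue (part B u i)" .
  \<comment> \<open>As \<open>ennreal\<close> sends negative reals to 0,
    \<open>ennreal (u \<bullet> normal0 x)\<close> is the positive part of the cosine, which matches
    the condition \<open>0 < u \<bullet> normal0 x\<close> in \<open>W\<close>.\<close>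
  let ?f = "\<lambda>z t. ennreal (C.jac z) * (ennreal (u \<bullet> normal0 (C.phi0 z)) * (indicator (piece i) (C.phi0 z) *
      (indicator {t. flies D (C.phi0 z) u t} t * indicator B (C.phi0 z + t *\<^sub>R u))))"
  have pw: "?f (?d w) (w $ last_index) = ennreal (indicator W w * \<bar>det (matrix (?L w))\<bar>)" for w
  proof (cases "w \<in> W")
    case True
    let ?z = "?d w"
    have zU: "?z \<in> U i" by (rule WU[OF True])
    have xR: "\<phi> i ?z \<in> R" using Wd(1)[OF True] piece_subset by blast
    have "\<bar>side_det (\<phi>' i ?z) u\<bar> = norm (cross_normal (\<phi>' i ?z)) * \<bar>u \<bullet> normal0 (\<phi> i ?z)\<bar>"
      by (intro abs_side_det_eq C.linear_der[OF zU] C.inj_der[OF zU] normal0_unit[OF xR] normal0_orthogonal[OF zU xR])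
    also have "\<dots> = C.jac ?z * (u \<bullet> normal0 (\<phi> i ?z))"
      using Wd(2)[OF True] zU by (simp add: C.jac_def)
    finally have det: "\<bar>det (matrix (?L w))\<bar> = C.jac ?z * (u \<bullet> normal0 (\<phi> i ?z))"
      by (simp add: side_det_def)
    have "?f ?z (w $ last_index) = ennreal (C.jac ?z) * ennreal (u \<bullet> normal0 (\<phi> i ?z))"
      using Wd[OF True] by (simp add: C.phi0_eq[OF zU] sweep_def)
    also have "\<dots> = ennreal \<bar>det (matrix (?L w))\<bar>"
      unfolding det using Wd(2)[OF True] by (intro ennreal_mult[symmetric]) auto
    finally show ?thesis using True by simp
  next
    case False
    then consider "?d w \<notin> U i" | "C.phi0 (?d w) \<notin> piece i" | "u \<bullet> normal0 (C.phi0 (?d w)) \<le> 0"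
      | "\<not> flies D (C.phi0 (?d w)) u (w $ last_index)" | "C.phi0 (?d w) + (w $ last_index) *\<^sub>R u \<notin> B"
      unfolding W_def by force
    then have "?f (?d w) (w $ last_index) = 0"
      by cases (simp_all add: C.jac_def ennreal_neg)
    then show ?thesis using False by simp
  qed
  let ?h = "\<lambda>x. ennreal (u \<bullet> normal0 x) * path_time D B x u * indicator (piece i) x"
  have "(\<integral>\<^sup>+x. ?h x \<partial>surface_measure) = (\<integral>\<^sup>+z. ennreal (C.jac z) * ?h (C.phi0 z) \<partial>hyper last_index)"
    by (rule nn_integral_piece) measurable
  also have "\<dots> = (\<integral>\<^sup>+z. \<integral>\<^sup>+t. ?f z t \<partial>lborel \<partial>hyper last_index)"
  proof (rule nn_integral_cong)
    fix z
    have [measurable]: "(\<lambda>t. indicator {t. flies D (C.phi0 z) u t} t * indicator B (C.phi0 z + t *\<^sub>R u) :: ennreal) \<in> borel_measurable lborel"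
      unfolding indicator_def mem_Collect_eq by measurable
    have "(\<integral>\<^sup>+t. ?f z t \<partial>lborel) = ennreal (C.jac z) *
        (ennreal (u \<bullet> normal0 (C.phi0 z)) * (indicator (piece i) (C.phi0 z) * path_time D B (C.phi0 z) u))"
      by (simp add: nn_integral_cmult path_time_def)
    then show "ennreal (C.jac z) * ?h (C.phi0 z) = (\<integral>\<^sup>+t. ?f z t \<partial>lborel)"
      by (simp only: mult.assoc mult.commute[of "path_time D B (C.phi0 z) u"])
  qed
  \<comment> \<open>On the base space \<open>z\<close> and \<open>t\<close> are the projection and
    the last coordinate of one vector; in this form Fubini along the last axis applies.\<close>
  also have "\<dots> = (\<integral>\<^sup>+z. \<integral>\<^sup>+t. ?f (?d (z + t *\<^sub>R axis last_index 1)) ((z + t *\<^sub>R axis last_index 1) $ last_index) \<partial>lborel \<partial>hyper last_index)"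
    using AE_hyper[of "last_index :: 'n"]
    by (intro nn_integral_cong_AE) (auto elim!: eventually_mono simp: drop_coord_add_axis drop_coord_id)
  also have "\<dots> = (\<integral>\<^sup>+w. ?f (?d w) (w $ last_index) \<partial>lborel)"
    by (rule nn_integral_lborel_hyper[symmetric]) (unfold indicator_def mem_Collect_eq, measurable)
  also have "\<dots> = emeasure lebesgue (part B u i)"
    unfolding pw vol ..
  finally show "(\<integral>\<^sup>+x. ?h x \<partial>surface_measure) = emeasure lebesgue (part B u i)" .
qed

text \<open>Flights from irregular boundary points cover a null set since \<open>frontier D - R\<close> is null for the
  Hausdorff measure, and tangential flights cover a null set by Sard's lemma.\<close>

lemma fixed_direction:
  assumes B [measurable]: "B \<in> sets borel" and BD: "B \<subseteq> D" and u: "norm u = 1"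
  shows "(\<integral>\<^sup>+x. ennreal (u \<bullet> normal0 x) * path_time D B x u * indicator R x \<partial>surface_measure) = emeasure lebesgue B"
proof -
  note pm [measurable] = path_time_measurable[OF D_open B]
  have "(\<integral>\<^sup>+x. ennreal (u \<bullet> normal0 x) * path_time D B x u * indicator (\<Union>i. piece i) x \<partial>surface_measure)
     = (\<Sum>i. \<integral>\<^sup>+x. ennreal (u \<bullet> normal0 x) * path_time D B x u * indicator (piece i) x \<partial>surface_measure)"
    by (rule nn_integral_disjoint_family[OF _ _ disjoint_pieces]) measurable
  also have "\<dots> = (\<Sum>i. emeasure lebesgue (part B u i))"
    by (simp only: chart_part(2)[OF B BD])
  also have "\<dots> = emeasure lebesgue (\<Union>i. part B u i)"
  proof (rule suminf_emeasure)
    show "range (part B u) \<subseteq> sets lebesgue" using chart_part(1)[OF B BD] by blast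
    show "disjoint_family (part B u)"
      unfolding disjoint_family_on_def
    proof (intro ballI impI)
      fix i j :: nat assume ij: "i \<noteq> j"
      show "part B u i \<inter> part B u j = {}"
      proof (rule ccontr)
        assume "part B u i \<inter> part B u j \<noteq> {}"
        then obtain x s y t where *: "x \<in> piece i" "y \<in> piece j" "flies D x u s" "flies D y u t" "x + s *\<^sub>R u = y + t *\<^sub>R u"
          unfolding part_def by blast
        have "x \<in> frontier D" "y \<in> frontier D" using *(1,2) piece_subset R_frontier by blast+
        then have "x = y" using flies_unique *(3-5) by blast
        then show False using *(1,2) disjoint_pieces ij by (auto simp: disjoint_family_on_def)
      qed
    qed
  qed
  also have "\<dots> = emeasure lebesgue B"
  proof (rule emeasure_eq_AE)
    let ?Z = "{x + t *\<^sub>R u |x t. x \<in> frontier D - R}"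
    \<comment> \<open>The critical parameters of the sweep: its Jacobian vanishes exactly where
      \<open>u\<close> is tangential to the chart.\<close>
    let ?S = "\<lambda>i. {w. drop_coord last_index w \<in> U i \<and> side_det (\<phi>' i (drop_coord last_index w)) u = 0}"
    have FR: "frontier D - R \<in> sets borel" by (intro sets.Diff R_borel) auto
    have nZ: "negligible ?Z"
      using R_full u by (intro negligible_lines) (simp_all add: surface_measure_eq_hausdorff[OF FR])
    have nS: "negligible (sweep i u ` ?S i)" for i
    proof (rule baby_Sard)
      fix w assume w: "w \<in> ?S i"
      show "(sweep i u has_derivative side_map (\<phi>' i (drop_coord last_index w)) u) (at w within ?S i)"
        using w by (rule sweep_derivative) simp
      have "linear (\<phi>' i (drop_coord last_index w))"
        using w c1_chart.linear_der[OF chart] by blast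
      then have "\<not> inj (side_map (\<phi>' i (drop_coord last_index w)) u)"
        using w det_nz_iff_inj[OF linear_side_map] by (auto simp: side_det_def)
      moreover have "(*v) (matrix (side_map (\<phi>' i (drop_coord last_index w)) u)) = side_map (\<phi>' i (drop_coord last_index w)) u"
        using matrix_works[OF linear_side_map[OF \<open>linear (\<phi>' i (drop_coord last_index w))\<close>,
            unfolded linear_matrix_vector_mul_eq[symmetric]]] by (simp add: fun_eq_iff)
      ultimately show "rank (matrix (side_map (\<phi>' i (drop_coord last_index w)) u)) < CARD('n)"
        by (simp add: less_rank_noninjective)
    qed simp
    have "negligible (?Z \<union> (\<Union>i. sweep i u ` ?S i))"
      using nZ nS by (intro negligible_Un negligible_countable_Union) auto
    then have null: "?Z \<union> (\<Union>i. sweep i u ` ?S i) \<in> null_sets lebesgue"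
      by (simp add: negligible_iff_null_sets)
    have sub: "B - (\<Union>i. part B u i) \<subseteq> ?Z \<union> (\<Union>i. sweep i u ` ?S i)"
    proof
      fix y assume y: "y \<in> B - (\<Union>i. part B u i)"
      then have yD: "y \<in> D" using BD by blast
      obtain r where r: "\<And>x. x \<in> D \<Longrightarrow> norm x \<le> r" using D_bounded by (auto simp: bounded_iff)
      \<comment> \<open>Times at which the backward ray is outside \<open>D\<close>. The infimum
        exists because \<open>D\<close> is bounded and is attained because \<open>D\<close> is
        open.\<close>
      let ?T = "{t. 0 \<le> t \<and> y - t *\<^sub>R u \<notin> D}"
      have Tcl: "closed ?T"
      proof -
        have "closed ((\<lambda>t. y - t *\<^sub>R u) -` (- D))"
          using D_open by (intro closed_vimage continuous_intros) auto
        moreover have "?T = {0..} \<inter> (\<lambda>t. y - t *\<^sub>R u) -` (- D)" by auto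
        ultimately show ?thesis by auto
      qed
      have "norm y + r + 1 \<in> ?T"
      proof -
        have rn: "0 \<le> r" using r[OF yD] norm_ge_zero[of y] by linarith
        have "norm (y - (norm y + r + 1) *\<^sub>R u) \<ge> norm ((norm y + r + 1) *\<^sub>R u) - norm y"
          by (metis norm_minus_commute norm_triangle_ineq2)
        then have "norm (y - (norm y + r + 1) *\<^sub>R u) > r" using u rn by simp
        then show ?thesis using r[of "y - (norm y + r + 1) *\<^sub>R u"] rn by (simp add: not_le[symmetric]) force
      qed
      then have Tne: "?T \<noteq> {}" by blast
      have Tbd: "bdd_below ?T" by (rule bdd_belowI[of _ 0]) simp
      define t0 where "t0 = Inf ?T"
      have t0: "t0 \<in> ?T" unfolding t0_def by (rule closed_contains_Inf[OF Tne Tbd Tcl])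
      have t0pos: "t0 > 0"
      proof (rule ccontr)
        assume "\<not> t0 > 0"
        then have "t0 = 0" using t0 by simp
        then show False using t0 yD by simp
      qed
      have before: "y - t *\<^sub>R u \<in> D" if "0 \<le> t" "t < t0" for t
      proof (rule ccontr)
        assume "y - t *\<^sub>R u \<notin> D"
        then have "t0 \<le> t" unfolding t0_def using that(1) by (intro cInf_lower Tbd) auto
        then show False using that by simp
      qed
      let ?x = "y - t0 *\<^sub>R u"
      have fl: "flies D ?x u t0"
        unfolding flies_def
      proof (intro conjI ballI t0pos)
        fix s assume s: "s \<in> {0<..t0}"
        have eq: "?x + s *\<^sub>R u = y - (t0 - s) *\<^sub>R u" by (simp add: algebra_simps)
        show "?x + s *\<^sub>R u \<in> D" unfolding eq by (rule before) (use s in auto)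
      qed
      have "?x \<in> closure D"
      proof -
        have lim: "((\<lambda>s. ?x + s *\<^sub>R u) \<longlongrightarrow> ?x + 0 *\<^sub>R u) (at_right 0)"
          by (intro tendsto_intros)
        have ev: "\<forall>\<^sub>F s in at_right 0. ?x + s *\<^sub>R u \<in> closure D"
          using eventually_at_right_real[OF t0pos]
        proof (rule eventually_mono)
          fix s assume "s \<in> {0<..<t0}"
          then have "?x + s *\<^sub>R u \<in> D" using fl by (simp add: flies_def)
          then show "?x + s *\<^sub>R u \<in> closure D" using closure_subset by blast
        qed
        have "?x + 0 *\<^sub>R u \<in> closure D"
          by (rule Lim_in_closed_set[OF closed_closure ev trivial_limit_at_right_real lim])
        then show ?thesis by simp
      qed
      then have xF: "?x \<in> frontier D"
        using t0 D_open by (simp add: frontier_def interior_open)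
      have yx: "y = ?x + t0 *\<^sub>R u" by simp
      show "y \<in> ?Z \<union> (\<Union>i. sweep i u ` ?S i)"
      proof (cases "?x \<in> R")
        case False
        then show ?thesis using xF yx by blast
      next
        case True
        then obtain i where i: "?x \<in> piece i" using Union_pieces by blast
        then obtain z where z: "z \<in> U i" "?x = \<phi> i z" using piece_subset by blast
        interpret C: c1_chart "U i" "\<phi> i" "\<phi>' i" "\<psi> i" by (rule chart)
        \<comment> \<open>A start with positive normal component would put \<open>y\<close> into
          \<open>part B u i\<close>, and a negative one contradicts one-sidedness; only a tangential
          start remains.\<close>
        have "\<not> 0 < u \<bullet> normal0 ?x"
        proof
          assume pos: "0 < u \<bullet> normal0 ?x"
          have "?x + t0 *\<^sub>R u \<in> B" using y by simp
          then have "y \<in> part B u i"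
            unfolding part_def mem_Collect_eq using yx i pos fl by blast
          then show False using y by blast
        qed
        moreover have "\<not> u \<bullet> normal0 ?x < 0"
        proof
          assume "u \<bullet> normal0 ?x < 0"
          then have "\<forall>\<^sub>F t in at_right 0. ?x + t *\<^sub>R u \<notin> D" by (rule one_sided[OF True])
          moreover have "\<forall>\<^sub>F t in at_right 0. ?x + t *\<^sub>R u \<in> D"
            using eventually_at_right_real[OF t0pos]
            by (rule eventually_mono) (use fl in \<open>auto simp: flies_def\<close>)
          ultimately have "\<forall>\<^sub>F t in at_right (0::real). False"
            by eventually_elim blast
          then show False by simp
        qed
        ultimately have "u \<bullet> normal0 (\<phi> i z) = 0" using z by simp
        moreover have "\<phi> i z \<in> R" using True z by simp
        ultimately have sd: "side_det (\<phi>' i z) u = 0"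
          using abs_side_det_eq[OF C.linear_der[OF z(1)] C.inj_der[OF z(1)] normal0_unit normal0_orthogonal[OF z(1)], of u] by simp
        have zb: "z \<in> base_space" using z C.U_base by blast
        let ?w = "z + t0 *\<^sub>R axis last_index 1"
        have w: "drop_coord last_index ?w = z" "?w $ last_index = t0"
          using zb by (simp_all add: drop_coord_add_axis drop_coord_base) (simp add: mem_base_space)
        have "?w \<in> ?S i" unfolding mem_Collect_eq w using z sd by simp
        moreover have "sweep i u ?w = y" unfolding sweep_def w using z yx by simp
        ultimately show ?thesis by (metis (no_types, lifting) UN_I UNIV_I UnI2 imageI)
      qed
    qed
    have "AE y in lebesgue. y \<notin> ?Z \<union> (\<Union>i. sweep i u ` ?S i)"
      using null by (rule AE_not_in)
    then show "AE y in lebesgue. y \<in> (\<Union>i. part B u i) \<longleftrightarrow> y \<in> B"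
    proof (rule eventually_mono)
      fix y assume y: "y \<notin> ?Z \<union> (\<Union>i. sweep i u ` ?S i)"
      have "part B u i \<subseteq> B" for i by (auto simp: part_def)
      then have "(\<Union>i. part B u i) \<subseteq> B" by (rule UN_least)
      moreover have "y \<notin> B - (\<Union>i. part B u i)" using y subsetD[OF sub] by (rule contrapos_nn)
      ultimately show "y \<in> (\<Union>i. part B u i) \<longleftrightarrow> y \<in> B"
        unfolding Diff_iff by (meson subsetD)
    qed
    show "(\<Union>i. part B u i) \<in> sets lebesgue"
      using chart_part(1)[OF B BD] by (intro sets.countable_UN) auto
    show "B \<in> sets lebesgue" by simp
  qed
  finally show ?thesis by (simp only: Union_pieces)
qed

end


section \<open>Averaging over directions\<close>

text \<open>A finite measure, in contrast to \<open>surface_measure\<close>, so that integrals over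
  directions can be exchanged. It does not depend on the starting point; the cosine is kept in the
  integrand.\<close>

definition sphere_law :: "(real^'n) measure" where
  "sphere_law = density surface_measure (indicator (sphere 0 1))"

lemma sets_sphere_law [simp, measurable_cong]: "sets sphere_law = sets borel"
  by (simp add: sphere_law_def)

lemma sphere_borel [measurable]: "sphere (0 :: real^'n) 1 \<in> sets borel"
  by simp

lemma nn_integral_sphere_law:
  assumes [measurable]: "f \<in> borel_measurable borel"
  shows "(\<integral>\<^sup>+u. f u \<partial>sphere_law) = (\<integral>\<^sup>+u. indicator (sphere 0 1) u * f u \<partial>surface_measure)"
  unfolding sphere_law_def by (rule nn_integral_density) measurable

lemma emeasure_sphere_law:
  "emeasure sphere_law (space (sphere_law :: (real^'n) measure)) = emeasure surface_measure (sphere (0 :: real^'n) 1)"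
proof -
  have "emeasure sphere_law (UNIV :: (real^'n) set) = (\<integral>\<^sup>+u. indicator (sphere 0 1) u * indicator (UNIV :: (real^'n) set) u \<partial>surface_measure)"
    unfolding sphere_law_def by (rule emeasure_density) measurable
  also have "\<dots> = emeasure surface_measure (sphere (0 :: real^'n) 1)"
    by simp
  finally show ?thesis by (simp add: sphere_law_def)
qed

lemma sigma_finite_sphere_law: "sigma_finite_measure (sphere_law :: (real^'n::{finite,wellorder}) measure)"
proof -
  have "finite_measure (sphere_law :: (real^'n::_) measure)"
    by (rule finite_measureI) (unfold emeasure_sphere_law surface_sphere, simp)
  then show ?thesis by (rule finite_measure.axioms)
qed

lemma AE_sphere_law: "AE u in (sphere_law :: (real^'n) measure). norm u = 1"
  unfolding sphere_law_def by (subst AE_density) (auto intro!: AE_I2 simp: indicator_def)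

section \<open>Time spent before the next hit\<close>

lemma segment_meets_frontier:
  fixes x u :: "'a::real_normed_vector" and a b :: real
  assumes "a \<le> b" "x + a *\<^sub>R u \<in> D \<longleftrightarrow> x + b *\<^sub>R u \<notin> D"
  obtains s where "a \<le> s" "s \<le> b" "x + s *\<^sub>R u \<in> frontier D"
proof -
  let ?S = "(\<lambda>s. x + s *\<^sub>R u) ` {a..b}"
  have "connected ?S"
    by (intro connected_continuous_image continuous_intros) auto
  moreover have "x + a *\<^sub>R u \<in> ?S" "x + b *\<^sub>R u \<in> ?S"
    using assms(1) by auto
  then have "?S \<inter> D \<noteq> {}" "?S - D \<noteq> {}"
    using assms(2) by blast+
  ultimately have "?S \<inter> frontier D \<noteq> {}" by (rule connected_Int_frontier)
  then show ?thesis using that by auto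
qed

text \<open>Default values do no harm. If \<open>?T\<close> is empty, \<open>Inf\<close> is
  unspecified; if \<open>hit_time\<close> is 0, then \<open>next_hit\<close> is \<open>x\<close> and
  \<open>unit_dir\<close> is the zero vector. In either case no flight through \<open>D\<close>
  exists and both sides vanish.\<close>

lemma hit_time_path_time:
  fixes D :: "(real^'n) set"
  assumes D: "open D" "bounded D" and x: "x \<in> frontier D" and u: "norm u = 1" and A: "A \<subseteq> D"
  shows "(\<integral>\<^sup>+t\<in>{0..hit_time D x u}. indicator A (x + t *\<^sub>R unit_dir x (next_hit D x u)) \<partial>lborel) = path_time D A x u"
proof -
  let ?\<tau> = "hit_time D x u" and ?T = "{t. t > 0 \<and> x + t *\<^sub>R u \<in> frontier D}"
  have FD: "y \<notin> D" if "y \<in> frontier D" for y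
    using that D(1) by (simp add: frontier_def interior_open)
  have Tbd: "bdd_below ?T" by (rule bdd_belowI[of _ 0]) simp
  \<comment> \<open>Boundedness forces the ray to leave \<open>D\<close> again, so the existence of
    a flight guarantees that \<open>?T\<close> is nonempty.\<close>
  have late: "t \<le> ?\<tau>" if fl: "flies D x u t" for t
  proof -
    have t: "t > 0" "x + t *\<^sub>R u \<in> D" using fl by (auto simp: flies_def)
    obtain r where r: "\<And>y. y \<in> D \<Longrightarrow> norm y \<le> r" using D(2) by (auto simp: bounded_iff)
    let ?b = "max t (norm x + r + 1)"
    have "x + ?b *\<^sub>R u \<notin> D"
    proof
      assume "x + ?b *\<^sub>R u \<in> D"
      then have "norm (x + ?b *\<^sub>R u) \<le> r" by (rule r)
      moreover have "norm (?b *\<^sub>R u) \<le> norm (x + ?b *\<^sub>R u) + norm x"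
        using norm_triangle_ineq4[of "x + ?b *\<^sub>R u" x] by simp
      moreover have "norm (?b *\<^sub>R u) \<ge> norm x + r + 1" using u by simp
      ultimately show False by linarith
    qed
    then have "t \<le> ?b" "x + t *\<^sub>R u \<in> D \<longleftrightarrow> x + ?b *\<^sub>R u \<notin> D" using t by auto
    then obtain s where "t \<le> s" "s \<le> ?b" "x + s *\<^sub>R u \<in> frontier D" by (rule segment_meets_frontier)
    then have "s \<in> ?T" using t by simp
    then have "?T \<noteq> {}" by blast
    then show ?thesis
      unfolding hit_time_def
    proof (rule cInf_greatest)
      fix s assume "s \<in> ?T"
      then have s: "s > 0" "x + s *\<^sub>R u \<notin> D" using FD by auto
      then show "t \<le> s" using fl unfolding flies_def by force
    qed
  qed
  have early: "flies D x u t" if t: "0 < t" "t \<le> ?\<tau>" "x + t *\<^sub>R u \<in> D" for t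
    unfolding flies_def
  proof (intro conjI ballI t(1))
    fix s assume s: "s \<in> {0<..t}"
    show "x + s *\<^sub>R u \<in> D"
    proof (rule ccontr)
      assume "x + s *\<^sub>R u \<notin> D"
      then have "s \<le> t" "x + s *\<^sub>R u \<in> D \<longleftrightarrow> x + t *\<^sub>R u \<notin> D" using s t by auto
      then obtain s' where s': "s \<le> s'" "s' \<le> t" "x + s' *\<^sub>R u \<in> frontier D" by (rule segment_meets_frontier)
      then have "s' \<in> ?T" using s by auto
      then have "?\<tau> \<le> s'" unfolding hit_time_def using Tbd by (rule cInf_lower)
      then have "s' = t" using s' t by linarith
      then show False using s'(3) t(3) FD by blast
    qed
  qed
  have dir: "unit_dir x (next_hit D x u) = u" if "?\<tau> > 0"
    using that u by (simp add: unit_dir_def next_hit_def)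
  show ?thesis
    unfolding path_time_def
  proof (rule nn_integral_cong)
    fix t
    show "indicator A (x + t *\<^sub>R unit_dir x (next_hit D x u)) * indicator {0..?\<tau>} t
       = (indicator {t. flies D x u t} t * indicator A (x + t *\<^sub>R u) :: ennreal)"
    proof (cases "?\<tau> > 0")
      case True
      have "x + t *\<^sub>R u \<in> A \<and> t \<in> {0..?\<tau>} \<longleftrightarrow> flies D x u t \<and> x + t *\<^sub>R u \<in> A"
      proof
        assume a: "x + t *\<^sub>R u \<in> A \<and> t \<in> {0..?\<tau>}"
        then have "x + t *\<^sub>R u \<in> D" using A by blast
        moreover have "t \<noteq> 0" using a A FD[OF x] by auto
        ultimately show "flies D x u t \<and> x + t *\<^sub>R u \<in> A" using a early[of t] by auto
      next
        assume "flies D x u t \<and> x + t *\<^sub>R u \<in> A"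
        then show "x + t *\<^sub>R u \<in> A \<and> t \<in> {0..?\<tau>}" using late[of t] by (auto simp: flies_def)
      qed
      then show ?thesis unfolding dir[OF True] by (auto simp: indicator_def)
    next
      case False
      then have "\<not> flies D x u t" using late[of t] by (auto simp: flies_def)
      moreover have "indicator A (x + t *\<^sub>R unit_dir x (next_hit D x u)) * indicator {0..?\<tau>} t = (0::ennreal)"
      proof (cases "t \<in> {0..?\<tau>}")
        case True
        then have "t = 0" using False by auto
        then show ?thesis using A FD[OF x] by (auto simp: indicator_def)
      qed simp
      ultimately show ?thesis by simp
    qed
  qed
qed

section \<open>Integration over all directions, and the mean time\<close>

context knudsen_charts
begin

text \<open>The chart formula carries the piece to \<open>hyper\<close>, where Fubini with
  \<open>sphere_law\<close> is available, and is then applied backwards for each fixed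
  \<open>u\<close>.\<close>

lemma swap_on_piece:
  fixes f :: "real^'n::_ \<Rightarrow> real^'n::_ \<Rightarrow> ennreal"
  assumes f: "(\<lambda>(x, u). f x u) \<in> borel_measurable (borel \<Otimes>\<^sub>M borel)"
  shows "(\<integral>\<^sup>+x. (\<integral>\<^sup>+u. f x u \<partial>sphere_law) * indicator (piece i) x \<partial>surface_measure) =
    (\<integral>\<^sup>+u. \<integral>\<^sup>+x. f x u * indicator (piece i) x \<partial>surface_measure \<partial>sphere_law)"
proof -
  interpret C: c1_chart "U i" "\<phi> i" "\<phi>' i" "\<psi> i" by (rule chart)
  interpret S: sigma_finite_measure "sphere_law :: (real^'n::_) measure" by (rule sigma_finite_sphere_law)
  interpret P: pair_sigma_finite "hyper last_index :: (real^'n::_) measure" "sphere_law :: (real^'n::_) measure" ..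
  note f' [measurable] = f[unfolded split_beta']
  have meas2 [measurable]: "(\<lambda>x. f (a x) (b x)) \<in> borel_measurable M" if [measurable]: "a \<in> M \<rightarrow>\<^sub>M borel" "b \<in> M \<rightarrow>\<^sub>M borel" for a b M
    using measurable_compose[OF measurable_Pair[OF that] f] by simp
  have [measurable]: "(\<lambda>x. \<integral>\<^sup>+u. f x u \<partial>sphere_law) \<in> borel_measurable borel"
  proof (rule S.borel_measurable_nn_integral)
    show "(\<lambda>(x, u). f x u) \<in> borel_measurable (borel \<Otimes>\<^sub>M sphere_law)"
      using f by (simp cong: measurable_cong_sets add: sets_pair_measure_cong[OF refl sets_sphere_law])
  qed
  have "(\<integral>\<^sup>+x. (\<integral>\<^sup>+u. f x u \<partial>sphere_law) * indicator (piece i) x \<partial>surface_measure)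
      = (\<integral>\<^sup>+z. ennreal (C.jac z) * ((\<integral>\<^sup>+u. f (C.phi0 z) u \<partial>sphere_law) * indicator (piece i) (C.phi0 z)) \<partial>hyper last_index)"
    by (rule nn_integral_piece[where i=i]) measurable
  also have "\<dots> = (\<integral>\<^sup>+z. \<integral>\<^sup>+u. ennreal (C.jac z) * (f (C.phi0 z) u * indicator (piece i) (C.phi0 z)) \<partial>sphere_law \<partial>hyper last_index)"
    by (intro nn_integral_cong) (simp add: nn_integral_cmult nn_integral_multc)
  also have "\<dots> = (\<integral>\<^sup>+u. \<integral>\<^sup>+z. ennreal (C.jac z) * (f (C.phi0 z) u * indicator (piece i) (C.phi0 z)) \<partial>hyper last_index \<partial>sphere_law)"
    by (rule P.Fubini'[symmetric]) (unfold split_beta', measurable)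
  also have "\<dots> = (\<integral>\<^sup>+u. \<integral>\<^sup>+x. f x u * indicator (piece i) x \<partial>surface_measure \<partial>sphere_law)"
    by (rule nn_integral_cong, rule nn_integral_piece[where i=i, symmetric]) measurable
  finally show ?thesis .
qed

lemma total_time:
  assumes B: "B \<in> sets borel" and BD: "B \<subseteq> D"
  shows "(\<integral>\<^sup>+x. (\<integral>\<^sup>+u. ennreal (u \<bullet> normal0 x) * path_time D B x u \<partial>sphere_law) * indicator R x \<partial>surface_measure)
    = emeasure lebesgue B * emeasure surface_measure (sphere (0 :: real^'n::_) 1)"
proof -
  interpret S: sigma_finite_measure "sphere_law :: (real^'n::_) measure" by (rule sigma_finite_sphere_law)
  note pm [measurable] = path_time_measurable[OF D_open B]
  let ?f = "\<lambda>x u. ennreal (u \<bullet> normal0 x) * path_time D B x u"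
  have f: "(\<lambda>(x, u). ?f x u) \<in> borel_measurable (borel \<Otimes>\<^sub>M borel)"
    unfolding split_beta' by measurable
  have fS: "(\<lambda>(x, u). ?f x u) \<in> borel_measurable (surface_measure \<Otimes>\<^sub>M sphere_law)"
    using f by (simp cong: measurable_cong_sets add: sets_pair_measure_cong[OF sets_surface_measure sets_sphere_law])
  have K [measurable]: "(\<lambda>x. \<integral>\<^sup>+u. ?f x u \<partial>sphere_law) \<in> borel_measurable surface_measure"
    by (rule S.borel_measurable_nn_integral[OF fS])
  have fi: "(\<lambda>x. ?f x u) \<in> borel_measurable surface_measure" for u by measurable
  have pieces: "(\<integral>\<^sup>+x. h x * indicator R x \<partial>surface_measure) = (\<Sum>i. \<integral>\<^sup>+x. h x * indicator (piece i) x \<partial>surface_measure)"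
    if "h \<in> borel_measurable surface_measure" for h
  proof -
    have "(\<integral>\<^sup>+x. h x * indicator (\<Union>i. piece i) x \<partial>surface_measure) = (\<Sum>i. \<integral>\<^sup>+x. h x * indicator (piece i) x \<partial>surface_measure)"
      by (rule nn_integral_disjoint_family[OF that _ disjoint_pieces]) simp
    then show ?thesis by (simp only: Union_pieces)
  qed
  have "(\<integral>\<^sup>+x. (\<integral>\<^sup>+u. ?f x u \<partial>sphere_law) * indicator R x \<partial>surface_measure)
      = (\<Sum>i. \<integral>\<^sup>+x. (\<integral>\<^sup>+u. ?f x u \<partial>sphere_law) * indicator (piece i) x \<partial>surface_measure)"
    by (rule pieces[OF K])
  also have "\<dots> = (\<Sum>i. \<integral>\<^sup>+u. \<integral>\<^sup>+x. ?f x u * indicator (piece i) x \<partial>surface_measure \<partial>sphere_law)"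
    by (simp only: swap_on_piece[OF f])
  also have "\<dots> = (\<Sum>i. \<integral>\<^sup>+u. emeasure lebesgue (part B u i) \<partial>sphere_law)"
    by (simp only: chart_part(2)[OF B BD])
  also have "\<dots> = (\<integral>\<^sup>+u. (\<Sum>i. emeasure lebesgue (part B u i)) \<partial>sphere_law)"
  proof (rule nn_integral_suminf[symmetric])
    fix i
    interpret C: c1_chart "U i" "\<phi> i" "\<phi>' i" "\<psi> i" by (rule chart)
    have "(\<integral>\<^sup>+x. ?f x u * indicator (piece i) x \<partial>surface_measure)
       = (\<integral>\<^sup>+z. ennreal (C.jac z) * (?f (C.phi0 z) u * indicator (piece i) (C.phi0 z)) \<partial>hyper last_index)" for u
      by (rule nn_integral_piece) measurable
    \<comment> \<open>Measurability of these volumes in \<open>u\<close> is not visible from the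
      definition of \<open>part\<close>; it is read off the integral formula.\<close>
    then have eq: "(\<lambda>u. emeasure lebesgue (part B u i)) = (\<lambda>u. \<integral>\<^sup>+z. ennreal (C.jac z) * (?f (C.phi0 z) u * indicator (piece i) (C.phi0 z)) \<partial>hyper last_index)"
      by (simp only: chart_part(2)[OF B BD])
    show "(\<lambda>u. emeasure lebesgue (part B u i)) \<in> borel_measurable sphere_law"
      unfolding eq by (rule hyper.borel_measurable_nn_integral) (unfold split_beta', measurable)
  qed
  also have "\<dots> = (\<integral>\<^sup>+u. emeasure lebesgue B \<partial>(sphere_law :: (real^'n::_) measure))"
  proof (rule nn_integral_cong_AE)
    have "(\<Sum>i. emeasure lebesgue (part B u i)) = emeasure lebesgue B" if u: "norm u = 1" for u
    proof -
      have "(\<Sum>i. emeasure lebesgue (part B u i)) = (\<integral>\<^sup>+x. ?f x u * indicator R x \<partial>surface_measure)"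
        unfolding pieces[OF fi] by (simp only: chart_part(2)[OF B BD])
      also have "\<dots> = emeasure lebesgue B" by (rule fixed_direction[OF B BD u])
      finally show ?thesis .
    qed
    then show "AE u in sphere_law. (\<Sum>i. emeasure lebesgue (part B u i)) = emeasure lebesgue B"
      by (rule eventually_mono[OF AE_sphere_law])
  qed
  also have "\<dots> = emeasure lebesgue B * emeasure surface_measure (sphere (0 :: real^'n::_) 1)"
    by (simp only: nn_integral_const emeasure_sphere_law)
  finally show ?thesis .
qed

lemma direction_law_integral:
  assumes B: "B \<in> sets borel" and BD: "B \<subseteq> D" and x: "x \<in> R"
  shows "(\<integral>\<^sup>+u. (\<integral>\<^sup>+t\<in>{0..hit_time D x u}. indicator B (x + t *\<^sub>R unit_dir x (next_hit D x u)) \<partial>lborel) \<partial>direction_law (\<nn> x))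
    = ennreal (knudsen_gamma TYPE('n)) * (\<integral>\<^sup>+u. ennreal (u \<bullet> normal0 x) * path_time D B x u \<partial>sphere_law)"
proof -
  let ?v = "normal0 x" and ?\<gamma> = "knudsen_gamma TYPE('n)"
  let ?g = "\<lambda>u. indicator (half_sphere ?v) u * ennreal (?\<gamma> * (u \<bullet> ?v))"
  note pm [measurable] = path_time_measurable[OF D_open B]
  have g [measurable]: "?g \<in> borel_measurable surface_measure" by measurable
  have law: "direction_law (\<nn> x) = density surface_measure ?g"
    using x by (simp add: direction_law_def normal0_def)
  have xF: "x \<in> frontier D" using x R_frontier by blast
  have "(\<integral>\<^sup>+u. (\<integral>\<^sup>+t\<in>{0..hit_time D x u}. indicator B (x + t *\<^sub>R unit_dir x (next_hit D x u)) \<partial>lborel) \<partial>direction_law (\<nn> x))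
      = (\<integral>\<^sup>+u. path_time D B x u \<partial>density surface_measure ?g)"
    unfolding law
  proof (rule nn_integral_cong_AE, subst AE_density[OF g], intro AE_I2 impI)
    fix u assume "0 < ?g u"
    then have "u \<in> half_sphere ?v" by (rule contrapos_pp) simp
    then have "norm u = 1" by (simp add: half_sphere_def)
    then show "(\<integral>\<^sup>+t\<in>{0..hit_time D x u}. indicator B (x + t *\<^sub>R unit_dir x (next_hit D x u)) \<partial>lborel) = path_time D B x u"
      by (intro hit_time_path_time D_open D_bounded xF BD)
  qed
  also have "\<dots> = (\<integral>\<^sup>+u. ?g u * path_time D B x u \<partial>surface_measure)"
    by (rule nn_integral_density) measurable
  also have "\<dots> = (\<integral>\<^sup>+u. ennreal ?\<gamma> * (indicator (sphere 0 1) u * (ennreal (u \<bullet> ?v) * path_time D B x u)) \<partial>surface_measure)"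
  proof (rule nn_integral_cong)
    fix u
    \<comment> \<open>The half sphere is absorbed, since \<open>ennreal\<close> vanishes where
      \<open>u \<bullet> ?v\<close> is not positive. The domain of integration no longer depends on
      \<open>x\<close>, which permits exchanging the integrals.\<close>
    have "?g u = ennreal ?\<gamma> * (indicator (sphere 0 1) u * ennreal (u \<bullet> ?v))"
      using knudsen_gamma_pos[where 'n='n]
      by (cases "u \<bullet> ?v > 0") (auto simp: indicator_def half_sphere_def inner_commute ennreal_neg ennreal_mult)
    then show "?g u * path_time D B x u = ennreal ?\<gamma> * (indicator (sphere 0 1) u * (ennreal (u \<bullet> ?v) * path_time D B x u))"
      by (simp only: mult.assoc)
  qed
  also have "\<dots> = ennreal ?\<gamma> * (\<integral>\<^sup>+u. indicator (sphere 0 1) u * (ennreal (u \<bullet> ?v) * path_time D B x u) \<partial>surface_measure)"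
    by (rule nn_integral_cmult) measurable
  also have "(\<integral>\<^sup>+u. indicator (sphere 0 1) u * (ennreal (u \<bullet> ?v) * path_time D B x u) \<partial>surface_measure)
      = (\<integral>\<^sup>+u. ennreal (u \<bullet> ?v) * path_time D B x u \<partial>sphere_law)"
    by (rule nn_integral_sphere_law[symmetric]) measurable
  finally show ?thesis .
qed

lemma mean_time_borel:
  assumes B: "B \<in> sets borel" and BD: "B \<subseteq> D"
  shows "mean_time D \<nn> B = ennreal (knudsen_kappa TYPE('n)) * (emeasure lebesgue B / emeasure surface_measure (frontier D))"
proof -
  interpret S: sigma_finite_measure "sphere_law :: (real^'n::_) measure" by (rule sigma_finite_sphere_law)
  note pm [measurable] = path_time_measurable[OF D_open B]
  let ?\<gamma> = "ennreal (knudsen_gamma TYPE('n))" and ?H = "emeasure surface_measure (frontier D)"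
  let ?f = "\<lambda>x u. ennreal (u \<bullet> normal0 x) * path_time D B x u"
  let ?K = "\<lambda>x. \<integral>\<^sup>+u. ?f x u \<partial>sphere_law"
  have f: "(\<lambda>(x, u). ?f x u) \<in> borel_measurable (surface_measure \<Otimes>\<^sub>M sphere_law)"
    unfolding split_beta' by measurable
  have K [measurable]: "?K \<in> borel_measurable surface_measure"
    by (rule S.borel_measurable_nn_integral[OF f])
  have fr [measurable]: "frontier D \<in> sets surface_measure" by simp
  have "AE x in surface_measure. x \<notin> frontier D - R"
    using R_full by (intro AE_not_in) (auto simp: null_sets_def)
  then have AE: "AE x in uniform_measure surface_measure (frontier D). x \<in> R"
    unfolding uniform_measure_def
    by (subst AE_density) (measurable, auto elim!: eventually_mono simp: indicator_def split: if_splits)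
  have "mean_time D \<nn> B = (\<integral>\<^sup>+x. ?\<gamma> * ?K x \<partial>uniform_measure surface_measure (frontier D))"
    unfolding mean_time_def knudsen_expectation_def using AE
    by (intro nn_integral_cong_AE) (auto elim!: eventually_mono simp: direction_law_integral[OF B BD])
  also have "\<dots> = (\<integral>\<^sup>+x. ?\<gamma> * ?K x * indicator (frontier D) x \<partial>surface_measure) / ?H"
    by (rule nn_integral_uniform_measure) measurable
  also have "(\<integral>\<^sup>+x. ?\<gamma> * ?K x * indicator (frontier D) x \<partial>surface_measure) = (\<integral>\<^sup>+x. ?\<gamma> * (?K x * indicator R x) \<partial>surface_measure)"
  proof (rule nn_integral_cong)
    fix x
    show "?\<gamma> * ?K x * indicator (frontier D) x = ?\<gamma> * (?K x * indicator R x)"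
    proof (cases "x \<in> R")
      case True
      then show ?thesis using R_frontier by (auto simp: indicator_def)
    next
      case False
      then have "?K x = 0" by (simp add: normal0_def)
      then show ?thesis by simp
    qed
  qed
  also have "\<dots> = ?\<gamma> * (\<integral>\<^sup>+x. ?K x * indicator R x \<partial>surface_measure)"
    by (rule nn_integral_cmult) measurable
  also have "\<dots> = ennreal (knudsen_kappa TYPE('n)) * emeasure lebesgue B"
    unfolding total_time[OF B BD] knudsen_kappa_eq_sphere by (simp only: ac_simps)
  finally show ?thesis by (simp only: ennreal_times_divide)
qed

lemma mean_time_mono:
  assumes "A \<subseteq> B"
  shows "mean_time D \<nn> A \<le> mean_time D \<nn> B"
  unfolding mean_time_def knudsen_expectation_def
  by (intro nn_integral_mono mult_right_mono) (use assms in \<open>auto simp: indicator_def\<close>)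

text \<open>For a Lebesgue set that is not Borel the integrands need not be measurable, but
  \<open>nn_integral\<close> is monotone for arbitrary functions. So \<open>A\<close> is squeezed
  between Borel subsets \<open>S\<close> and \<open>?B\<close> of \<open>D\<close> of equal
  volume.\<close>

lemma mean_time_lebesgue:
  assumes A: "A \<in> sets lebesgue" "A \<subseteq> D"
  shows "mean_time D \<nn> A = ennreal (knudsen_kappa TYPE('n)) * (emeasure lebesgue A / emeasure surface_measure (frontier D))"
proof -
  obtain S N N' where SN: "A = S \<union> N" "N \<subseteq> N'" "N' \<in> null_sets lborel" "S \<in> sets lborel"
    using A(1) by (rule sets_completionE)
  let ?B = "(S \<union> N') \<inter> D"
  have Sb: "S \<in> sets borel" "S \<subseteq> D" using SN A(2) by auto
  have N'b: "N' \<in> sets borel" using SN(3) by (simp add: null_sets_def)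
  have Bb: "?B \<in> sets borel" "?B \<subseteq> D" using Sb N'b by auto
  have sub: "S \<subseteq> A" "A \<subseteq> ?B" using SN A(2) by auto
  have "emeasure lebesgue ?B \<le> emeasure lebesgue (S \<union> N')"
    using Sb N'b by (intro emeasure_mono) auto
  also have "\<dots> = emeasure lborel (S \<union> N')"
    using Sb N'b by simp
  also have "\<dots> = emeasure lborel S"
    using SN by (intro emeasure_Un_null_set) auto
  also have "\<dots> = emeasure lebesgue S" using Sb by simp
  finally have BS: "emeasure lebesgue ?B \<le> emeasure lebesgue S" .
  have SA: "emeasure lebesgue S \<le> emeasure lebesgue A"
    using sub A(1) by (intro emeasure_mono) auto
  have AB: "emeasure lebesgue A \<le> emeasure lebesgue ?B"
    using sub Bb by (intro emeasure_mono) auto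
  have eq: "emeasure lebesgue ?B = emeasure lebesgue A" "emeasure lebesgue S = emeasure lebesgue A"
    using BS SA AB by auto
  show ?thesis
  proof (rule antisym)
    show "mean_time D \<nn> A \<le> ennreal (knudsen_kappa TYPE('n)) * (emeasure lebesgue A / emeasure surface_measure (frontier D))"
      using mean_time_mono[OF sub(2)] by (simp only: mean_time_borel[OF Bb] eq)
    show "ennreal (knudsen_kappa TYPE('n)) * (emeasure lebesgue A / emeasure surface_measure (frontier D)) \<le> mean_time D \<nn> A"
      using mean_time_mono[OF sub(1)] by (simp only: mean_time_borel[OF Sb] eq)
  qed
qed

end

theorem theorem2p6:
  fixes D R :: "(real^'n::{finite,wellorder}) set"
    and \<nn> :: "real^'n::_ \<Rightarrow> real^'n::_"
  assumes dim: "CARD('n) \<ge> 2"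
    and domain: "open D" "connected D"
    and lipschitz: "lipschitz_boundary D"
    and regular_open: "openin (top_of_set (frontier D)) R"
    and regular_full: "emeasure surface_measure (frontier D - R) = 0"
    and regular_C1: "\<And>x. x \<in> R \<Longrightarrow> locally_C1_at (frontier D) x"
    and normal: "\<And>x. x \<in> R \<Longrightarrow> inward_unit_normal D x (\<nn> x)"
    and bounded: "bounded D"
  shows "(\<forall>A \<in> sets lebesgue. A \<subseteq> D \<longrightarrow>
           mean_time D \<nn> A =
             ennreal (knudsen_kappa TYPE('n)) *
               (emeasure lebesgue A / emeasure surface_measure (frontier D))) \<and>
         knudsen_kappa TYPE('n) =
           pi powr (1/2) * Gamma ((real CARD('n) + 1) / 2) * real CARD('n)
             / Gamma (real CARD('n) / 2 + 1) \<and>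
         mean_time D \<nn> D =
           ennreal (knudsen_kappa TYPE('n)) *
             (emeasure lebesgue D / emeasure surface_measure (frontier D))"
proof -
  obtain U \<phi> \<phi>' where C1: "\<And>i::nat. C1_parametrization (frontier D) (U i) (\<phi> i) (\<phi>' i)"
    and cover: "R \<subseteq> (\<Union>i. \<phi> i ` U i)"
    using countable_parametrizations[OF regular_C1] by blast
  have "\<forall>i. \<exists>\<psi>. c1_chart (U i) (\<phi> i) (\<phi>' i) \<psi>"
    using C1_parametrization_chart[OF C1] by simp
  then obtain \<psi> where chart: "\<And>i. c1_chart (U i) (\<phi> i) (\<phi>' i) (\<psi> i)"
    by metis
  interpret knudsen_charts D R \<nn> U \<phi> \<phi>' \<psi>
    by (rule knudsen_charts.intro) (fact domain bounded lipschitz regular_open regular_full normal C1 chart cover)+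
  have "D \<in> sets lebesgue" using domain(1) by simp
  then show ?thesis
    using mean_time_lebesgue knudsen_kappa_formula by blast
qed


end
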